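(* Let $\varphi^{L}\colon MU_{*}\otimes\mathbb{Q}\to M_{*}^{\mathbb{Q}}(G)$ be the rational genus determined by $$\log_{\varphi^{L}}'(x)=\sum_{k\ge 0}\varphi^{L}[\mathbb{C}P^{k}]\,x^{k}=\sum_{k\ge 0}P_{k}(\alpha,\beta)\,x^{4k},$$ i.e. $\varphi^{L}[\mathbb{C}P^{l}]=P_{l/4}(\alpha,\beta)$ if $4\mid l$ and $\varphi^L[\mathbb{C}P^l]=0$ otherwise. Then for each prime $p\equiv 1 \bmod 4$, the image of $BP_*$ under $\varphi^{L}$ is contained in the subring of $p$-local automorphic forms: $$\varphi^{L}(BP_* )\subset M^{\mathbb{Z}_{(p)}}_*(G)\cong\mathbb{Z}_{(p)}[\alpha,\beta].$$
   Context: Group: $U(1,1;\mathbb{Z}[i])$ is the group of matrices $g$ with entries in $\mathbb{Z}[i]$ satisfying $\bar g^{tr}Hg=H$, $H=\mathrm{diag}(1,-1)$. Put $g_0=\frac{1}{\sqrt2}\begin{pmatrix}1&i\\ i&1\end{pmatrix}$ and $G=g_0\,U(1,1;\mathbb{Z}[i])\,g_0^{-1}\subset GL_2(\mathbb{C})$, which acts on the upper half plane $\mathbb{H}_1$ by fractional linear transformations. Automorphic forms: an automorphic form of weight $k$ for $G$ is a holomorphic function $f$ on $\mathbb{H}_1$ with $f(\frac{a\tau+b}{c\tau+d})=(c\tau+d)^kf(\tau)$ for all $\begin{pmatrix}a&b\\c&d\end{pmatrix}\in G$, holomorphic at the unique cusp $i\infty$ (i.e. with a power series expansion in $q^{1/2}$,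 $q=e^{2\pi i\tau}$). Its degree is twice its weight. $M^{\mathbb{C}}_*(G)$ is the ring of automorphic forms graded by degree; for a ring $\mathbb{Z}\subseteq R\subseteq\mathbb{C}$, $M^R_*(G)$ is the subring of forms with expansions in $R[\![q^{1/2}]\!]$. The forms $\alpha,\beta$: let $\theta[\begin{smallmatrix}1\\0\end{smallmatrix}](\tau)=\sum_{n\in\mathbb{Z}}e^{\pi i(n+1/2)^2\tau}$, $\theta[\begin{smallmatrix}0\\1\end{smallmatrix}](\tau)=\sum_{n\in\mathbb{Z}}(-1)^ne^{\pi i n^2\tau}$, $\delta'=\frac18(\theta[\begin{smallmatrix}1\\0\end{smallmatrix}]^4-\theta[\begin{smallmatrix}0\\1\end{smallmatrix}]^4)$, $\epsilon'=-\frac1{16}\theta[\begin{smallmatrix}1\\0\end{smallmatrix}]^4\theta[\begin{smallmatrix}0\\1\end{smallmatrix}]^4$; then $\alpha=-2^7(\epsilon'-\frac12\delta'^2)$ and $\beta=2^{12}\delta'^4$ are automorphic forms for $G$ of weight $4$ and $8$ respectively. Legendre polynomials: the homogeneous Legendre polynomials $P_k(\alpha,\beta)$ are given by $(1-2\alpha u+\beta u^2)^{-1/2}=\sum_{k\ge0}P_k(\alpha,\beta)u^k$. Bordism: $MU_*\otimes\mathbb{Q}$ is the polynomial $\mathbb{Q}$-algebra on the classes $[\mathbb{C}P^k]$, $k\ge1$; a rational genus is a ring homomorphism out of it, and its logarithm is $\log_\varphi(x)=\sum_{k\ge0}\varphi[\mathbb{C}P^k]\frac{x^{k+1}}{k+1}$.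 For a prime $p$, $BP_*=\mathbb{Z}_{(p)}[v_1,v_2,\dots]\subset MU_*\otimes\mathbb{Q}$ is the subring generated over $\mathbb{Z}_{(p)}$ by the Hazewinkel generators defined by $p\,\ell_n=\sum_{0\le j<n}\ell_j v_{n-j}^{p^j}$, where $\ell_j=[\mathbb{C}P^{p^j-1}]/p^j$, $\ell_0=1$. *)

theory Defs
  imports
    "HOL-Analysis.Analysis"
    "HOL-Complex_Analysis.Complex_Analysis"
    "HOL-Library.Poly_Mapping"
    "HOL-Library.Function_Algebras"
    "HOL-Computational_Algebra.Formal_Power_Series"
    "HOL-Computational_Algebra.Primes"
    "HOL-Algebra.QuotRing"
    "HOL-Algebra.Generated_Rings"
begin

no_notation fps_nth (infixl \<open>$\<close> 75)

section \<open>Rings carried by a type class\<close>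

definition ring_of :: "'a::comm_ring_1 set \<Rightarrow> 'a ring"
  where "ring_of S = \<lparr>carrier = S, mult = (*), one = 1, zero = 0, add = (+)\<rparr>"

lemma cring_ring_of_UNIV: "cring (ring_of (UNIV :: 'a::comm_ring_1 set))"
proof (intro cringI abelian_groupI comm_monoidI)
  fix x :: 'a
  show "\<exists>y\<in>carrier (ring_of UNIV). y \<oplus>\<^bsub>ring_of UNIV\<^esub> x = \<zero>\<^bsub>ring_of UNIV\<^esub>"
    by (rule bexI[of _ "- x"]) (auto simp: ring_of_def)
qed (auto simp: ring_of_def algebra_simps)

text \<open>The localization of the integers at p, inside the rationals.\<close>

definition Zloc :: "nat \<Rightarrow> rat set"
  where "Zloc p = {of_int a / of_int b |a b. \<not> int p dvd b}"

section \<open>The group G\<close>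

definition gauss_ints :: "complex set"
  where "gauss_ints = {z. Re z \<in> \<int> \<and> Im z \<in> \<int>}"

definition Hform :: "complex^2^2"
  where "Hform = vector [vector [1, 0], vector [0, -1]]"

definition conj_tr :: "complex^2^2 \<Rightarrow> complex^2^2"
  where "conj_tr g = (\<chi> i j. cnj (g $ j $ i))"

definition U11 :: "(complex^2^2) set"
  where "U11 = {g. (\<forall>i j. g $ i $ j \<in> gauss_ints) \<and> conj_tr g ** Hform ** g = Hform}"

definition g0 :: "complex^2^2"
  where "g0 = (1 / sqrt 2) *\<^sub>R vector [vector [1, \<i>], vector [\<i>, 1]]"

definition G :: "(complex^2^2) set"
  where "G = (\<lambda>g. g0 ** g ** matrix_inv g0) ` U11"

section \<open>Automorphic forms\<close>

text \<open>Functions on the upper half plane are functions on a type of its own, so that they form a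
  commutative ring under the pointwise operations of \<^theory>\<open>HOL-Library.Function_Algebras\<close>.\<close>

typedef uhp = "{z::complex. Im z > 0}"
  by (rule exI[of _ \<i>]) simp

text \<open>Every element of G is a unimodular scalar times a real matrix of determinant 1, so the
  quotient below lies in the upper half plane and the abstraction map is applied to a legal value.\<close>

definition moebius :: "complex^2^2 \<Rightarrow> uhp \<Rightarrow> uhp"
  where "moebius g \<tau> = Abs_uhp ((g $ 1 $ 1 * Rep_uhp \<tau> + g $ 1 $ 2) / (g $ 2 $ 1 * Rep_uhp \<tau> + g $ 2 $ 2))"

text \<open>Expansion in powers of the square root \<open>exp (\<pi> \<i> \<tau>)\<close> of q.\<close>

definition has_q_expansion :: "(uhp \<Rightarrow> complex) \<Rightarrow> (nat \<Rightarrow> complex) \<Rightarrow> bool"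
  where "has_q_expansion f c \<longleftrightarrow>
    (\<forall>\<tau>. (\<lambda>n. c n * exp (of_real pi * \<i> * Rep_uhp \<tau>) ^ n) sums f \<tau>)"

definition automorphic_form :: "int \<Rightarrow> (uhp \<Rightarrow> complex) \<Rightarrow> bool"
  where "automorphic_form k f \<longleftrightarrow>
    (\<lambda>z. f (Abs_uhp z)) holomorphic_on {z. Im z > 0} \<and>
    (\<forall>g\<in>G. \<forall>\<tau>. f (moebius g \<tau>) = (g $ 2 $ 1 * Rep_uhp \<tau> + g $ 2 $ 2) powi k * f \<tau>) \<and>
    (\<exists>c. has_q_expansion f c)"

text \<open>Elements of the graded ring are finitely supported families of functions, indexed by the
  degree (twice the weight); the product of \<^theory>\<open>HOL-Library.Poly_Mapping\<close> is
  the convolution product, i.e. the product of the external direct sum.\<close>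

type_synonym graded = "int \<Rightarrow>\<^sub>0 (uhp \<Rightarrow> complex)"

definition forms_of_degree :: "complex set \<Rightarrow> int \<Rightarrow> (uhp \<Rightarrow> complex) set"
  where "forms_of_degree R d =
    (if even d then {f. automorphic_form (d div 2) f \<and> (\<exists>c. range c \<subseteq> R \<and> has_q_expansion f c)}
     else {0})"

definition MG :: "complex set \<Rightarrow> graded set"
  where "MG R = {F. \<forall>d. Poly_Mapping.lookup F d \<in> forms_of_degree R d}"

definition graded_const :: "rat \<Rightarrow> graded"
  where "graded_const r = Poly_Mapping.single 0 (\<lambda>_. of_rat r)"

section \<open>The forms \<open>\<alpha>\<close> and \<open>\<beta>\<close>\<close>

definition theta10 :: "uhp \<Rightarrow> complex"
  where "theta10 \<tau> = (\<Sum>\<^sub>\<infinity>n\<in>(UNIV::int set). exp (of_real pi * \<i> * (of_int n + 1/2)^2 * Rep_uhp \<tau>))"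

definition theta01 :: "uhp \<Rightarrow> complex"
  where "theta01 \<tau> = (\<Sum>\<^sub>\<infinity>n\<in>(UNIV::int set). (-1) powi n * exp (of_real pi * \<i> * (of_int n)^2 * Rep_uhp \<tau>))"

definition delta' :: "uhp \<Rightarrow> complex"
  where "delta' \<tau> = 1/8 * (theta10 \<tau> ^ 4 - theta01 \<tau> ^ 4)"

definition epsilon' :: "uhp \<Rightarrow> complex"
  where "epsilon' \<tau> = - (1/16) * theta10 \<tau> ^ 4 * theta01 \<tau> ^ 4"

definition alpha_fun :: "uhp \<Rightarrow> complex"
  where "alpha_fun \<tau> = - (2^7) * (epsilon' \<tau> - 1/2 * delta' \<tau> ^ 2)"

definition beta_fun :: "uhp \<Rightarrow> complex"
  where "beta_fun \<tau> = 2^12 * delta' \<tau> ^ 4"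

definition alpha :: graded
  where "alpha = Poly_Mapping.single 8 alpha_fun"

definition beta :: graded
  where "beta = Poly_Mapping.single 16 beta_fun"

section \<open>Polynomials in two indeterminates and the Legendre polynomials\<close>

datatype indet = A | B

type_synonym 'v qpoly = "('v \<Rightarrow>\<^sub>0 nat) \<Rightarrow>\<^sub>0 rat"

definition qconst :: "rat \<Rightarrow> 'v qpoly"
  where "qconst r = Poly_Mapping.single 0 r"

definition qvar :: "'v \<Rightarrow> 'v qpoly"
  where "qvar v = Poly_Mapping.single (Poly_Mapping.single v 1) 1"

definition polys_over :: "rat set \<Rightarrow> 'v qpoly set"
  where "polys_over R = {P. \<forall>m. Poly_Mapping.lookup P m \<in> R}"

definition eval_at :: "('v \<Rightarrow> graded) \<Rightarrow> 'v qpoly \<Rightarrow> graded"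
  where "eval_at x P = (\<Sum>m\<in>Poly_Mapping.keys P.
    graded_const (Poly_Mapping.lookup P m) * (\<Prod>v\<in>Poly_Mapping.keys m. x v ^ Poly_Mapping.lookup m v))"

definition eval_alpha_beta :: "indet qpoly \<Rightarrow> graded"
  where "eval_alpha_beta = eval_at (case_indet alpha beta)"

text \<open>The generating series \<open>(1 - 2 A u + B u\<^sup>2) powr (-1/2)\<close>, as the binomial series
  \<open>(1 + X) powr (-1/2)\<close> composed with \<open>- 2 A u + B u\<^sup>2\<close>.\<close>

definition legendre_series :: "indet qpoly fps"
  where "legendre_series =
    Abs_fps (\<lambda>n. qconst (fps_nth (fps_binomial (- 1/2)) n)) oo
    (fps_const (qvar B) * fps_X ^ 2 - fps_const (2 * qvar A) * fps_X)"

definition legendre :: "nat \<Rightarrow> indet qpoly"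
  where "legendre k = fps_nth legendre_series k"

section \<open>Rational bordism, genera and Brown-Peterson homology\<close>

text \<open>The indeterminate with index k is the class of \<open>CP\<^bsup>k+1\<^esup>\<close>.\<close>

type_synonym MUQ = "nat qpoly"

definition CP :: "nat \<Rightarrow> MUQ"
  where "CP k = (if k = 0 then 1 else qvar (k - 1))"

definition rational_genera :: "complex set \<Rightarrow> (MUQ \<Rightarrow> graded) set"
  where "rational_genera R = ring_hom (ring_of UNIV) (ring_of (MG R))"

definition genus_log :: "(MUQ \<Rightarrow> graded) \<Rightarrow> graded fps"
  where "genus_log \<phi> =
    Abs_fps (\<lambda>n. case n of 0 \<Rightarrow> 0 | Suc k \<Rightarrow> graded_const (1 / of_nat (k + 1)) * \<phi> (CP k))"

text \<open>The series \<open>\<Sum>k. P\<^sub>k(\<alpha>,\<beta>) x\<^bsup>4k\<^esup>\<close>.\<close>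

definition legendre_log_deriv :: "graded fps"
  where "legendre_log_deriv = Abs_fps (\<lambda>k. eval_alpha_beta (legendre k)) oo fps_X ^ 4"

definition is_legendre_genus :: "(MUQ \<Rightarrow> graded) \<Rightarrow> bool"
  where "is_legendre_genus \<phi> \<longleftrightarrow>
    \<phi> \<in> rational_genera \<rat> \<and> fps_deriv (genus_log \<phi>) = legendre_log_deriv"

definition ell :: "nat \<Rightarrow> nat \<Rightarrow> MUQ"
  where "ell p j = qconst (1 / of_nat (p ^ j)) * CP (p ^ j - 1)"

text \<open>Hazewinkel's relation solved for the generator with index n; only indices
  \<open>n \<ge> 1\<close> are meaningful.\<close>

fun hazewinkel :: "nat \<Rightarrow> nat \<Rightarrow> MUQ"
  where "hazewinkel p n =
    of_nat p * ell p n - (\<Sum>j = 1..<n. ell p j * hazewinkel p (n - j) ^ (p ^ j))"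

declare hazewinkel.simps [simp del]

lemma ell_0: "ell p 0 = 1"
  by (simp add: ell_def CP_def qconst_def)

lemma hazewinkel_relation:
  assumes "n \<ge> 1"
  shows "of_nat p * ell p n = (\<Sum>j<n. ell p j * hazewinkel p (n - j) ^ (p ^ j))"
proof -
  have "{..<n} = insert 0 {1..<n}"
    using assms by auto
  then show ?thesis
    by (simp add: ell_0 hazewinkel.simps[of p n])
qed

definition BP :: "nat \<Rightarrow> MUQ set"
  where "BP p = generate_ring (ring_of UNIV) (qconst ` Zloc p \<union> hazewinkel p ` {1..})"

end

theory Submission
  imports Defs "HOL-Probability.Distributions"
begin

text \<open>
  Integrality: by a two-way form of the functional equation lemma, a p-typical logarithm with
  coefficients \<open>l\<^sub>n\<close> has integral Hazewinkel generators iff it has integral coefficients in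
  Honda's relation, which uses a Frobenius lift instead of p-th powers. The Legendre polynomial
  \<open>P\<^sub>k\<close> is the central coefficient of \<open>F\<^sup>k\<close> with
  \<open>F = t\<^sup>2 + A t + (A\<^sup>2 - B)/4\<close>. For \<open>p = 4 c + 1\<close>, the logarithm with coefficients
  \<open>F\<^bsup>(p\<^sup>n - 1)/4\<^esup> / p\<^sup>n\<close> has the integral Hazewinkel generators \<open>F\<^bsup>c\<^esup>, 0, 0, \<dots>\<close>,
  and Honda's relation survives taking central coefficients.

  Automorphic forms: with \<open>x = \<theta>[1,0]\<^sup>4\<close> and \<open>y = \<theta>[0,1]\<^sup>4\<close> one has
  \<open>\<alpha> = x\<^sup>2 + 6 x y + y\<^sup>2\<close>, \<open>\<beta> = (x - y)\<^sup>4\<close> and \<open>\<alpha>\<^sup>2 - \<beta> = 16 x y (x + y)\<^sup>2\<close>. Modulo scalars,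
  G is generated by \<open>\<tau> \<mapsto> \<tau> + 2\<close> and the rotation \<open>\<tau> \<mapsto> (\<tau> - 1)/(\<tau> + 1)\<close> of order 4,
  whose effect on theta constants is a combination of the inversion formula and Landen's
  transformation. The inversion formula itself follows from Landen's transformation by comparing
  two arithmetic-geometric mean iterations on the imaginary axis. The form \<open>\<alpha>\<^sup>2 - \<beta>\<close>
  has no zeros and a simple zero at the cusp with leading coefficient 256, so that every form is,
  modulo a multiple of \<open>\<alpha>\<^sup>2 - \<beta>\<close>, a multiple of a power of \<open>\<alpha>\<close>; there are no forms of negative
  weight by the maximum principle.
\<close>

section \<open>Commutative ring homomorphisms and subrings\<close>

text \<open>The obstacle: taking the central coefficient of a power of F is additive but not
  multiplicative, so Hazewinkel's relation with its p^j-th powers does not pass through it. Honda's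
  relation is linear in the Frobenius twists of the logarithm. A twist by \<sigma>^m leaves only
  exponents divisible by p^m; since the m-th Honda coefficient has degree at most 2k with k = (p^m -
  1)/4 < p^m, a single product contributes to the centre. The condition p = 1 mod 4 makes all
  exponents (p^n - 1)/4 integral and leaves one generator in the recursion for F^((p^n - 1)/4). It
  also makes p odd, which puts 1/4 and 1/256 into the p-local integers: the first places F over
  them, the second keeps division by \<alpha>^2 - \<beta> p-local. On the analytic side, the
  inversion formula is needed only for squares of theta constants and, by analytic continuation,
  only on the imaginary axis, where real monotonicity arguments suffice. The one asymptotic input at
  0 is that sqrt y \<theta>_3(i y) tends to 1, a Riemann sum for the Gaussian integral.\<close>

locale comm_ring_hom =
  fixes h :: "'a::comm_ring_1 \<Rightarrow> 'b::comm_ring_1"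
  assumes hom_one [simp]: "h 1 = 1"
    and hom_add: "h (x + y) = h x + h y"
    and hom_mult: "h (x * y) = h x * h y"
begin

lemma hom_zero [simp]: "h 0 = 0"
  using hom_add[of 0 0] by simp

lemma hom_uminus: "h (- x) = - h x"
  using hom_add[of x "- x"] by (simp add: minus_unique)

lemma hom_diff: "h (x - y) = h x - h y"
  using hom_add[of x "- y"] by (simp add: hom_uminus)

lemma hom_sum: "h (sum f I) = (\<Sum>i\<in>I. h (f i))"
  by (induction I rule: infinite_finite_induct) (simp_all add: hom_add)

lemma hom_prod: "h (prod f I) = (\<Prod>i\<in>I. h (f i))"
  by (induction I rule: infinite_finite_induct) (simp_all add: hom_mult)

lemma hom_power: "h (x ^ n) = h x ^ n"
  by (induction n) (simp_all add: hom_mult)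

lemma hom_of_nat [simp]: "h (of_nat n) = of_nat n"
  by (induction n) (simp_all add: hom_add)

lemma hom_numeral [simp]: "h (numeral n) = numeral n"
  using hom_of_nat[of "numeral n"] by simp

lemma hom_of_int [simp]: "h (of_int n) = of_int n"
  by (cases n rule: int_diff_cases) (simp add: hom_diff)

end

lemma comm_ring_hom_comp:
  "comm_ring_hom f \<Longrightarrow> comm_ring_hom g \<Longrightarrow> comm_ring_hom (\<lambda>x. f (g x))"
  by (simp add: comm_ring_hom_def)

lemma comm_ring_hom_funpow: "comm_ring_hom (f :: 'a::comm_ring_1 \<Rightarrow> 'a) \<Longrightarrow> comm_ring_hom (f ^^ n)"
  by (induction n) (simp_all add: comm_ring_hom_def)

locale unital_subring =
  fixes S :: "'a::comm_ring_1 set"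
  assumes one_mem [simp]: "1 \<in> S"
    and diff_mem: "x \<in> S \<Longrightarrow> y \<in> S \<Longrightarrow> x - y \<in> S"
    and mult_mem: "x \<in> S \<Longrightarrow> y \<in> S \<Longrightarrow> x * y \<in> S"
begin

lemma zero_mem [simp]: "0 \<in> S"
  using diff_mem[of 1 1] by simp

lemma uminus_mem: "x \<in> S \<Longrightarrow> - x \<in> S"
  using diff_mem[of 0 x] by simp

lemma add_mem: "x \<in> S \<Longrightarrow> y \<in> S \<Longrightarrow> x + y \<in> S"
  using diff_mem[of x "- y"] uminus_mem by simp

lemma sum_mem: "(\<And>i. i \<in> I \<Longrightarrow> f i \<in> S) \<Longrightarrow> sum f I \<in> S"
  by (induction I rule: infinite_finite_induct) (auto intro: add_mem)

lemma prod_mem: "(\<And>i. i \<in> I \<Longrightarrow> f i \<in> S) \<Longrightarrow> prod f I \<in> S"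
  by (induction I rule: infinite_finite_induct) (auto intro: mult_mem)

lemma power_mem: "x \<in> S \<Longrightarrow> x ^ n \<in> S"
  by (induction n) (auto intro: mult_mem)

lemma of_nat_mem [simp]: "of_nat n \<in> S"
  by (induction n) (auto intro: add_mem)

lemma numeral_mem [simp]: "numeral n \<in> S"
  using of_nat_mem[of "numeral n"] by simp

lemma of_int_mem [simp]: "of_int n \<in> S"
  by (cases n rule: int_diff_cases) (auto intro: diff_mem)

end

lemma unital_subring_image:
  assumes "comm_ring_hom h" "unital_subring S"
  shows "unital_subring (h ` S)"
proof -
  interpret h: comm_ring_hom h by fact
  interpret S: unital_subring S by fact
  show ?thesis
  proof
    show "1 \<in> h ` S" by (rule image_eqI[of _ _ 1]) auto
  qed (auto simp flip: h.hom_diff h.hom_mult intro!: S.diff_mem S.mult_mem)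
qed

section \<open>Evaluation of polynomials\<close>

definition monom_at :: "('v \<Rightarrow> 'b::comm_ring_1) \<Rightarrow> ('v \<Rightarrow>\<^sub>0 nat) \<Rightarrow> 'b"
  where "monom_at x m = (\<Prod>v\<in>Poly_Mapping.keys m. x v ^ Poly_Mapping.lookup m v)"

text \<open>The coefficient map is a parameter so that one development covers the evaluation at
  \<alpha> and \<beta>, the Frobenius lift and the genus.\<close>

definition peval :: "(rat \<Rightarrow> 'b) \<Rightarrow> ('v \<Rightarrow> 'b::comm_ring_1) \<Rightarrow> 'v qpoly \<Rightarrow> 'b"
  where "peval c x P = (\<Sum>m\<in>Poly_Mapping.keys P. c (Poly_Mapping.lookup P m) * monom_at x m)"

lemma monom_at_superset:
  assumes "finite K" "Poly_Mapping.keys m \<subseteq> K"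
  shows "monom_at x m = (\<Prod>v\<in>K. x v ^ Poly_Mapping.lookup m v)"
  unfolding monom_at_def using assms
  by (intro prod.mono_neutral_left) (auto simp: in_keys_iff)

lemma monom_at_0 [simp]: "monom_at x 0 = 1"
  by (simp add: monom_at_def)

lemma monom_at_add: "monom_at x (m + n) = monom_at x m * monom_at x n"
proof -
  let ?K = "Poly_Mapping.keys m \<union> Poly_Mapping.keys n"
  have "Poly_Mapping.keys (m + n) \<subseteq> ?K" by (rule keys_add)
  then show ?thesis
    by (simp add: monom_at_superset[of ?K] lookup_add power_add prod.distrib)
qed

lemma monom_at_single [simp]: "monom_at x (Poly_Mapping.single v k) = x v ^ k"
  by (simp add: monom_at_def)

lemma poly_mapping_sum_single:
  "P = (\<Sum>m\<in>Poly_Mapping.keys P. Poly_Mapping.single m (Poly_Mapping.lookup P m))"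
  by (rule poly_mapping_eqI) (auto simp: lookup_sum lookup_single when_def not_in_keys_iff_lookup_eq_zero)

context
  fixes c :: "rat \<Rightarrow> 'b::comm_ring_1" and x :: "'v \<Rightarrow> 'b"
  assumes c: "comm_ring_hom c"
begin

interpretation c: comm_ring_hom c by (rule c)

lemma peval_superset:
  assumes "finite K" "Poly_Mapping.keys P \<subseteq> K"
  shows "peval c x P = (\<Sum>m\<in>K. c (Poly_Mapping.lookup P m) * monom_at x m)"
  unfolding peval_def using assms
  by (intro sum.mono_neutral_left) (auto simp: in_keys_iff)

lemma peval_add: "peval c x (P + Q) = peval c x P + peval c x Q"
proof -
  let ?K = "Poly_Mapping.keys P \<union> Poly_Mapping.keys Q"
  have "Poly_Mapping.keys (P + Q) \<subseteq> ?K" by (rule keys_add)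
  then show ?thesis
    by (simp add: peval_superset[of ?K] lookup_add c.hom_add distrib_right sum.distrib)
qed

lemma peval_0 [simp]: "peval c x 0 = 0"
  by (simp add: peval_def)

lemma peval_sum: "peval c x (sum f I) = (\<Sum>i\<in>I. peval c x (f i))"
  by (induction I rule: infinite_finite_induct) (simp_all add: peval_add)

lemma peval_single: "peval c x (Poly_Mapping.single m r) = c r * monom_at x m"
  by (cases "r = 0") (simp_all add: peval_def)

lemma peval_mult: "peval c x (P * Q) = peval c x P * peval c x Q"
proof -
  have "peval c x (P * Q) = (\<Sum>m\<in>Poly_Mapping.keys P. \<Sum>n\<in>Poly_Mapping.keys Q.
      peval c x (Poly_Mapping.single m (Poly_Mapping.lookup P m) * Poly_Mapping.single n (Poly_Mapping.lookup Q n)))"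
    by (subst poly_mapping_sum_single[of P], subst poly_mapping_sum_single[of Q])
       (simp add: sum_product peval_sum)
  also have "\<dots> = peval c x P * peval c x Q"
    unfolding peval_def[of c x P] peval_def[of c x Q] sum_product
    by (simp add: mult_single peval_single monom_at_add c.hom_mult mult_ac)
  finally show ?thesis .
qed

lemma comm_ring_hom_peval: "comm_ring_hom (peval c x)"
proof
  show "peval c x 1 = 1"
    using peval_single[of 0 1] by simp
qed (simp_all add: peval_add peval_mult)

lemma peval_qconst [simp]: "peval c x (qconst r) = c r"
  by (simp add: qconst_def peval_single)

lemma peval_qvar [simp]: "peval c x (qvar v) = x v"
  by (simp add: qvar_def peval_single)

end

lemma comm_ring_hom_qconst: "comm_ring_hom qconst"
  by unfold_locales (simp_all add: qconst_def single_add mult_single)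

interpretation qconst: comm_ring_hom qconst
  by (rule comm_ring_hom_qconst)

lemma qvar_power: "qvar v ^ k = Poly_Mapping.single (Poly_Mapping.single v k) 1"
  by (induction k) (simp_all add: qvar_def mult_single flip: single_add)

lemma monom_at_qvar: "monom_at qvar m = Poly_Mapping.single m 1"
proof -
  have *: "(\<Prod>v\<in>K. Poly_Mapping.single (f v) (1::rat)) = Poly_Mapping.single (sum f K) 1"
    if "finite K" for K and f :: "'a \<Rightarrow> 'a \<Rightarrow>\<^sub>0 nat"
    using that by (induction K) (simp_all add: mult_single)
  show ?thesis
    by (simp add: monom_at_def qvar_power * flip: poly_mapping_sum_single)
qed

lemma peval_id: "peval qconst qvar P = P"
  by (subst (3) poly_mapping_sum_single)
     (simp add: peval_def monom_at_qvar qconst_def mult_single)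

lemma hom_eq_peval:
  assumes "comm_ring_hom h"
  shows "h P = peval (\<lambda>r. h (qconst r)) (\<lambda>v. h (qvar v)) P"
proof -
  interpret h: comm_ring_hom h by fact
  have "h P = h (peval qconst qvar P)" by (simp add: peval_id)
  also have "\<dots> = peval (\<lambda>r. h (qconst r)) (\<lambda>v. h (qvar v)) P"
    by (simp add: peval_def monom_at_def h.hom_sum h.hom_mult h.hom_prod h.hom_power)
  finally show ?thesis .
qed

text \<open>In the target the denominator b has the inverse \<open>k (1 / of_int b)\<close>, so both
  images of r = a/b are the only solution of x b = a.\<close>

lemma qpoly_hom_of_rat:
  fixes h :: "'v qpoly \<Rightarrow> 'b::comm_ring_1"
  assumes "comm_ring_hom h" "comm_ring_hom k"
  shows "h (qconst r) = k r"
proof -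
  interpret h: comm_ring_hom h by fact
  interpret k: comm_ring_hom k by fact
  obtain a b where r: "quotient_of r = (a, b)" by (cases "quotient_of r")
  then have b: "b \<noteq> 0" and r': "r = of_int a / of_int b"
    using quotient_of_denom_pos quotient_of_div by (fastforce, blast)
  have "r * of_int b = of_int a" using b r' by simp
  then have 1: "h (qconst r) * of_int b = of_int a" "k r * of_int b = of_int a"
    by (metis h.hom_mult h.hom_of_int qconst.hom_mult qconst.hom_of_int,
        metis k.hom_mult k.hom_of_int)
  have "of_int b * k (1 / of_int b) = 1"
    using b by (metis k.hom_mult k.hom_of_int k.hom_one nonzero_mult_div_cancel_left
        of_int_eq_0_iff times_divide_eq_right mult.right_neutral)
  then show ?thesis using 1 by (metis mult.assoc mult.right_neutral)
qed

lemma peval_mem: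
  assumes "unital_subring T" "comm_ring_hom c"
    and "\<And>m. c (Poly_Mapping.lookup P m) \<in> T" "\<And>v. x v \<in> T"
  shows "peval c x P \<in> T"
proof -
  interpret T: unital_subring T by fact
  show ?thesis
    unfolding peval_def monom_at_def
    by (intro T.sum_mem T.mult_mem T.prod_mem T.power_mem assms)
qed

lemma unital_subring_polys_over:
  assumes "unital_subring R"
  shows "unital_subring (polys_over R :: 'v qpoly set)"
proof -
  interpret R: unital_subring R by fact
  show ?thesis
  proof
    show "(1 :: 'v qpoly) \<in> polys_over R"
      by (auto simp: polys_over_def lookup_one when_def)
    fix P Q :: "'v qpoly" assume PQ: "P \<in> polys_over R" "Q \<in> polys_over R"
    then show "P - Q \<in> polys_over R"
      by (auto simp: polys_over_def lookup_minus intro: R.diff_mem)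
    have "P * Q = (\<Sum>m\<in>Poly_Mapping.keys P. \<Sum>n\<in>Poly_Mapping.keys Q. Poly_Mapping.single (m + n)
            (Poly_Mapping.lookup P m * Poly_Mapping.lookup Q n))"
      by (subst poly_mapping_sum_single[of P], subst poly_mapping_sum_single[of Q])
         (simp add: sum_product mult_single)
    then show "P * Q \<in> polys_over R"
      using PQ by (auto simp: polys_over_def lookup_sum lookup_single when_def intro!: R.sum_mem R.mult_mem)
  qed
qed

lemma qconst_mem_polys_over: "0 \<in> R \<Longrightarrow> r \<in> R \<Longrightarrow> qconst r \<in> polys_over R"
  by (auto simp: qconst_def polys_over_def lookup_single when_def)

lemma qvar_mem_polys_over: "0 \<in> R \<Longrightarrow> 1 \<in> R \<Longrightarrow> qvar v \<in> polys_over R"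
  by (auto simp: qvar_def polys_over_def lookup_single when_def)

section \<open>The p-local integers\<close>

lemma Zloc_I: "\<not> int p dvd b \<Longrightarrow> of_int a / of_int b \<in> Zloc p"
  by (auto simp: Zloc_def)

lemma unital_subring_Zloc:
  assumes "prime p"
  shows "unital_subring (Zloc p)"
proof
  have p: "prime (int p)" using assms by simp
  have dvd: "\<not> int p dvd b * d" if "\<not> int p dvd b" "\<not> int p dvd d" for b d
    using that p prime_dvd_mult_iff by blast
  have "\<not> int p dvd 1" using p by (auto dest: not_prime_unit)
  then show "1 \<in> Zloc p" using Zloc_I[of p 1 1] by simp
  fix x y assume "x \<in> Zloc p" "y \<in> Zloc p"
  then obtain a b c d where x: "x = of_int a / of_int b" "\<not> int p dvd b"
    and y: "y = of_int c / of_int d" "\<not> int p dvd d"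
    unfolding Zloc_def by blast
  then have nz: "b \<noteq> 0" "d \<noteq> 0" by auto
  have "x - y = of_int (a * d - c * b) / of_int (b * d)"
    using nz by (simp add: x y field_simps)
  then show "x - y \<in> Zloc p" unfolding Zloc_def using dvd x y by blast
  have "x * y = of_int (a * c) / of_int (b * d)"
    by (simp add: x y)
  then show "x * y \<in> Zloc p" unfolding Zloc_def using dvd x y by blast
qed

section \<open>The functional equation lemma\<close>

text \<open>\<open>S\<close> consists of the integral elements of a ring in which p has the inverse
  \<open>q\<close>: logarithms live in the large ring, integrality is membership in
  \<open>S\<close>, and \<open>\<sigma>\<close> lifts the p-th power map modulo p.\<close>

locale frobenius_lift = S: unital_subring S + \<sigma>: comm_ring_hom \<sigma>
  for S :: "'a::comm_ring_1 set" and \<sigma> :: "'a \<Rightarrow> 'a" +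
  fixes p :: nat and q :: 'a
  assumes inv_p: "of_nat p * q = 1"
    and sigma_mem: "x \<in> S \<Longrightarrow> \<sigma> x \<in> S"
    and sigma_cong: "x \<in> S \<Longrightarrow> \<exists>s\<in>S. \<sigma> x - x ^ p = of_nat p * s"
begin

text \<open>Congruence modulo p^j S. Both members are required to be integral, so that congruences
  can be multiplied.\<close>

definition eqm :: "nat \<Rightarrow> 'a \<Rightarrow> 'a \<Rightarrow> bool"
  where "eqm j x y \<longleftrightarrow> x \<in> S \<and> y \<in> S \<and> (\<exists>s\<in>S. x - y = of_nat p ^ j * s)"

lemma eqm_refl: "x \<in> S \<Longrightarrow> eqm j x x"
  by (auto simp: eqm_def intro: bexI[of _ 0])

lemma eqm_trans:
  assumes "eqm j x y" "eqm j y z"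
  shows "eqm j x z"
proof -
  obtain s t where "s \<in> S" "t \<in> S" "x - y = of_nat p ^ j * s" "y - z = of_nat p ^ j * t"
    using assms by (auto simp: eqm_def)
  moreover have "x - z = (x - y) + (y - z)" by simp
  ultimately have "x - z = of_nat p ^ j * (s + t)" "s + t \<in> S"
    by (simp_all only: distrib_left S.add_mem)
  then show ?thesis using assms unfolding eqm_def by blast
qed

lemma eqm_add:
  assumes "eqm j x y" "eqm j x' y'"
  shows "eqm j (x + x') (y + y')"
proof -
  obtain s t where "s \<in> S" "t \<in> S" "x - y = of_nat p ^ j * s" "x' - y' = of_nat p ^ j * t"
    using assms by (auto simp: eqm_def)
  then have "x + x' - (y + y') = of_nat p ^ j * (s + t)" "s + t \<in> S"
    by (auto simp: algebra_simps S.add_mem)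
  then show ?thesis using assms unfolding eqm_def by (blast intro: S.add_mem)
qed

lemma eqm_mult:
  assumes "eqm j x y" "eqm j x' y'"
  shows "eqm j (x * x') (y * y')"
proof -
  obtain s t where st: "s \<in> S" "t \<in> S" "x - y = of_nat p ^ j * s" "x' - y' = of_nat p ^ j * t"
    using assms by (auto simp: eqm_def)
  have mem: "x \<in> S" "y \<in> S" "x' \<in> S" "y' \<in> S" using assms by (auto simp: eqm_def)
  have "x * x' - y * y' = (x - y) * x' + y * (x' - y')" by (simp add: algebra_simps)
  also have "\<dots> = of_nat p ^ j * (s * x' + y * t)" unfolding st by (simp add: algebra_simps)
  finally have "x * x' - y * y' = of_nat p ^ j * (s * x' + y * t)" .
  moreover have "s * x' + y * t \<in> S" using st mem by (auto intro: S.add_mem S.mult_mem)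
  ultimately show ?thesis using mem unfolding eqm_def by (blast intro: S.mult_mem)
qed

lemma eqm_power: "eqm j x y \<Longrightarrow> eqm j (x ^ n) (y ^ n)"
  by (induction n) (auto intro: eqm_mult eqm_refl)

lemma eqm_sum: "(\<And>i. i \<in> I \<Longrightarrow> eqm j (f i) (g i)) \<Longrightarrow> eqm j (sum f I) (sum g I)"
  by (induction I rule: infinite_finite_induct) (auto intro: eqm_add eqm_refl)

text \<open>Factor x^p - y^p as x - y times a sum of p terms. Modulo p each term is y^(p - 1), so
  the sum is divisible by p and contributes one further power.\<close>

lemma eqm_power_p:
  assumes "eqm (Suc j) x y"
  shows "eqm (Suc (Suc j)) (x ^ p) (y ^ p)"
proof -
  have mem: "x \<in> S" "y \<in> S" using assms by (auto simp: eqm_def)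
  obtain s where s: "s \<in> S" "x - y = of_nat p ^ Suc j * s" using assms by (auto simp: eqm_def)
  have "eqm 1 x y" unfolding eqm_def using s mem
    by (intro conjI mem bexI[of _ "of_nat p ^ j * s"])
       (simp add: mult.assoc, intro S.mult_mem S.power_mem S.of_nat_mem, assumption)
  then have "eqm 1 (\<Sum>i<p. y ^ (p - Suc i) * x ^ i) (\<Sum>i<p. y ^ (p - Suc i) * y ^ i)"
    using mem by (intro eqm_sum eqm_mult eqm_power eqm_refl)
  then obtain t where t: "t \<in> S"
    "(\<Sum>i<p. y ^ (p - Suc i) * x ^ i) - (\<Sum>i<p. y ^ (p - Suc i) * y ^ i) = of_nat p * t"
    by (auto simp: eqm_def)
  have "(\<Sum>i<p. y ^ (p - Suc i) * y ^ i) = (\<Sum>i<p. y ^ (p - 1))"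
    by (intro sum.cong) (auto simp flip: power_add)
  then have "(\<Sum>i<p. y ^ (p - Suc i) * x ^ i) = of_nat p * (t + y ^ (p - 1))"
    using t(2) by (simp add: algebra_simps)
  then have "x ^ p - y ^ p = of_nat p ^ Suc (Suc j) * (s * (t + y ^ (p - 1)))"
    by (subst power_diff_sumr2) (simp add: s algebra_simps)
  moreover have "s * (t + y ^ (p - 1)) \<in> S"
    using s t mem by (auto intro: S.mult_mem S.add_mem S.power_mem)
  ultimately show ?thesis using mem unfolding eqm_def by (blast intro: S.power_mem)
qed

text \<open>The gain of i powers of p compensates the denominator p^i of \<open>l i\<close> in
  \<open>haz_honda_diff\<close>.\<close>

lemma eqm_power_p_power: "eqm 1 x y \<Longrightarrow> eqm (Suc i) (x ^ (p ^ i)) (y ^ (p ^ i))"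
proof (induction i)
  case (Suc i)
  then have "eqm (Suc (Suc i)) ((x ^ (p ^ i)) ^ p) ((y ^ (p ^ i)) ^ p)" by (intro eqm_power_p) simp
  moreover have "(x ^ (p ^ i)) ^ p = x ^ (p ^ Suc i)" for x :: 'a
    by (simp only: power_Suc2 flip: power_mult)
  ultimately show ?case by simp
qed simp

lemma sigma_pow_mem: "x \<in> S \<Longrightarrow> (\<sigma> ^^ m) x \<in> S"
  by (induction m) (auto intro: sigma_mem)

lemma eqm_sigma_pow: "x \<in> S \<Longrightarrow> eqm 1 ((\<sigma> ^^ m) x) (x ^ (p ^ m))"
proof (induction m)
  case (Suc m)
  let ?y = "(\<sigma> ^^ m) x"
  have y: "?y \<in> S" using Suc sigma_pow_mem by blast
  have "eqm 1 (\<sigma> ?y) (?y ^ p)"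
    using y sigma_cong[OF y] by (auto simp: eqm_def sigma_mem S.power_mem)
  moreover have "eqm 1 (?y ^ p) ((x ^ (p ^ m)) ^ p)" using Suc by (intro eqm_power) auto
  ultimately have "eqm 1 (\<sigma> ?y) ((x ^ (p ^ m)) ^ p)" by (rule eqm_trans)
  moreover have "(x ^ (p ^ m)) ^ p = x ^ (p ^ Suc m)"
    by (simp only: power_Suc2 flip: power_mult)
  ultimately show ?case by simp
qed (simp add: eqm_refl)

lemma cancel_p:
  fixes x y :: 'a
  assumes "of_nat p * x = of_nat p * y"
  shows "x = y"
proof -
  have "z = q * (of_nat p * z)" for z :: 'a
    using inv_p by (simp add: mult.commute flip: mult.assoc)
  from this[of x] this[of y] show ?thesis using assms by simp
qed

sublocale sigma_pow: comm_ring_hom "\<sigma> ^^ m" for m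
  by (rule comm_ring_hom_funpow[OF \<sigma>.comm_ring_hom_axioms])

text \<open>Hazewinkel's recursion, with \<open>p\<^bsup>j\<^esup>\<close>-th powers, and Honda's, with the Frobenius lift,
  describe the same p-integral logarithms: the two sequences of coefficients differ
  by integral elements, step by step.\<close>

context
  fixes l v w :: "nat \<Rightarrow> 'a"
  assumes l0: "l 0 = 1"
    and haz: "\<And>n. n \<ge> 1 \<Longrightarrow> of_nat p * l n = (\<Sum>j<n. l j * v (n - j) ^ (p ^ j))"
    and honda: "\<And>n. n \<ge> 1 \<Longrightarrow> of_nat p * l n = (\<Sum>m=1..n. w m * (\<sigma> ^^ m) (l (n - m)))"
begin

text \<open>Each step of Hazewinkel's recursion divides by p once, so the denominator of
  \<open>l n\<close> is at most p^n.\<close>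

lemma l_mem:
  assumes "\<And>i. 1 \<le> i \<Longrightarrow> i \<le> n \<Longrightarrow> v i \<in> S"
  shows "of_nat p ^ n * l n \<in> S"
  using assms
proof (induction n rule: less_induct)
  case (less n)
  show ?case
  proof (cases n)
    case 0 then show ?thesis by (simp add: l0)
  next
    case (Suc k)
    have "of_nat p ^ n * l n = of_nat p ^ k * (of_nat p * l n)" by (simp add: Suc mult_ac)
    also have "\<dots> = (\<Sum>j<n. of_nat p ^ (k - j) * (of_nat p ^ j * l j) * v (n - j) ^ (p ^ j))"
    proof (subst haz)
      show "of_nat p ^ k * (\<Sum>j<n. l j * v (n - j) ^ (p ^ j))
          = (\<Sum>j<n. of_nat p ^ (k - j) * (of_nat p ^ j * l j) * v (n - j) ^ (p ^ j))"
        unfolding sum_distrib_left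
      proof (intro sum.cong refl)
        fix j assume "j \<in> {..<n}"
        then have "of_nat p ^ k = (of_nat p ^ (k - j) * of_nat p ^ j :: 'a)"
          by (simp add: Suc flip: power_add)
        then show "of_nat p ^ k * (l j * v (n - j) ^ (p ^ j))
            = of_nat p ^ (k - j) * (of_nat p ^ j * l j) * v (n - j) ^ (p ^ j)"
          by (simp add: mult_ac)
      qed
    qed (simp add: Suc)
    also have "\<dots> \<in> S"
    proof (intro S.sum_mem)
      fix j assume j: "j \<in> {..<n}"
      then have "of_nat p ^ j * l j \<in> S" "v (n - j) \<in> S" using less by auto
      then show "of_nat p ^ (k - j) * (of_nat p ^ j * l j) * v (n - j) ^ (p ^ j) \<in> S"
        by (intro S.mult_mem[OF S.mult_mem[OF S.power_mem]] S.power_mem) simp_all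
    qed
    finally show ?thesis .
  qed
qed

text \<open>Isolating v n and w n in the two relations leaves w n - v n = T - U. Expand p T by
  Honda's relation and p U by Hazewinkel's: both become sums of w_m \<sigma>^m(l_i) times v^(p^(m +
  i)) in one case and \<sigma>^m(v)^(p^i) in the other. These powers agree modulo p^(i + 1); the
  factor p^i clears the denominator of l_i and the remaining p cancels the one in p (T - U).\<close>

lemma haz_honda_diff:
  assumes n: "n \<ge> 1" and v: "\<And>i. 1 \<le> i \<Longrightarrow> i < n \<Longrightarrow> v i \<in> S" and w: "\<And>i. 1 \<le> i \<Longrightarrow> i < n \<Longrightarrow> w i \<in> S"
  shows "w n - v n \<in> S"
proof -
  define T where "T = (\<Sum>j=1..<n. l j * v (n - j) ^ (p ^ j))"
  define U where "U = (\<Sum>m=1..<n. w m * (\<sigma> ^^ m) (l (n - m)))"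
  have "{..<n} = insert 0 {1..<n}" using n by auto
  then have "of_nat p * l n = v n + T"
    using haz[OF n] by (simp add: T_def l0)
  moreover have "{1..n} = insert n {1..<n}" using n by auto
  then have "of_nat p * l n = w n + U"
    using honda[OF n] sigma_pow.hom_one
    by (simp add: U_def l0)
  ultimately have diff: "w n - v n = T - U" by (simp add: algebra_simps)
  let ?X = "\<lambda>m i. w m * (\<sigma> ^^ m) (l i)"
  have "of_nat p * T = (\<Sum>j=1..<n. (of_nat p * l j) * v (n - j) ^ (p ^ j))"
    by (simp add: T_def sum_distrib_left mult_ac)
  also have "\<dots> = (\<Sum>j=1..<n. \<Sum>m=1..j. ?X m (j - m) * v (n - j) ^ (p ^ j))"
    by (intro sum.cong refl, subst honda) (auto simp: sum_distrib_right)
  \<comment> \<open>Exchange the sums with i = j - m, so that the pairs (m, i) match those in the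
    expansion of p U.\<close>
  also have "\<dots> = (\<Sum>m=1..<n. \<Sum>i<n - m. ?X m i * v (n - m - i) ^ (p ^ (m + i)))"
    unfolding sum.Sigma[OF finite_atLeastLessThan ballI[OF finite_lessThan]]
      sum.Sigma[OF finite_atLeastLessThan ballI[OF finite_atLeastAtMost]]
    by (rule sum.reindex_bij_witness[of _ "\<lambda>(m, i). (m + i, m)" "\<lambda>(j, m). (m, j - m)"]) auto
  finally have T: "of_nat p * T = \<dots>" .
  have "of_nat p * U = (\<Sum>m=1..<n. w m * (\<sigma> ^^ m) (of_nat p * l (n - m)))"
    by (simp add: U_def sum_distrib_left mult_ac
        sigma_pow.hom_mult
        sigma_pow.hom_of_nat)
  also have "\<dots> = (\<Sum>m=1..<n. \<Sum>i<n - m. ?X m i * (\<sigma> ^^ m) (v (n - m - i)) ^ (p ^ i))"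
    by (intro sum.cong refl, subst haz)
      (auto simp: sum_distrib_left mult_ac
        sigma_pow.hom_mult
        sigma_pow.hom_sum
        sigma_pow.hom_power)
  finally have U: "of_nat p * U = \<dots>" .
  have "\<exists>s\<in>S. ?X m i * v (n - m - i) ^ (p ^ (m + i)) - ?X m i * (\<sigma> ^^ m) (v (n - m - i)) ^ (p ^ i)
      = of_nat p * s" if "m \<in> {1..<n}" "i < n - m" for m i
  proof -
    have vS: "v (n - m - i) \<in> S" using that by (intro v) auto
    have li: "of_nat p ^ i * l i \<in> S" using that by (intro l_mem v) auto
    have "eqm (Suc i) ((\<sigma> ^^ m) (v (n - m - i)) ^ (p ^ i)) ((v (n - m - i) ^ (p ^ m)) ^ (p ^ i))"
      by (intro eqm_power_p_power eqm_sigma_pow vS)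
    then obtain s where s: "s \<in> S"
      "(\<sigma> ^^ m) (v (n - m - i)) ^ (p ^ i) - v (n - m - i) ^ (p ^ (m + i)) = of_nat p ^ Suc i * s"
      by (auto simp: eqm_def power_add power_mult)
    have "?X m i * v (n - m - i) ^ (p ^ (m + i)) - ?X m i * (\<sigma> ^^ m) (v (n - m - i)) ^ (p ^ i)
       = - (?X m i * ((\<sigma> ^^ m) (v (n - m - i)) ^ (p ^ i) - v (n - m - i) ^ (p ^ (m + i))))"
      by (simp add: algebra_simps)
    also have "\<dots> = of_nat p * (- (w m * (\<sigma> ^^ m) (of_nat p ^ i * l i) * s))"
      unfolding s(2)
      by (simp add: mult_ac sigma_pow.hom_mult
        sigma_pow.hom_of_nat
        sigma_pow.hom_power)
    finally show ?thesis
      using that w[of m] li s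
      by (intro bexI[of _ "- (w m * (\<sigma> ^^ m) (of_nat p ^ i * l i) * s)"])
         (auto intro!: S.uminus_mem S.mult_mem sigma_pow_mem)
  qed
  then obtain s where s: "\<And>m i. m \<in> {1..<n} \<Longrightarrow> i < n - m \<Longrightarrow> s m i \<in> S \<and>
      ?X m i * v (n - m - i) ^ (p ^ (m + i)) - ?X m i * (\<sigma> ^^ m) (v (n - m - i)) ^ (p ^ i) = of_nat p * s m i"
    by metis
  have "of_nat p * (T - U) = of_nat p * (\<Sum>m=1..<n. \<Sum>i<n - m. s m i)"
    unfolding right_diff_distrib T U sum_subtractf[symmetric] sum_distrib_left
    using s by (intro sum.cong) auto
  then have "T - U = (\<Sum>m=1..<n. \<Sum>i<n - m. s m i)" by (rule cancel_p)
  also have "\<dots> \<in> S" using s by (intro S.sum_mem) auto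
  finally show ?thesis by (simp add: diff)
qed

text \<open>Both directions get used: from Hazewinkel to Honda over polynomials in t, and back again
  after taking central coefficients.\<close>

lemma haz_iff_honda: "(\<forall>n\<ge>1. v n \<in> S) \<longleftrightarrow> (\<forall>n\<ge>1. w n \<in> S)"
proof -
  have main: "v n \<in> S \<and> w n \<in> S" if "n \<ge> 1" and vw: "(\<forall>n\<ge>1. v n \<in> S) \<or> (\<forall>n\<ge>1. w n \<in> S)" for n
    using that(1)
  proof (induction n rule: less_induct)
    case (less n)
    then have d: "w n - v n \<in> S" by (intro haz_honda_diff) auto
    from vw show ?case
    proof
      assume "\<forall>n\<ge>1. v n \<in> S"
      then have "v n \<in> S" using less.prems by simp
      then show ?thesis using S.add_mem[OF d, of "v n"] by simp
    next
      assume "\<forall>n\<ge>1. w n \<in> S"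
      then have "w n \<in> S" using less.prems by simp
      then show ?thesis using S.diff_mem[OF _ d, of "w n"] by simp
    qed
  qed
  show ?thesis
  proof
    assume "\<forall>n\<ge>1. v n \<in> S"
    then show "\<forall>n\<ge>1. w n \<in> S" by (intro allI impI conjunct2[OF main]) simp_all
  next
    assume "\<forall>n\<ge>1. w n \<in> S"
    then show "\<forall>n\<ge>1. v n \<in> S" by (intro allI impI conjunct1[OF main]) simp_all
  qed
qed

end

end

section \<open>Legendre polynomials as central coefficients\<close>

text \<open>Ordering the indeterminates orders the monomials, so that \<open>indet qpoly\<close> is
  an integral domain and the rules for composing power series apply.\<close>

instantiation indet :: linorder
begin

definition less_eq_indet :: "indet \<Rightarrow> indet \<Rightarrow> bool"
  where "less_eq_indet x y \<longleftrightarrow> x = A \<or> y = B"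

definition less_indet :: "indet \<Rightarrow> indet \<Rightarrow> bool"
  where "less_indet x y \<longleftrightarrow> x = A \<and> y = B"

instance
proof
  fix x y z :: indet
  show "x \<le> x" "(x < y) = (x \<le> y \<and> \<not> y \<le> x)" "x \<le> y \<or> y \<le> x"
    by (cases x; cases y; simp add: less_eq_indet_def less_indet_def)+
  show "x \<le> y \<Longrightarrow> y \<le> x \<Longrightarrow> x = y"
    by (cases x; cases y; simp add: less_eq_indet_def)
  show "x \<le> y \<Longrightarrow> y \<le> z \<Longrightarrow> x \<le> z"
    by (cases x; cases y; cases z; simp add: less_eq_indet_def)
qed

end

abbreviation vA :: "indet qpoly" where "vA \<equiv> qvar A"
abbreviation vB :: "indet qpoly" where "vB \<equiv> qvar B"

lemma qconst_half: "2 * qconst (1/2) = 1"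
  using qconst.hom_mult[of 2 "1/2"] by simp

text \<open>The binomial series b = (1 + X)^(-1/2) satisfies b' (1 + X) = -b/2 by its coefficient
  recursion; compose with h = B u^2 - 2 A u and use the chain rule.\<close>

lemma legendre_series_ODE:
  "fps_deriv legendre_series * (1 - fps_const (2 * vA) * fps_X + fps_const vB * fps_X ^ 2)
    = (fps_const vA - fps_const vB * fps_X) * legendre_series"
proof -
  define b where "b = Abs_fps (\<lambda>n. qconst (fps_nth (fps_binomial (- 1/2)) n) :: indet qpoly)"
  define h where "h = fps_const vB * fps_X ^ 2 - fps_const (2 * vA) * fps_X"
  have h0: "fps_nth h 0 = 0" by (simp add: h_def)
  have L: "legendre_series = b oo h"
    by (simp add: legendre_series_def b_def h_def)
  have b_ODE: "fps_deriv b * (1 + fps_X) = fps_const (qconst (- 1/2)) * b"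
  proof (rule fps_ext)
    fix n
    have "of_nat (Suc n) * ((- 1/2 :: rat) gchoose Suc n) + of_nat n * ((- 1/2) gchoose n)
        = - 1/2 * ((- 1/2) gchoose n)"
      using gbinomial_mult_1[of "- 1/2 :: rat" n] by simp
    then have "qconst (of_nat (Suc n) * ((- 1/2 :: rat) gchoose Suc n) + of_nat n * ((- 1/2) gchoose n))
        = (qconst (- 1/2 * ((- 1/2) gchoose n)) :: indet qpoly)" by (rule arg_cong)
    then show "fps_nth (fps_deriv b * (1 + fps_X)) n = fps_nth (fps_const (qconst (- 1/2)) * b) n"
      unfolding qconst.hom_add qconst.hom_mult qconst.hom_of_nat
      by (cases n) (simp_all add: b_def distrib_left qconst.hom_uminus)
  qed
  have "(fps_deriv b oo h) * (1 + h) = (fps_deriv b * (1 + fps_X)) oo h"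
    using h0 by (simp add: fps_compose_mult_distrib fps_compose_add_distrib)
  also have "\<dots> = fps_const (qconst (- 1/2)) * legendre_series"
    unfolding b_ODE L using h0 by (simp add: fps_compose_mult_distrib)
  finally have *: "(fps_deriv b oo h) * (1 + h) = fps_const (qconst (- 1/2)) * legendre_series" .
  have "fps_deriv h = fps_const 2 * (fps_const vB * fps_X - fps_const vA)"
    by (simp add: h_def power2_eq_square algebra_simps flip: fps_const_mult numeral_fps_const)
  then have "fps_deriv legendre_series * (1 + h)
      = ((fps_deriv b oo h) * (1 + h)) * (fps_const 2 * (fps_const vB * fps_X - fps_const vA))"
    using fps_compose_deriv[OF h0, of b] by (simp add: L mult_ac)
  also have "\<dots> = fps_const (2 * qconst (1/2)) * (fps_const vA - fps_const vB * fps_X) * legendre_series"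
    unfolding * by (simp add: qconst.hom_uminus algebra_simps flip: fps_const_neg fps_const_mult)
  finally show ?thesis
    by (simp add: qconst_half h_def algebra_simps)
qed

lemma legendre_0: "legendre 0 = 1"
  by (simp add: legendre_def legendre_series_def)

text \<open>Bonnet's recursion, the coefficient of u^n in the differential equation. At n = 0 the
  truncated index n - 1 comes with the factor 0.\<close>

lemma legendre_Suc:
  "of_nat (Suc n) * legendre (Suc n)
    = of_nat (2 * n + 1) * vA * legendre n - of_nat n * vB * legendre (n - 1)"
proof -
  have 1: "fps_deriv legendre_series * (1 - fps_const (2 * vA) * fps_X + fps_const vB * fps_X ^ 2)
    = fps_deriv legendre_series - fps_const (2 * vA) * (fps_X * fps_deriv legendre_series)
      + fps_const vB * (fps_X * (fps_X * fps_deriv legendre_series))"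
    by (simp add: algebra_simps power2_eq_square)
  have 2: "(fps_const vA - fps_const vB * fps_X) * legendre_series
    = fps_const vA * legendre_series - fps_const vB * (fps_X * legendre_series)"
    by (simp add: algebra_simps)
  have "fps_nth (fps_deriv legendre_series - fps_const (2 * vA) * (fps_X * fps_deriv legendre_series)
      + fps_const vB * (fps_X * (fps_X * fps_deriv legendre_series))) n
    = fps_nth (fps_const vA * legendre_series - fps_const vB * (fps_X * legendre_series)) n"
    using legendre_series_ODE unfolding 1 2 by simp
  then show ?thesis
    by (cases n; cases "n - 1") (simp_all add: legendre_def, simp_all add: algebra_simps)
qed

section \<open>Central coefficients of powers of a quadratic polynomial\<close>

lemma Suc_times_central_binomial:
  "Suc i * (2 * Suc i choose Suc i) = 2 * (2 * i + 1) * (2 * i choose i)"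
proof -
  have "Suc i * (Suc (Suc (2 * i)) choose Suc i) = Suc (Suc (2 * i)) * (Suc (2 * i) choose i)"
    by (rule Suc_times_binomial)
  also have "Suc (2 * i) choose i = Suc (2 * i) choose Suc i"
    by (subst binomial_symmetric) auto
  finally have "Suc i * (2 * Suc i choose Suc i) = 2 * Suc i * (Suc (2 * i) choose Suc i)"
    by simp
  then have "Suc i * (Suc i * (2 * Suc i choose Suc i)) = 2 * Suc i * (Suc i * (Suc (2 * i) choose Suc i))"
    by (simp only: mult_ac)
  also have "\<dots> = 2 * Suc i * (Suc (2 * i) * (2 * i choose i))"
    by (simp only: Suc_times_binomial)
  finally have "Suc i * (Suc i * (2 * Suc i choose Suc i)) = Suc i * (2 * (2 * i + 1) * (2 * i choose i))"
    by (simp only: mult_ac Suc_eq_plus1)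
  then show ?thesis by (simp only: mult_cancel1) simp
qed

text \<open>The multinomial number k!/(i! i! (k - 2i)!), which counts the term a^(k - 2i) d^i at t^k
  in (t^2 + a t + d)^k.\<close>

definition trinom :: "nat \<Rightarrow> nat \<Rightarrow> nat"
  where "trinom k i = (2 * i choose i) * (k choose (2 * i))"

lemma trinom_eq_0: "k < 2 * i \<Longrightarrow> trinom k i = 0"
  by (simp add: trinom_def binomial_eq_0)

text \<open>Bonnet's recursion coefficient by coefficient. Pascal's rule reduces everything to three
  neighbouring binomials X, Y, Z of n and two central ones c, d; their two absorption identities
  become applicable after multiplying by 2i + 1.\<close>

lemma trinom_Suc:
  "int (Suc (Suc n)) * int (trinom (Suc (Suc n)) (Suc i)) + int (Suc n) * int (trinom n (Suc i))
    = int (2 * n + 3) * int (trinom (Suc n) (Suc i)) + 4 * int (Suc n) * int (trinom n i)"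
proof -
  define X Y Z where "X = int (n choose Suc (Suc (2 * i)))" and "Y = int (n choose Suc (2 * i))"
    and "Z = int (n choose (2 * i))"
  define c d where "c = int (2 * Suc i choose Suc i)" and "d = int (2 * i choose i)"
  have "Suc (2 * i) * (n choose Suc (2 * i)) = (n - 2 * i) * (n choose (2 * i))"
    by (simp only: binomial_absorb_comp flip: binomial_absorption)
  then have "int (Suc (2 * i)) * Y = int (n - 2 * i) * Z"
    unfolding Y_def Z_def by (metis of_nat_mult)
  moreover have "int (n - 2 * i) * Z = (int n - 2 * int i) * Z"
    by (cases "2 * i \<le> n") (auto simp: Z_def of_nat_diff)
  moreover have "int (Suc (2 * i)) = 2 * int i + 1" by simp
  ultimately have YZ: "(2 * int i + 1) * Y = (int n - 2 * int i) * Z" by metis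
  have "(int i + 1) * c = 2 * (2 * int i + 1) * d"
    unfolding c_def d_def using arg_cong[OF Suc_times_central_binomial[of i], of int]
    by (simp only: of_nat_mult of_nat_add of_nat_Suc of_nat_numeral of_nat_1 add.commute)
  then have cd: "2 * (2 * int i + 1) * d = (int i + 1) * c" by simp
  have "(2 * int i + 1) * ((int n + 2) * (c * (X + 2 * Y + Z)) + (int n + 1) * (c * X))
      = (2 * int i + 1) * ((2 * int n + 3) * (c * (X + Y)) + 4 * (int n + 1) * (d * Z))"
  proof -
    have "(2 * int i + 1) * ((int n + 2) * (c * (X + 2 * Y + Z)) + (int n + 1) * (c * X))
        - (2 * int i + 1) * ((2 * int n + 3) * (c * (X + Y)) + 4 * (int n + 1) * (d * Z))
      = c * ((2 * int i + 1) * Y - (int n - 2 * int i) * Z)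
        - 2 * (int n + 1) * Z * (2 * (2 * int i + 1) * d - (int i + 1) * c)"
      by (simp add: algebra_simps)
    then show ?thesis unfolding YZ cd by simp
  qed
  then have "(int n + 2) * (c * (X + 2 * Y + Z)) + (int n + 1) * (c * X)
      = (2 * int n + 3) * (c * (X + Y)) + 4 * (int n + 1) * (d * Z)" by simp
  then show ?thesis
    by (simp add: trinom_def X_def Y_def Z_def c_def d_def algebra_simps)
qed

text \<open>For 2i > k the factor \<open>trinom k i\<close> is 0, which makes the truncated exponent
  harmless.\<close>

definition trinom_poly :: "'a::comm_ring_1 \<Rightarrow> 'a \<Rightarrow> nat \<Rightarrow> 'a"
  where "trinom_poly a d k = (\<Sum>i\<le>k. of_nat (trinom k i) * a ^ (k - 2 * i) * d ^ i)"

lemma trinom_poly_bound: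
  "k \<le> N \<Longrightarrow> trinom_poly a d k = (\<Sum>i\<le>N. of_nat (trinom k i) * a ^ (k - 2 * i) * d ^ i)"
  unfolding trinom_poly_def by (rule sum.mono_neutral_left) (auto simp: trinom_def binomial_eq_0)

lemma trinom_poly_Suc:
  "of_nat (Suc (Suc n)) * trinom_poly a d (Suc (Suc n))
    = of_nat (2 * n + 3) * a * trinom_poly a d (Suc n) - of_nat (Suc n) * (a ^ 2 - 4 * d) * trinom_poly a d n"
proof -
  let ?t = "\<lambda>k i. of_nat (trinom k i) :: 'a"
  let ?a = "\<lambda>i. a ^ (Suc (Suc n) - 2 * i)"
  have 1: "of_nat (Suc (Suc n)) * trinom_poly a d (Suc (Suc n))
     = (\<Sum>i\<le>Suc (Suc n). of_nat (Suc (Suc n)) * ?t (Suc (Suc n)) i * ?a i * d ^ i)"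
    by (simp only: trinom_poly_def sum_distrib_left mult.assoc)
  have e: "?t k i * (a ^ (k - 2 * i) * a ^ (Suc (Suc n) - k)) = ?t k i * ?a i"
    if "k \<le> Suc (Suc n)" for k i
  proof (cases "2 * i \<le> k")
    case True
    then have "k - 2 * i + (Suc (Suc n) - k) = Suc (Suc n) - 2 * i" using that by simp
    then show ?thesis by (simp only: power_add[symmetric])
  qed (simp add: trinom_def binomial_eq_0)
  have 2: "of_nat (2 * n + 3) * a * trinom_poly a d (Suc n)
     = (\<Sum>i\<le>Suc (Suc n). of_nat (2 * n + 3) * ?t (Suc n) i * ?a i * d ^ i)"
  proof -
    have "of_nat (2 * n + 3) * a * trinom_poly a d (Suc n)
      = (\<Sum>i\<le>Suc (Suc n). of_nat (2 * n + 3) * (?t (Suc n) i * (a ^ (Suc n - 2 * i) * a ^ (Suc (Suc n) - Suc n))) * d ^ i)"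
      by (subst trinom_poly_bound[of _ "Suc (Suc n)"]) (simp_all only: sum_distrib_left mult_ac, simp_all add: mult_ac)
    then show ?thesis by (subst (asm) e) (simp, simp only: mult.assoc)
  qed
  have 3: "of_nat (Suc n) * a ^ 2 * trinom_poly a d n
     = (\<Sum>i\<le>Suc (Suc n). of_nat (Suc n) * ?t n i * ?a i * d ^ i)"
  proof -
    have "of_nat (Suc n) * a ^ 2 * trinom_poly a d n
      = (\<Sum>i\<le>Suc (Suc n). of_nat (Suc n) * (?t n i * (a ^ (n - 2 * i) * a ^ (Suc (Suc n) - n))) * d ^ i)"
      by (subst trinom_poly_bound[of _ "Suc (Suc n)"]) (simp_all only: sum_distrib_left mult_ac, simp_all add: mult_ac Suc_diff_le power2_eq_square)
    then show ?thesis by (subst (asm) e) (simp, simp only: mult.assoc)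
  qed
  have 4: "of_nat (Suc n) * (4 * d) * trinom_poly a d n
     = (\<Sum>i\<le>Suc n. 4 * of_nat (Suc n) * ?t n i * ?a (Suc i) * d ^ Suc i)"
    by (subst trinom_poly_bound[of _ "Suc n"], simp, unfold sum_distrib_left,
        intro sum.cong refl, simp add: mult_ac)
  have rec: "of_nat (Suc (Suc n)) * ?t (Suc (Suc n)) (Suc i) + of_nat (Suc n) * ?t n (Suc i)
      = of_nat (2 * n + 3) * ?t (Suc n) (Suc i) + 4 * of_nat (Suc n) * ?t n i" for i
    using arg_cong[OF trinom_Suc[of n i], of "of_int :: int \<Rightarrow> 'a"]
    by (simp only: of_int_add of_int_mult of_int_of_nat_eq of_int_numeral)
  have "of_nat (Suc (Suc n)) * trinom_poly a d (Suc (Suc n)) + of_nat (Suc n) * a ^ 2 * trinom_poly a d n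
     = of_nat (2 * n + 3) * a * trinom_poly a d (Suc n) + of_nat (Suc n) * (4 * d) * trinom_poly a d n"
  proof -
    have "(\<Sum>i\<le>Suc n. of_nat (Suc (Suc n)) * ?t (Suc (Suc n)) (Suc i) * ?a (Suc i) * d ^ Suc i)
        + (\<Sum>i\<le>Suc n. of_nat (Suc n) * ?t n (Suc i) * ?a (Suc i) * d ^ Suc i)
      = (\<Sum>i\<le>Suc n. (of_nat (Suc (Suc n)) * ?t (Suc (Suc n)) (Suc i) + of_nat (Suc n) * ?t n (Suc i))
          * ?a (Suc i) * d ^ Suc i)"
      by (simp only: sum.distrib distrib_right)
    also have "\<dots> = (\<Sum>i\<le>Suc n. of_nat (2 * n + 3) * ?t (Suc n) (Suc i) * ?a (Suc i) * d ^ Suc i)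
        + (\<Sum>i\<le>Suc n. 4 * of_nat (Suc n) * ?t n i * ?a (Suc i) * d ^ Suc i)"
      by (simp only: rec sum.distrib distrib_right)
    finally show ?thesis
      unfolding 1 2 3 4 sum.atMost_Suc_shift[of _ "Suc n"]
      by (simp add: trinom_def algebra_simps del: sum.atMost_Suc power_Suc)
  qed
  then show ?thesis by (simp add: algebra_simps)
qed


text \<open>Both sides satisfy the same three-term recursion, because d = (A^2 - B)/4 makes the
  discriminant a^2 - 4d equal to B. The leading factor n is cancelled with the rational constant
  1/n.\<close>

lemma legendre_eq_trinom_poly: "legendre n = trinom_poly vA ((vA ^ 2 - vB) * qconst (1/4)) n"
proof (induction n rule: less_induct)
  case (less n)
  let ?d = "(vA ^ 2 - vB) * qconst (1/4)"
  have "4 * qconst (1/4) = (1 :: indet qpoly)"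
    using qconst.hom_mult[of 4 "1/4"] by simp
  then have "4 * ?d = vA ^ 2 - vB" by (simp add: mult.left_commute)
  then have d: "vA ^ 2 - 4 * ?d = vB" by (simp only:) simp
  consider "n = 0" | "n = 1" | m where "n = Suc (Suc m)"
    by (metis One_nat_def not0_implies_Suc)
  then show ?case
  proof cases
    case 1 then show ?thesis by (simp add: legendre_0 trinom_poly_def trinom_def)
  next
    case 2 then show ?thesis
      using legendre_Suc[of 0] by (simp add: legendre_0 trinom_poly_def trinom_def)
  next
    case (3 m)
    have "of_nat (Suc (Suc m)) * legendre n = of_nat (Suc (Suc m)) * trinom_poly vA ?d n"
      using legendre_Suc[of "Suc m"] less.IH[of m] less.IH[of "Suc m"]
      by (simp only: 3 trinom_poly_Suc d lessI less_SucI diff_Suc_1) simp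
    then have "qconst (1 / of_nat (Suc (Suc m))) * (of_nat (Suc (Suc m)) * legendre n)
      = qconst (1 / of_nat (Suc (Suc m))) * (of_nat (Suc (Suc m)) * trinom_poly vA ?d n)"
      by (rule arg_cong)
    moreover have "qconst (1 / of_nat (Suc (Suc m))) * of_nat (Suc (Suc m)) = (1 :: indet qpoly)"
      using qconst.hom_mult[of "1 / of_nat (Suc (Suc m))" "of_nat (Suc (Suc m))"]
      by (simp only: qconst.hom_of_nat) simp
    ultimately show ?thesis by (simp only: mult.assoc[symmetric]) simp
  qed
qed

text \<open>Expand in powers of a t: next to (a t)^(k - j) one needs the coefficient of t^j in (t^2
  + d)^j, which vanishes for odd j.\<close>

lemma coeff_power_trinomial: "Polynomial.coeff ([:d, a, 1:] ^ k) k = trinom_poly a d k"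
proof -
  have sq: "Polynomial.coeff ((Polynomial.monom 1 2 + [:d:]) ^ j) j = (if even j then of_nat (j choose (j div 2)) * d ^ (j div 2) else 0)"
    for j
  proof -
    have "Polynomial.coeff ((Polynomial.monom 1 2 + [:d:]) ^ j) j
        = (\<Sum>i\<le>j. of_nat (j choose i) * Polynomial.coeff (Polynomial.monom 1 (2 * i) * [:d ^ (j - i):]) j)"
      by (simp add: binomial_ring coeff_sum monom_power poly_const_pow of_nat_poly mult_ac)
    also have "\<dots> = (\<Sum>i\<le>j. if i = j div 2 then (if even j then of_nat (j choose (j div 2)) * d ^ (j div 2) else 0) else 0)"
    proof (intro sum.cong refl)
      fix i assume "i \<in> {..j}"
      then show "of_nat (j choose i) * Polynomial.coeff (Polynomial.monom 1 (2 * i) * [:d ^ (j - i):]) j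
        = (if i = j div 2 then (if even j then of_nat (j choose (j div 2)) * d ^ (j div 2) else 0) else 0)"
        by (cases "j = 2 * i") (auto simp: coeff_monom_mult coeff_pCons split: nat.split)
    qed
    also have "\<dots> = (if even j then of_nat (j choose (j div 2)) * d ^ (j div 2) else 0)"
      by simp
    finally show ?thesis .
  qed
  have "[:d, a, 1:] = Polynomial.monom a 1 + (Polynomial.monom 1 2 + [:d:])"
    by (simp add: monom_altdef numeral_2_eq_2)
  then have "Polynomial.coeff ([:d, a, 1:] ^ k) k
     = (\<Sum>i\<le>k. of_nat (k choose i) * Polynomial.coeff (Polynomial.monom (a ^ i) i * (Polynomial.monom 1 2 + [:d:]) ^ (k - i)) k)"
    by (simp add: binomial_ring coeff_sum monom_power of_nat_poly mult.assoc)
  also have "\<dots> = (\<Sum>i\<le>k. of_nat (k choose i) * a ^ i * Polynomial.coeff ((Polynomial.monom 1 2 + [:d:]) ^ (k - i)) (k - i))"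
    by (simp add: coeff_monom_mult mult.assoc)
  also have "\<dots> = (\<Sum>j\<le>k. of_nat (k choose (k - j)) * a ^ (k - j) * Polynomial.coeff ((Polynomial.monom 1 2 + [:d:]) ^ j) j)"
    by (rule sum.reindex_bij_witness[of _ "\<lambda>j. k - j" "\<lambda>j. k - j"]) auto
  also have "\<dots> = (\<Sum>j\<in>(*) 2 ` {..k div 2}. of_nat (k choose (k - j)) * a ^ (k - j) * Polynomial.coeff ((Polynomial.monom 1 2 + [:d:]) ^ j) j)"
    by (rule sum.mono_neutral_right) (auto simp: sq elim!: evenE)
  also have "\<dots> = (\<Sum>i\<le>k div 2. of_nat (k choose (k - 2 * i)) * a ^ (k - 2 * i) * (of_nat (2 * i choose i) * d ^ i))"
    by (subst sum.reindex) (auto simp: inj_on_def sq)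
  also have "\<dots> = (\<Sum>i\<le>k div 2. of_nat (trinom k i) * a ^ (k - 2 * i) * d ^ i)"
    by (intro sum.cong refl) (auto simp: trinom_def binomial_symmetric[of "2 * _" k, symmetric])
  also have "\<dots> = trinom_poly a d k"
    unfolding trinom_poly_def
  proof (rule sum.mono_neutral_left)
    show "\<forall>i\<in>{..k} - {..k div 2}. of_nat (trinom k i) * a ^ (k - 2 * i) * d ^ i = 0"
    proof
      fix i assume "i \<in> {..k} - {..k div 2}"
      then have "trinom k i = 0" by (intro trinom_eq_0) auto
      then show "of_nat (trinom k i) * a ^ (k - 2 * i) * d ^ i = 0" by simp
    qed
  qed auto
  finally show ?thesis .
qed


section \<open>Frobenius lifts\<close>

text \<open>The inner binomial coefficients are divisible by p. With the next two lemmas, this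
  reduces the Frobenius congruence for polynomials to constants and monomials.\<close>

lemma frobenius_congruence_add:
  assumes p: "prime p" and S: "unital_subring S" and "comm_ring_hom \<sigma>"
    and xy: "x \<in> S" "y \<in> S" "\<exists>s\<in>S. \<sigma> x - x ^ p = of_nat p * s" "\<exists>s\<in>S. \<sigma> y - y ^ p = of_nat p * s"
  shows "\<exists>s\<in>S. \<sigma> (x + y) - (x + y) ^ p = of_nat p * s"
proof -
  interpret S: unital_subring S by fact
  interpret \<sigma>: comm_ring_hom \<sigma> by fact
  obtain s t where st: "s \<in> S" "t \<in> S" "\<sigma> x - x ^ p = of_nat p * s" "\<sigma> y - y ^ p = of_nat p * t"
    using xy by blast
  define c where "c k = (p choose k) div p" for k
  have c: "p choose k = p * c k" if "k \<in> {1..<p}" for k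
    using dvd_choose_prime[of k p] p that by (auto simp: c_def)
  let ?u = "\<Sum>k=1..<p. of_nat (c k) * x ^ k * y ^ (p - k)"
  have p1: "p \<ge> 1" using prime_ge_1_nat[OF p] .
  have split: "{..p} = insert 0 (insert p {1..<p})" using p1 by auto
  have "(x + y) ^ p = y ^ p + (x ^ p + (\<Sum>k=1..<p. of_nat (p choose k) * x ^ k * y ^ (p - k)))"
    unfolding binomial_ring split using p1 by (subst sum.insert; simp)+
  also have "(\<Sum>k=1..<p. of_nat (p choose k) * x ^ k * y ^ (p - k)) = of_nat p * ?u"
    unfolding sum_distrib_left by (intro sum.cong refl) (simp add: c mult_ac)
  finally have "\<sigma> (x + y) - (x + y) ^ p = (\<sigma> x - x ^ p) + (\<sigma> y - y ^ p) - of_nat p * ?u"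
    by (simp add: \<sigma>.hom_add)
  also have "\<dots> = of_nat p * (s + t - ?u)" unfolding st by (simp add: algebra_simps)
  finally show ?thesis
    using st(1,2) xy(1,2)
    by (intro bexI) (assumption, intro S.diff_mem S.add_mem S.sum_mem S.mult_mem S.power_mem S.of_nat_mem)
qed

lemma frobenius_congruence_mult:
  assumes S: "unital_subring S" and "comm_ring_hom \<sigma>"
    and xy: "x \<in> S" "y \<in> S" "\<exists>s\<in>S. \<sigma> x - x ^ p = of_nat p * s" "\<exists>s\<in>S. \<sigma> y - y ^ p = of_nat p * s"
  shows "\<exists>s\<in>S. \<sigma> (x * y) - (x * y) ^ p = of_nat p * s"
proof -
  interpret S: unital_subring S by fact
  interpret \<sigma>: comm_ring_hom \<sigma> by fact
  obtain s t where st: "s \<in> S" "t \<in> S" "\<sigma> x - x ^ p = of_nat p * s" "\<sigma> y - y ^ p = of_nat p * t"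
    using xy by blast
  have e: "\<sigma> x = x ^ p + of_nat p * s" "\<sigma> y = y ^ p + of_nat p * t"
    using st by (simp_all add: algebra_simps)
  have "\<sigma> (x * y) - (x * y) ^ p = of_nat p * (s * y ^ p + x ^ p * t + of_nat p * s * t)"
    unfolding \<sigma>.hom_mult e by (simp add: algebra_simps)
  then show ?thesis
    using st(1,2) xy(1,2)
    by (intro bexI) (assumption, intro S.add_mem S.mult_mem S.power_mem S.of_nat_mem)
qed

lemma frobenius_congruence_sum:
  assumes p: "prime p" and S: "unital_subring S" and \<sigma>: "comm_ring_hom \<sigma>"
    and f: "\<And>i. i \<in> I \<Longrightarrow> f i \<in> S \<and> (\<exists>s\<in>S. \<sigma> (f i) - f i ^ p = of_nat p * s)"
  shows "\<exists>s\<in>S. \<sigma> (sum f I) - sum f I ^ p = of_nat p * s"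
proof -
  interpret S: unital_subring S by fact
  interpret \<sigma>: comm_ring_hom \<sigma> by fact
  have 0: "\<exists>s\<in>S. \<sigma> 0 - 0 ^ p = of_nat p * s"
    using prime_gt_0_nat[OF p] by (intro bexI[of _ 0]) (auto simp: zero_power)
  have zp: "(0 :: 'a) ^ p = 0" using prime_gt_0_nat[OF p] by (rule zero_power)
  from f show ?thesis
  proof (induction I rule: infinite_finite_induct)
    case (insert i I)
    then show ?case
      by (simp add: frobenius_congruence_add[OF p S \<sigma>] S.sum_mem)
  qed (use 0 in \<open>simp_all add: zp\<close>)
qed

text \<open>For integers, Fermat's theorem follows by induction from the additive closure with the
  identity as lift. For a fraction a/b, the numerator a b^p - b a^p is a combination of a - a^p and
  b - b^p.\<close>

lemma fermat_Zloc:
  assumes p: "prime p" and r: "r \<in> Zloc p"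
  shows "\<exists>s\<in>Zloc p. r - r ^ p = of_nat p * s"
proof -
  obtain a b where ab: "r = of_int a / of_int b" "\<not> int p dvd b" using r by (auto simp: Zloc_def)
  have fermat: "int p dvd x - x ^ p" for x :: int
  proof -
    have nat: "\<exists>s\<in>(UNIV::int set). int n - int n ^ p = of_nat p * s" for n
    proof (induction n)
      case 0 then show ?case using prime_gt_0_nat[OF p] by (auto simp: zero_power)
    next
      case (Suc n)
      have "\<exists>s\<in>(UNIV::int set). id (int n + 1) - (int n + 1) ^ p = of_nat p * s"
        using Suc by (intro frobenius_congruence_add[OF p]) (auto simp: unital_subring_def comm_ring_hom_def)
      then show ?case by (simp add: add.commute)
    qed
    have "(x - x ^ p) mod int p = (x mod int p - (x mod int p) ^ p) mod int p"
      by (metis mod_diff_left_eq mod_diff_right_eq power_mod)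
    moreover have "x mod int p = int (nat (x mod int p))"
      using prime_gt_0_nat[OF p] by simp
    then have "int p dvd x mod int p - (x mod int p) ^ p"
      using nat[of "nat (x mod int p)"] by (metis dvd_triv_left)
    ultimately show ?thesis by (simp add: dvd_eq_mod_eq_0)
  qed
  have b: "b \<noteq> 0" using ab by auto
  have "int p dvd b ^ p * a - b * a ^ p"
  proof -
    have "b ^ p * a - b * a ^ p = b * (a - a ^ p) - (b - b ^ p) * a" by (simp add: algebra_simps)
    then show ?thesis using fermat by simp
  qed
  then obtain t where t: "b ^ p * a - b * a ^ p = int p * t" by blast
  have "r - r ^ p = of_int (b ^ p * a - b * a ^ p) / of_int (b * b ^ p)"
    using b by (simp add: ab power_divide field_simps)
  also have "\<dots> = of_nat p * (of_int t / of_int (b * b ^ p))" unfolding t by simp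
  finally have "r - r ^ p = of_nat p * (of_int t / of_int (b * b ^ p))" .
  moreover have "\<not> int p dvd b * b ^ p"
  proof -
    have "prime (int p)" using p by simp
    then show ?thesis using ab(2) by (metis prime_dvd_mult_iff prime_dvd_power)
  qed
  then have "of_int t / of_int (b * b ^ p) \<in> Zloc p" by (rule Zloc_I)
  ultimately show ?thesis by blast
qed

definition frob :: "nat \<Rightarrow> 'v qpoly \<Rightarrow> 'v qpoly"
  where "frob p = peval qconst (\<lambda>v. qvar v ^ p)"

lemma comm_ring_hom_frob: "comm_ring_hom (frob p)"
  unfolding frob_def by (rule comm_ring_hom_peval[OF comm_ring_hom_qconst])

lemma frob_qconst [simp]: "frob p (qconst r) = qconst r"
  unfolding frob_def by (rule peval_qconst[OF comm_ring_hom_qconst])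

lemma frob_qvar [simp]: "frob p (qvar v) = qvar v ^ p"
  unfolding frob_def by (rule peval_qvar[OF comm_ring_hom_qconst])

lemma of_nat_mult_qconst_inverse: "p > 0 \<Longrightarrow> of_nat p * qconst (1 / of_nat p) = 1"
  using qconst.hom_mult[of "of_nat p" "1 / of_nat p"] by (simp add: qconst.hom_of_nat)

text \<open>Split a polynomial into constants times monomials: Fermat's theorem settles the
  constants, and monomials go exactly to their p-th powers.\<close>

lemma frobenius_lift_frob:
  assumes p: "prime p"
  shows "frobenius_lift (polys_over (Zloc p)) (frob p) p (qconst (1 / of_nat p) :: 'v qpoly)"
proof -
  interpret Z: unital_subring "Zloc p" using p by (rule unital_subring_Zloc)
  interpret S: unital_subring "polys_over (Zloc p) :: 'v qpoly set"
    using Z.unital_subring_axioms by (rule unital_subring_polys_over)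
  interpret \<sigma>: comm_ring_hom "frob p :: 'v qpoly \<Rightarrow> _" by (rule comm_ring_hom_frob)
  have lookup: "Poly_Mapping.lookup P m \<in> Zloc p" if "P \<in> polys_over (Zloc p)" for P :: "'v qpoly" and m
    using that by (simp add: polys_over_def)
  show ?thesis
  proof
    show "of_nat p * qconst (1 / of_nat p) = (1 :: 'v qpoly)"
      using prime_gt_0_nat[OF p] by (rule of_nat_mult_qconst_inverse)
    fix P :: "'v qpoly" assume P: "P \<in> polys_over (Zloc p)"
    show "frob p P \<in> polys_over (Zloc p)"
      unfolding frob_def
      by (intro peval_mem[OF S.unital_subring_axioms comm_ring_hom_qconst] qconst_mem_polys_over
          S.power_mem qvar_mem_polys_over lookup P Z.zero_mem Z.one_mem)
    have "\<exists>s\<in>polys_over (Zloc p). frob p (peval qconst qvar P) - peval qconst qvar P ^ p = of_nat p * s"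
      unfolding peval_def
    proof (intro frobenius_congruence_sum[OF p S.unital_subring_axioms \<sigma>.comm_ring_hom_axioms] conjI)
      fix m
      let ?c = "qconst (Poly_Mapping.lookup P m) :: 'v qpoly"
      have c: "?c \<in> polys_over (Zloc p)" by (intro qconst_mem_polys_over lookup P Z.zero_mem)
      have m: "monom_at qvar m \<in> polys_over (Zloc p)"
        unfolding monom_at_def by (intro S.prod_mem S.power_mem qvar_mem_polys_over Z.zero_mem Z.one_mem)
      show "?c * monom_at qvar m \<in> polys_over (Zloc p)" using c m by (rule S.mult_mem)
      have "\<exists>s\<in>polys_over (Zloc p). frob p ?c - ?c ^ p = of_nat p * s"
      proof -
        obtain s where s: "s \<in> Zloc p" "Poly_Mapping.lookup P m - Poly_Mapping.lookup P m ^ p = of_nat p * s"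
          using fermat_Zloc[OF p lookup[OF P, of m]] by blast
        then have "frob p ?c - ?c ^ p = of_nat p * qconst s"
          by (simp flip: qconst.hom_power qconst.hom_diff qconst.hom_mult qconst.hom_of_nat)
        then show ?thesis using s by (blast intro: qconst_mem_polys_over Z.zero_mem)
      qed
      moreover have "\<exists>s\<in>polys_over (Zloc p). frob p (monom_at qvar m) - monom_at qvar m ^ p = of_nat p * s"
        by (intro bexI[of _ 0])
           (simp_all add: monom_at_def \<sigma>.hom_prod \<sigma>.hom_power prod_power_distrib mult.commute flip: power_mult)
      ultimately show "\<exists>s\<in>polys_over (Zloc p). frob p (?c * monom_at qvar m) - (?c * monom_at qvar m) ^ p = of_nat p * s"
        by (intro frobenius_congruence_mult[OF S.unital_subring_axioms \<sigma>.comm_ring_hom_axioms] c m)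
    qed
    then show "\<exists>s\<in>polys_over (Zloc p). frob p P - P ^ p = of_nat p * s" by (simp add: peval_id)
  qed
qed

section \<open>Extension of a Frobenius lift to polynomials in t\<close>

definition poly_frob :: "nat \<Rightarrow> ('a::comm_ring_1 \<Rightarrow> 'a) \<Rightarrow> 'a poly \<Rightarrow> 'a poly"
  where "poly_frob p \<sigma> f = pcompose (map_poly \<sigma> f) (Polynomial.monom 1 p)"

lemma coeff_pcompose_monom:
  fixes f :: "'a::comm_ring_1 poly"
  assumes "p > 0"
  shows "Polynomial.coeff (pcompose f (Polynomial.monom 1 p)) k = (if p dvd k then Polynomial.coeff f (k div p) else 0)"
proof (induction f arbitrary: k)
  case (pCons a f)
  have "k div p = Suc ((k - p) div p)" if "p \<le> k" using that assms by (simp add: le_div_geq)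
  moreover have "p dvd k - p \<longleftrightarrow> p dvd k" if "p \<le> k" using that by (metis dvd_minus_self not_le)
  ultimately show ?case
    using assms
    by (auto simp: pcompose_pCons coeff_monom_mult pCons.IH coeff_pCons not_less split: nat.splits)
qed simp

context
  fixes \<sigma> :: "'a::comm_ring_1 \<Rightarrow> 'a" and p :: nat
  assumes \<sigma>: "comm_ring_hom \<sigma>" and p0: "p > 0"
begin

interpretation \<sigma>: comm_ring_hom \<sigma> by (rule \<sigma>)

lemma coeff_poly_frob:
  "Polynomial.coeff (poly_frob p \<sigma> f) k = (if p dvd k then \<sigma> (Polynomial.coeff f (k div p)) else 0)"
  by (simp add: poly_frob_def coeff_pcompose_monom p0 coeff_map_poly)

lemma comm_ring_hom_poly_frob: "comm_ring_hom (poly_frob p \<sigma>)"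
proof
  show "poly_frob p \<sigma> 1 = 1" by (simp add: poly_frob_def map_poly_1' pcompose_1)
  fix f g
  have "map_poly \<sigma> (f + g) = map_poly \<sigma> f + map_poly \<sigma> g"
    by (rule poly_eqI) (simp add: coeff_map_poly \<sigma>.hom_add)
  then show "poly_frob p \<sigma> (f + g) = poly_frob p \<sigma> f + poly_frob p \<sigma> g"
    by (simp add: poly_frob_def pcompose_add)
  have "map_poly \<sigma> (f * g) = map_poly \<sigma> f * map_poly \<sigma> g"
    by (rule poly_eqI) (simp add: coeff_map_poly coeff_mult \<sigma>.hom_sum \<sigma>.hom_mult)
  then show "poly_frob p \<sigma> (f * g) = poly_frob p \<sigma> f * poly_frob p \<sigma> g"
    by (simp add: poly_frob_def pcompose_mult)
qed

text \<open>The sparsity shown here, exponents divisible by p^m only, is what later isolates a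
  single product in a central coefficient.\<close>

lemma coeff_poly_frob_funpow:
  "Polynomial.coeff ((poly_frob p \<sigma> ^^ m) f) k
    = (if p ^ m dvd k then (\<sigma> ^^ m) (Polynomial.coeff f (k div p ^ m)) else 0)"
proof (induction m arbitrary: k)
  case (Suc m)
  have "p * p ^ m dvd k \<longleftrightarrow> p dvd k \<and> p ^ m dvd k div p"
    using p0 by (metis dvd_mult_left dvd_div_iff_mult mult.commute not_gr_zero)
  then show ?case by (auto simp: coeff_poly_frob Suc div_mult2_eq)
qed simp

end

definition polys_with_coeffs :: "'a::comm_ring_1 set \<Rightarrow> 'a poly set"
  where "polys_with_coeffs S = {f. \<forall>i. Polynomial.coeff f i \<in> S}"

lemma unital_subring_polys_with_coeffs:
  assumes "unital_subring S"
  shows "unital_subring (polys_with_coeffs S)"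
proof -
  interpret S: unital_subring S by fact
  show ?thesis
    by unfold_locales
      (auto simp: polys_with_coeffs_def coeff_mult coeff_1 intro!: S.diff_mem S.sum_mem S.mult_mem)
qed

lemma frobenius_lift_poly_frob:
  assumes "frobenius_lift S \<sigma> p q" and p: "prime p"
  shows "frobenius_lift (polys_with_coeffs S) (poly_frob p \<sigma>) p [:q:]"
proof -
  interpret frobenius_lift S \<sigma> p q by fact
  have p0: "p > 0" using p by (rule prime_gt_0_nat)
  let ?T = "polys_with_coeffs S"
  interpret T: unital_subring ?T
    by (rule unital_subring_polys_with_coeffs) (rule S.unital_subring_axioms)
  interpret \<tau>: comm_ring_hom "poly_frob p \<sigma>"
    using \<sigma>.comm_ring_hom_axioms p0 by (rule comm_ring_hom_poly_frob)
  show ?thesis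
  proof
    show "of_nat p * [:q:] = 1" by (simp add: of_nat_poly inv_p one_pCons mult.commute[of q])
    fix f assume f: "f \<in> ?T"
    then show "poly_frob p \<sigma> f \<in> ?T"
      by (auto simp: polys_with_coeffs_def coeff_poly_frob[OF \<sigma>.comm_ring_hom_axioms p0] sigma_mem)
    have "\<exists>s\<in>?T. poly_frob p \<sigma> (\<Sum>i\<le>degree f. Polynomial.monom (Polynomial.coeff f i) i)
        - (\<Sum>i\<le>degree f. Polynomial.monom (Polynomial.coeff f i) i) ^ p = of_nat p * s"
    proof (intro frobenius_congruence_sum[OF p T.unital_subring_axioms \<tau>.comm_ring_hom_axioms] conjI)
      fix i
      let ?a = "Polynomial.coeff f i"
      have a: "?a \<in> S" using f by (simp add: polys_with_coeffs_def)
      show "Polynomial.monom ?a i \<in> ?T" using a by (simp add: polys_with_coeffs_def)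
      obtain s where s: "s \<in> S" "\<sigma> ?a - ?a ^ p = of_nat p * s" using sigma_cong[OF a] by blast
      have "poly_frob p \<sigma> (Polynomial.monom ?a i) = Polynomial.monom (\<sigma> ?a) (i * p)"
      proof (rule poly_eqI)
        fix n
        show "Polynomial.coeff (poly_frob p \<sigma> (Polynomial.monom ?a i)) n
            = Polynomial.coeff (Polynomial.monom (\<sigma> ?a) (i * p)) n"
          using p0 by (cases "p dvd n") (auto simp: coeff_poly_frob[OF \<sigma>.comm_ring_hom_axioms p0] elim!: dvdE)
      qed
      then have "poly_frob p \<sigma> (Polynomial.monom ?a i) - Polynomial.monom ?a i ^ p
          = of_nat p * Polynomial.monom s (i * p)"
        by (simp add: monom_power diff_monom s of_nat_poly smult_monom)
      moreover have "Polynomial.monom s (i * p) \<in> ?T" using s by (simp add: polys_with_coeffs_def)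
      ultimately show "\<exists>s\<in>?T. poly_frob p \<sigma> (Polynomial.monom ?a i) - Polynomial.monom ?a i ^ p = of_nat p * s"
        by blast
    qed
    then show "\<exists>s\<in>?T. poly_frob p \<sigma> f - f ^ p = of_nat p * s"
      by (simp add: poly_as_sum_of_monoms)
  qed
qed

section \<open>Integrality of the Legendre logarithm\<close>

context frobenius_lift
begin

text \<open>Honda's relation solved for its n-th coefficient; this is always possible because
  \<sigma>^n fixes l 0 = 1, so that only integrality is at stake.\<close>

fun honda_coeff :: "(nat \<Rightarrow> 'a) \<Rightarrow> nat \<Rightarrow> 'a"
  where "honda_coeff l n = of_nat p * l n - (\<Sum>m=1..<n. honda_coeff l m * (\<sigma> ^^ m) (l (n - m)))"

declare honda_coeff.simps [simp del]

lemma honda_coeff_relation: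
  assumes "n \<ge> 1" "l 0 = 1"
  shows "of_nat p * l n = (\<Sum>m=1..n. honda_coeff l m * (\<sigma> ^^ m) (l (n - m)))"
proof -
  have "{1..n} = insert n {1..<n}" using assms by auto
  then show ?thesis
    using sigma_pow.hom_one assms
    by (simp add: honda_coeff.simps[of l n])
qed

end

text \<open>The idea: with \<open>c = (p - 1)/4\<close> and \<open>F = t\<^sup>2 + A t + (A\<^sup>2 - B)/4\<close>, the sequence
  \<open>F\<^bsup>(p\<^sup>n - 1)/4\<^esup> / p\<^sup>n\<close> is the logarithm with Hazewinkel
  generators \<open>F\<^bsup>c\<^esup>, 0, 0, \<dots>\<close>, so its Honda coefficients are integral; by their degrees,
  taking central coefficients is compatible with Honda's relation.\<close>

lemma central_hazewinkel_integral:
  fixes a d :: "'a::comm_ring_1"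
  assumes "frobenius_lift S \<sigma> p q" and p: "prime p" "p mod 4 = 1" and ad: "a \<in> S" "d \<in> S"
    and l: "\<And>n. l n = q ^ n * trinom_poly a d ((p ^ n - 1) div 4)"
    and haz: "\<And>n. n \<ge> 1 \<Longrightarrow> of_nat p * l n = (\<Sum>j<n. l j * v (n - j) ^ (p ^ j))"
    and n: "n \<ge> 1"
  shows "v n \<in> S"
proof -
  interpret R: frobenius_lift S \<sigma> p q by fact
  interpret P: frobenius_lift "polys_with_coeffs S" "poly_frob p \<sigma>" p "[:q:]"
    by (rule frobenius_lift_poly_frob) fact+
  have p0: "p > 0" using p prime_gt_0_nat by blast
  define k where "k n = (p ^ n - 1) div 4" for n
  define c where "c = (p - 1) div 4"
  have p_c: "p = 4 * c + 1" using p(2) p0 unfolding c_def by presburger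
  have pk: "p ^ n = 4 * k n + 1" for n
  proof -
    have "p ^ n mod 4 = 1" by (metis p(2) power_mod power_one mod_less one_less_numeral_iff semiring_norm(76))
    then show ?thesis unfolding k_def by presburger
  qed
  \<comment> \<open>This identity lets powers of F satisfy Hazewinkel's relation, and it places the
    centre of a product at the sum of the twisted centres.\<close>
  have k_add: "k (m + n) = k m + p ^ m * k n" for m n
  proof -
    have "4 * k (m + n) + 1 = (4 * k m + 1) * (4 * k n + 1)" by (simp only: power_add flip: pk)
    then have "4 * k (m + n) = 4 * (k m + (4 * k m + 1) * k n)" by (simp add: algebra_simps)
    then show ?thesis by (simp add: pk)
  qed
  have k0: "k 0 = 0" and k1: "k 1 = c" by (simp_all add: k_def c_def)
  let ?F = "[:d, a, 1:]"
  define L where "L n = [:q ^ n:] * ?F ^ k n" for n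
  define V where "V i = (if i = 1 then ?F ^ c else 0)" for i :: nat
  have L0: "L 0 = 1" by (simp add: L_def k0 one_pCons)
  have pq: "[:of_nat p:] * [:q ^ Suc n:] = [:q ^ n:]" for n
  proof -
    have "of_nat p * q ^ Suc n = (of_nat p * q) * q ^ n" by (simp only: power_Suc mult.assoc)
    then have "of_nat p * q ^ Suc n = q ^ n" by (simp only: R.inv_p mult_1)
    then show ?thesis by (simp add: mult_ac)
  qed
  \<comment> \<open>Only j = n - 1 contributes, since V vanishes away from index 1.\<close>
  have hazL: "of_nat p * L n = (\<Sum>j<n. L j * V (n - j) ^ (p ^ j))" if n1: "n \<ge> 1" for n
  proof -
    obtain m where m: "n = Suc m" using n1 by (cases n) auto
    have "(\<Sum>j<n. L j * V (n - j) ^ (p ^ j)) = (\<Sum>j<n. if j = m then L m * ?F ^ (c * p ^ m) else 0)"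
      using p0 by (intro sum.cong) (auto simp: V_def m power_mult zero_power)
    also have "\<dots> = [:q ^ m:] * ?F ^ (k m + p ^ m * k 1)"
      by (simp add: m L_def k1[unfolded One_nat_def] power_add mult_ac)
    also have "\<dots> = [:q ^ m:] * ?F ^ k n" using k_add[of m 1] by (simp add: m)
    also have "\<dots> = of_nat p * L n"
      unfolding L_def m by (simp only: of_nat_poly mult.assoc[symmetric] pq)
    finally show ?thesis by simp
  qed
  let ?W = "P.honda_coeff L"
  have F: "?F \<in> polys_with_coeffs S"
    using ad by (auto simp: polys_with_coeffs_def coeff_pCons split: nat.splits)
  have V: "\<forall>n\<ge>1. V n \<in> polys_with_coeffs S"
    using F by (auto simp: V_def intro: P.S.power_mem)
  have W: "\<forall>n\<ge>1. ?W n \<in> polys_with_coeffs S"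
  proof -
    have "of_nat p * L n = (\<Sum>m=1..n. ?W m * (poly_frob p \<sigma> ^^ m) (L (n - m)))" if "n \<ge> 1" for n
      using that L0 by (rule P.honda_coeff_relation)
    from P.haz_iff_honda[of L V ?W, OF L0 hazL this] V show ?thesis by simp
  qed
  \<comment> \<open>Degrees are at most twice the centre; this passes to Honda's coefficients
    through the recursion.\<close>
  have degL: "degree (L n) \<le> 2 * k n" for n
  proof -
    have "degree (L n) \<le> degree [:q ^ n:] + degree (?F ^ k n)" unfolding L_def by (rule degree_mult_le)
    also have "degree (?F ^ k n) \<le> degree ?F * k n" by (rule degree_power_le)
    also have "degree ?F \<le> 2" by simp
    finally show ?thesis by simp
  qed
  have \<sigma>: "comm_ring_hom \<sigma>" by (rule R.\<sigma>.comm_ring_hom_axioms)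
  have degS: "degree ((poly_frob p \<sigma> ^^ m) f) \<le> p ^ m * degree f" for m f
  proof (rule degree_le, intro allI impI)
    fix i assume "p ^ m * degree f < i"
    then have "degree f < i div p ^ m" if "p ^ m dvd i"
      using that p0 by (metis dvd_mult_div_cancel nat_mult_less_cancel_disj)
    then show "Polynomial.coeff ((poly_frob p \<sigma> ^^ m) f) i = 0"
      by (simp add: coeff_poly_frob_funpow[OF \<sigma> p0] coeff_eq_0
          comm_ring_hom.hom_zero[OF comm_ring_hom_funpow[OF \<sigma>]])
  qed
  have degW: "degree (?W n) \<le> 2 * k n" for n
  proof (induction n rule: less_induct)
    case (less n)
    have "degree (?W m * (poly_frob p \<sigma> ^^ m) (L (n - m))) \<le> 2 * k n" if "m \<in> {1..<n}" for m
    proof -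
      have "degree (?W m * (poly_frob p \<sigma> ^^ m) (L (n - m))) \<le> 2 * k m + p ^ m * (2 * k (n - m))"
        using that by (intro order.trans[OF degree_mult_le] add_mono less order.trans[OF degS] mult_left_mono degL) auto
      also have "\<dots> = 2 * k n" using that k_add[of m "n - m"] by (simp add: algebra_simps)
      finally show ?thesis .
    qed
    moreover have "degree (of_nat p * L n) \<le> 2 * k n"
      unfolding of_nat_poly using degL[of n] by (simp add: order.trans[OF degree_smult_le])
    ultimately show ?case
      unfolding P.honda_coeff.simps[of L n] by (intro degree_diff_le degree_sum_le) auto
  qed
  define w where "w n = Polynomial.coeff (?W n) (k n)" for n
  have cL: "Polynomial.coeff (L n) (k n) = l n" for n
    by (simp add: L_def l coeff_power_trinomial k_def)
  \<comment> \<open>A contributing i satisfies i = k m modulo p^m, because the second factor has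
    only exponents divisible by p^m. The degree bound gives |i - k m| \<le> k m < 4 (k m) + 1 = p^m,
    so i = k m.\<close>
  have coeff_central: "Polynomial.coeff (?W m * (poly_frob p \<sigma> ^^ m) (L (n - m))) (k n) = w m * (\<sigma> ^^ m) (l (n - m))"
    if m: "m \<in> {1..n}" for m n
  proof -
    let ?G = "(poly_frob p \<sigma> ^^ m) (L (n - m))"
    have kn: "k n = k m + p ^ m * k (n - m)" using m k_add[of m "n - m"] by simp
    have "Polynomial.coeff (?W m * ?G) (k n) = (\<Sum>i\<le>k n. Polynomial.coeff (?W m) i * Polynomial.coeff ?G (k n - i))"
      by (rule coeff_mult)
    also have "\<dots> = (\<Sum>i\<le>k n. if i = k m then Polynomial.coeff (?W m) (k m) * Polynomial.coeff ?G (k n - k m) else 0)"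
    proof (intro sum.cong refl)
      fix i assume "i \<in> {..k n}"
      show "Polynomial.coeff (?W m) i * Polynomial.coeff ?G (k n - i)
        = (if i = k m then Polynomial.coeff (?W m) (k m) * Polynomial.coeff ?G (k n - k m) else 0)"
      proof (cases "i = k m \<or> i > 2 * k m \<or> \<not> p ^ m dvd k n - i")
        case True
        then show ?thesis
          using degW[of m] by (auto simp: coeff_poly_frob_funpow[OF \<sigma> p0] coeff_eq_0)
      next
        case False
        have "int (p ^ m) dvd int (k n - i)" using False int_dvd_int_iff by blast
        then have "int (p ^ m) dvd int (k n) - int i" using \<open>i \<in> {..k n}\<close> by (simp add: of_nat_diff)
        then have "int (p ^ m) dvd int (k n) - int i - int (p ^ m) * int (k (n - m))" by simp
        moreover have "int (k n) - int i - int (p ^ m) * int (k (n - m)) = int (k m) - int i"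
          by (simp add: kn)
        ultimately have "int (p ^ m) dvd int (k m) - int i" by metis
        moreover have "\<bar>int (k m) - int i\<bar> < int (p ^ m)" using False pk[of m] by auto
        ultimately have "int (k m) - int i = 0"
          using dvd_imp_le_int[of "int (k m) - int i" "int (p ^ m)"] by linarith
        then show ?thesis using False by simp
      qed
    qed
    also have "\<dots> = Polynomial.coeff (?W m) (k m) * Polynomial.coeff ?G (p ^ m * k (n - m))"
      by (simp add: kn)
    also have "\<dots> = w m * (\<sigma> ^^ m) (l (n - m))"
      using p0 by (simp add: coeff_poly_frob_funpow[OF \<sigma> p0] cL w_def)
    finally show ?thesis .
  qed
  have honda: "of_nat p * l n = (\<Sum>m=1..n. w m * (\<sigma> ^^ m) (l (n - m)))" if "n \<ge> 1" for n
  proof -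
    have "of_nat p * l n = Polynomial.coeff (of_nat p * L n) (k n)"
      by (simp add: of_nat_poly cL)
    also have "\<dots> = (\<Sum>m=1..n. w m * (\<sigma> ^^ m) (l (n - m)))"
      by (simp add: P.honda_coeff_relation[of n L, OF that L0] coeff_sum coeff_central)
    finally show ?thesis .
  qed
  have "\<forall>n\<ge>1. w n \<in> S" using W by (simp add: w_def polys_with_coeffs_def)
  moreover have "l 0 = 1" using cL[of 0] by (simp add: L0 k0)
  ultimately have "\<forall>n\<ge>1. v n \<in> S"
    using R.haz_iff_honda[of l v w, OF _ haz honda] by simp
  then show ?thesis using n by blast
qed

section \<open>Theta series\<close>

text \<open>With N = 2n for integral and N = 2n + 1 for half-integral characteristics, all theta
  constants become weighted sums over the integers of one Gaussian.\<close>

definition gauss :: "complex \<Rightarrow> int \<Rightarrow> complex"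
  where "gauss z N = exp (of_real pi * \<i> * z / 4 * of_int (N ^ 2))"

definition theta :: "(int \<Rightarrow> complex) \<Rightarrow> complex \<Rightarrow> complex"
  where "theta \<kappa> z = (\<Sum>\<^sub>\<infinity>N\<in>UNIV. \<kappa> N * gauss z N)"

definition bounded_weight :: "(int \<Rightarrow> complex) \<Rightarrow> bool"
  where "bounded_weight \<kappa> \<longleftrightarrow> (\<forall>N. norm (\<kappa> N) \<le> 1)"

lemma norm_gauss: "norm (gauss z N) = exp (- pi * Im z / 4 * real_of_int (N ^ 2))"
  by (simp add: gauss_def)

lemma int_UNIV_split: "range int \<union> range (\<lambda>n. - int (Suc n)) = UNIV"
proof (rule equalityI[OF subset_UNIV subsetI])
  fix N :: int
  show "N \<in> range int \<union> range (\<lambda>n. - int (Suc n))"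
    by (cases N rule: int_cases) auto
qed

lemma summable_on_int_geometric:
  assumes "0 \<le> r" "r < (1::real)"
  shows "(\<lambda>N::int. r ^ nat \<bar>N\<bar>) summable_on UNIV"
proof -
  have "summable (\<lambda>n. norm (r ^ n))" "summable (\<lambda>n. norm (r ^ Suc n))"
    using assms by (auto simp: summable_geometric norm_power intro!: summable_mult)
  then have 1: "(\<lambda>n. r ^ n) summable_on UNIV" "(\<lambda>n. r ^ Suc n) summable_on UNIV"
    by (blast intro: norm_summable_imp_summable_on)+
  have "(\<lambda>N::int. r ^ nat \<bar>N\<bar>) summable_on (range int)"
    using 1(1) by (subst summable_on_reindex) (auto simp: o_def)
  moreover have "(\<lambda>N::int. r ^ nat \<bar>N\<bar>) summable_on (range (\<lambda>n. - int (Suc n)))"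
    using 1(2) by (subst summable_on_reindex) (auto simp: o_def inj_on_def nat_add_distrib)
  ultimately have "(\<lambda>N::int. r ^ nat \<bar>N\<bar>) summable_on (range int \<union> range (\<lambda>n. - int (Suc n)))"
    by (rule summable_on_Un_disjoint) auto
  then show ?thesis by (simp only: int_UNIV_split)
qed

lemma abs_le_square_int: "\<bar>N\<bar> \<le> (N::int) ^ 2"
  using self_le_power[of "\<bar>N\<bar>" 2] by (cases "N = 0") auto

lemma gauss_abs_summable:
  assumes "Im z > 0"
  shows "(\<lambda>N. norm (gauss z N)) summable_on UNIV"
proof -
  define r where "r = exp (- pi * Im z / 4)"
  have r: "0 \<le> r" "r < 1" using assms by (auto simp: r_def)
  have "(\<lambda>N::int. norm (r ^ nat \<bar>N\<bar>)) summable_on UNIV"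
    using summable_on_int_geometric[OF r] r by simp
  then show ?thesis
  proof (rule Infinite_Sum.abs_summable_on_comparison_test)
    fix N :: int
    have "norm (gauss z N) = r ^ nat (N ^ 2)"
      by (simp add: norm_gauss r_def flip: exp_of_nat_mult)
    also have "\<dots> \<le> r ^ nat \<bar>N\<bar>"
    proof (rule power_decreasing)
      show "nat \<bar>N\<bar> \<le> nat (N ^ 2)" by (intro nat_mono abs_le_square_int)
    qed (use r in auto)
    finally show "norm (gauss z N) \<le> norm (r ^ nat \<bar>N\<bar>)" using r by simp
  qed
qed

lemma theta_abs_summable:
  assumes "Im z > 0" "bounded_weight \<kappa>"
  shows "(\<lambda>N. norm (\<kappa> N * gauss z N)) summable_on UNIV"
  by (rule Infinite_Sum.abs_summable_on_comparison_test[OF gauss_abs_summable[OF assms(1)]])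
     (use assms(2) in \<open>auto simp: bounded_weight_def norm_mult intro!: mult_left_le_one_le\<close>)

lemma has_sum_theta:
  assumes "Im z > 0" "bounded_weight \<kappa>"
  shows "((\<lambda>N. \<kappa> N * gauss z N) has_sum theta \<kappa> z) UNIV"
  unfolding theta_def
  using theta_abs_summable[OF assms, THEN Infinite_Sum.abs_summable_summable] by (rule has_sum_infsum)

lemma has_sum_mult_banach:
  fixes f g :: "'a \<Rightarrow> complex"
  assumes "(\<lambda>x. norm (f x)) summable_on UNIV" "(\<lambda>y. norm (g y)) summable_on UNIV"
  shows "((\<lambda>(x, y). f x * g y) has_sum (infsum f UNIV * infsum g UNIV)) UNIV"
proof -
  have "(\<lambda>(x, y). f x * g y) summable_on UNIV \<times> UNIV"
  proof (rule Infinite_Sum.abs_summable_summable)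
    have "(\<lambda>(x, y). norm (f x) * norm (g y)) summable_on UNIV \<times> UNIV"
      using assms by (intro summable_on_SigmaI[where g = "\<lambda>x. norm (f x) * infsum (\<lambda>y. norm (g y)) UNIV"])
        (auto intro!: has_sum_cmult_right summable_on_cmult_left)
    then show "(\<lambda>z. norm (case z of (x, y) \<Rightarrow> f x * g y)) summable_on UNIV \<times> UNIV"
      by (simp add: case_prod_unfold norm_mult)
  qed
  moreover from this have "infsum (\<lambda>(x, y). f x * g y) (UNIV \<times> UNIV) = infsum f UNIV * infsum g UNIV"
    by (subst infsum_Sigma'_banach[symmetric])
       (auto simp: infsum_cmult_right' infsum_cmult_left')
  ultimately show ?thesis by (metis UNIV_Times_UNIV has_sum_infsum)
qed

lemma has_sum_theta_mult:
  assumes "Im z > 0" "bounded_weight \<kappa>" "bounded_weight \<psi>"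
  shows "((\<lambda>(M, N). \<kappa> M * \<psi> N * (gauss z M * gauss z N)) has_sum (theta \<kappa> z * theta \<psi> z)) UNIV"
  using has_sum_mult_banach[OF theta_abs_summable[OF assms(1,2)] theta_abs_summable[OF assms(1,3)]]
  by (simp add: theta_def mult_ac)

text \<open>The substitution \<open>M = U + V\<close>, \<open>N = U - V\<close> turns
  \<open>M\<^sup>2 + N\<^sup>2\<close> into \<open>2 (U\<^sup>2 + V\<^sup>2)\<close>.\<close>

lemma theta_mult:
  assumes z: "Im z > 0"
    and bd: "bounded_weight \<kappa>" "bounded_weight \<psi>" "bounded_weight f" "bounded_weight g"
      "bounded_weight f'" "bounded_weight g'"
    and odd: "\<And>M N. odd (M + N) \<Longrightarrow> \<kappa> M * \<psi> N = 0"
    and split: "\<And>U V. \<kappa> (U + V) * \<psi> (U - V) = f U * g V + f' U * g' V"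
  shows "theta \<kappa> z * theta \<psi> z = theta f (2 * z) * theta g (2 * z) + theta f' (2 * z) * theta g' (2 * z)"
proof -
  let ?E = "{(M, N). even (M + N)} :: (int \<times> int) set"
  have gauss: "gauss z (U + V) * gauss z (U - V) = gauss (2 * z) U * gauss (2 * z) V" for U V
  proof -
    have "of_real pi * \<i> * z / 4 * of_int ((U + V) ^ 2) + of_real pi * \<i> * z / 4 * of_int ((U - V) ^ 2)
      = of_real pi * \<i> * (2 * z) / 4 * of_int (U ^ 2) + of_real pi * \<i> * (2 * z) / 4 * of_int (V ^ 2)"
      by (simp add: field_simps power2_eq_square)
    then show ?thesis by (simp only: gauss_def flip: exp_add)
  qed
  have w: "(M + N) div 2 + (M - N) div 2 = M" "(M + N) div 2 - (M - N) div 2 = N"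
    if "even (M + N)" for M N :: int
    using that by presburger+
  have "((\<lambda>(M, N). \<kappa> M * \<psi> N * (gauss z M * gauss z N)) has_sum (theta \<kappa> z * theta \<psi> z)) UNIV"
    using z bd by (intro has_sum_theta_mult)
  then have "((\<lambda>(M, N). \<kappa> M * \<psi> N * (gauss z M * gauss z N)) has_sum (theta \<kappa> z * theta \<psi> z)) ?E"
  proof (rule has_sum_cong_neutral[THEN iffD1, rotated -1])
    fix x :: "int \<times> int" assume "x \<in> UNIV - ?E"
    then show "(case x of (M, N) \<Rightarrow> \<kappa> M * \<psi> N * (gauss z M * gauss z N)) = 0"
      using odd[of "fst x" "snd x"] by (cases x) auto
  qed auto
  then have "((\<lambda>(U, V). (f U * g V + f' U * g' V) * (gauss (2 * z) U * gauss (2 * z) V))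
      has_sum (theta \<kappa> z * theta \<psi> z)) UNIV"
    by (subst has_sum_reindex_bij_witness[where T = ?E and j = "\<lambda>(U, V). (U + V, U - V)"
          and i = "\<lambda>(M, N). ((M + N) div 2, (M - N) div 2)"
          and h = "\<lambda>(M, N). \<kappa> M * \<psi> N * (gauss z M * gauss z N)"])
       (auto simp: split gauss w)
  moreover have "((\<lambda>(U, V). (f U * g V + f' U * g' V) * (gauss (2 * z) U * gauss (2 * z) V))
      has_sum (theta f (2 * z) * theta g (2 * z) + theta f' (2 * z) * theta g' (2 * z))) UNIV"
    using has_sum_add[OF has_sum_theta_mult[of "2 * z" f g] has_sum_theta_mult[of "2 * z" f' g']] z bd
    by (simp add: case_prod_unfold distrib_right)
  ultimately show ?thesis by (rule has_sum_unique)
qed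

text \<open>The weights of the theta constants with characteristics (0,0), (1,0) and (0,1).\<close>

definition w3 :: "int \<Rightarrow> complex" where "w3 N = (if even N then 1 else 0)"
definition w2 :: "int \<Rightarrow> complex" where "w2 N = (if odd N then 1 else 0)"
definition w4 :: "int \<Rightarrow> complex" where "w4 N = (if even N then (if 4 dvd N then 1 else -1) else 0)"
definition w1 :: "int \<Rightarrow> complex" where "w1 N = (if odd N then (if 4 dvd N - 1 then 1 else -1) else 0)"

abbreviation "\<theta>2 \<equiv> theta w2"
abbreviation "\<theta>3 \<equiv> theta w3"
abbreviation "\<theta>4 \<equiv> theta w4"

lemma bounded_weights [simp]:
  "bounded_weight w1" "bounded_weight w2" "bounded_weight w3" "bounded_weight w4"
  "bounded_weight (\<lambda>N. - w2 N)" "bounded_weight (\<lambda>N. w2 N + w3 N)"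
  by (auto simp: bounded_weight_def w1_def w2_def w3_def w4_def)

lemma theta_uminus: "theta (\<lambda>N. - \<kappa> N) z = - theta \<kappa> z"
  by (simp add: theta_def infsum_uminus)

text \<open>The weight is the nontrivial character modulo 4, which is odd, while the Gaussian is
  even. It accounts for the pairs of odd U, V in the product of \<theta>_3 and \<theta>_4.\<close>

lemma theta_w1: "theta w1 z = 0"
proof -
  have "4 dvd - N - 1 \<longleftrightarrow> \<not> 4 dvd N - 1" if "odd N" for N :: int using that by presburger
  then have "w1 (- N) = - w1 N" for N by (simp add: w1_def)
  then have "theta w1 z = (\<Sum>\<^sub>\<infinity>N\<in>UNIV. - w1 (- N) * gauss z (- N))"
    by (simp add: theta_def gauss_def)
  also have "\<dots> = (\<Sum>\<^sub>\<infinity>N\<in>UNIV. - w1 N * gauss z N)"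
    by (rule infsum_reindex_bij_witness[of _ uminus uminus]) auto
  also have "\<dots> = - theta w1 z" by (simp add: theta_def infsum_uminus)
  finally show ?thesis by simp
qed

section \<open>Landen's transformation\<close>

lemma theta3_sq: "Im z > 0 \<Longrightarrow> \<theta>3 z ^ 2 = \<theta>3 (2 * z) ^ 2 + \<theta>2 (2 * z) ^ 2"
  unfolding power2_eq_square
  by (rule theta_mult) (auto simp: w3_def w2_def)

lemma theta4_sq: "Im z > 0 \<Longrightarrow> \<theta>4 z ^ 2 = \<theta>3 (2 * z) ^ 2 - \<theta>2 (2 * z) ^ 2"
proof -
  assume z: "Im z > 0"
  have "\<theta>4 z * \<theta>4 z = \<theta>3 (2 * z) * \<theta>3 (2 * z) + \<theta>2 (2 * z) * theta (\<lambda>N. - w2 N) (2 * z)"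
  proof (rule theta_mult[OF z])
    fix U V :: int
    show "w4 (U + V) * w4 (U - V) = w3 U * w3 V + w2 U * - w2 V"
    proof -
      have "even (U + V) \<Longrightarrow> (4 dvd U + V \<longleftrightarrow> 4 dvd U - V) \<longleftrightarrow> even V" by presburger
      then show ?thesis
        by (cases "even U"; cases "even V"; cases "4 dvd U + V"; cases "4 dvd U - V")
           (simp_all add: w4_def w3_def w2_def)
    qed
  qed (auto simp: w4_def)
  then show ?thesis by (simp add: theta_uminus power2_eq_square)
qed

lemma theta2_sq: "Im z > 0 \<Longrightarrow> \<theta>2 z ^ 2 = 2 * \<theta>2 (2 * z) * \<theta>3 (2 * z)"
proof -
  assume z: "Im z > 0"
  have "\<theta>2 z * \<theta>2 z = \<theta>2 (2 * z) * \<theta>3 (2 * z) + \<theta>3 (2 * z) * \<theta>2 (2 * z)"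
    by (rule theta_mult[OF z]) (auto simp: w3_def w2_def)
  then show ?thesis by (simp add: power2_eq_square)
qed

lemma theta3_theta4: "Im z > 0 \<Longrightarrow> \<theta>3 z * \<theta>4 z = \<theta>4 (2 * z) ^ 2"
proof -
  assume z: "Im z > 0"
  have "\<theta>3 z * \<theta>4 z = \<theta>4 (2 * z) * \<theta>4 (2 * z) + theta w1 (2 * z) * theta w1 (2 * z)"
  proof (rule theta_mult[OF z])
    fix U V :: int
    show "w3 (U + V) * w4 (U - V) = w4 U * w4 V + w1 U * w1 V"
    proof -
      have "even U \<Longrightarrow> even V \<Longrightarrow> 4 dvd U - V \<longleftrightarrow> (4 dvd U \<longleftrightarrow> 4 dvd V)"
        "odd U \<Longrightarrow> odd V \<Longrightarrow> 4 dvd U - V \<longleftrightarrow> (4 dvd U - 1 \<longleftrightarrow> 4 dvd V - 1)" by presburger+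
      then show ?thesis
        by (cases "even U"; cases "even V"; cases "4 dvd U - V")
           (auto simp add: w4_def w3_def w1_def)
    qed
  qed (auto simp: w4_def w3_def)
  then show ?thesis by (simp add: theta_w1 power2_eq_square)
qed

lemma theta_add:
  assumes "Im z > 0" "bounded_weight \<kappa>" "bounded_weight \<psi>"
  shows "theta (\<lambda>N. \<kappa> N + \<psi> N) z = theta \<kappa> z + theta \<psi> z"
proof -
  have "((\<lambda>N. (\<kappa> N + \<psi> N) * gauss z N) has_sum (theta \<kappa> z + theta \<psi> z)) UNIV"
    using has_sum_add[OF has_sum_theta[OF assms(1,2)] has_sum_theta[OF assms(1,3)]]
    by (simp add: distrib_right)
  then show ?thesis unfolding theta_def by (rule infsumI)
qed

lemma theta3_quarter: "Im z > 0 \<Longrightarrow> \<theta>3 (4 * z) = (\<Sum>\<^sub>\<infinity>n\<in>UNIV. gauss (16 * z) n)"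
proof -
  assume z: "Im z > 0"
  have "\<theta>3 (4 * z) = (\<Sum>\<^sub>\<infinity>N\<in>{N. even N}. gauss (4 * z) N)"
    unfolding theta_def by (rule infsum_cong_neutral) (auto simp: w3_def)
  also have "\<dots> = (\<Sum>\<^sub>\<infinity>n\<in>UNIV. gauss (16 * z) n)"
    by (rule infsum_reindex_bij_witness[of _ "\<lambda>n. 2 * n" "\<lambda>n. n div 2"])
       (auto simp: gauss_def power_mult_distrib mult_ac elim!: evenE)
  finally show ?thesis .
qed

text \<open>Even and odd N together run through all integers. This expresses \<theta>_2 through
  \<theta>_3, whose behaviour at 0 is the only one estimated directly.\<close>

lemma theta3_add_theta2: "Im z > 0 \<Longrightarrow> \<theta>3 (4 * z) + \<theta>2 (4 * z) = \<theta>3 z"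
proof -
  assume z: "Im z > 0"
  have "\<theta>3 (4 * z) + \<theta>2 (4 * z) = theta (\<lambda>N. w3 N + w2 N) (4 * z)"
    using z by (subst theta_add) auto
  also have "\<dots> = (\<Sum>\<^sub>\<infinity>N\<in>UNIV. gauss (4 * z) N)"
    unfolding theta_def by (intro infsum_cong) (auto simp: w3_def w2_def)
  also have "\<dots> = \<theta>3 z" using theta3_quarter[of "z / 4"] z by simp
  finally show ?thesis .
qed

section \<open>Translation by 1\<close>

lemma gauss_add_1_even: "gauss (z + 1) (2 * n) = (if even n then 1 else -1) * gauss z (2 * n)"
proof -
  have "gauss (z + 1) (2 * n) = exp (of_real pi * \<i> * of_int (n ^ 2)) * gauss z (2 * n)"
  proof -
    have "of_real pi * \<i> * (z + 1) / 4 * of_int ((2 * n) ^ 2)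
      = of_real pi * \<i> * of_int (n ^ 2) + of_real pi * \<i> * z / 4 * of_int ((2 * n) ^ 2)"
      by (simp add: power_mult_distrib algebra_simps add_divide_distrib)
    then show ?thesis by (simp only: gauss_def exp_add)
  qed
  moreover have "exp (of_real pi * \<i> * of_int (n ^ 2)) = (if even n then 1 else -1)"
  proof (cases "even n")
    case True
    then obtain k where "n ^ 2 = 2 * k" by (metis evenE power2_eq_square mult.assoc)
    then have "exp (of_real pi * \<i> * of_int (n ^ 2)) = exp (2 * of_int k * of_real pi * \<i>)"
      by (simp add: mult_ac)
    then show ?thesis using True exp_two_pi_i[unfolded] by (simp add: exp_eq_1)
  next
    case False
    then obtain k where "n ^ 2 = 2 * k + 1" by (metis oddE even_power pos2)
    then have "exp (of_real pi * \<i> * of_int (n ^ 2)) = exp (2 * of_int k * of_real pi * \<i>) * exp (of_real pi * \<i>)"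
      by (simp add: algebra_simps flip: exp_add)
    moreover have "exp (2 * of_int k * of_real pi * \<i>) = 1" by (simp add: exp_eq_1)
    ultimately show ?thesis using False by simp
  qed
  ultimately show ?thesis by simp
qed

text \<open>Odd squares are 1 modulo 8, so all odd terms pick up the same eighth root of
  unity.\<close>

lemma gauss_add_1_odd: 
  assumes "odd N"
  shows "gauss (z + 1) N = exp (of_real pi * \<i> / 4) * gauss z N"
proof -
  obtain n where n: "N = 2 * n + 1" using assms by (elim oddE)
  have "even (n * (n + 1))" by simp
  then obtain k where "n * (n + 1) = 2 * k" by (elim evenE)
  then have k: "N ^ 2 = 8 * k + 1" unfolding n power2_eq_square by (simp add: algebra_simps)
  have "gauss (z + 1) N = exp (of_real pi * \<i> / 4 * of_int (N ^ 2)) * gauss z N"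
    by (simp add: gauss_def field_simps flip: exp_add)
  also have "exp (of_real pi * \<i> / 4 * of_int (N ^ 2)) = exp (2 * of_int k * of_real pi * \<i>) * exp (of_real pi * \<i> / 4)"
    unfolding k by (simp add: algebra_simps flip: exp_add)
  also have "exp (2 * of_int k * of_real pi * \<i>) = 1" by (simp add: exp_eq_1)
  finally show ?thesis by simp
qed

lemma four_dvd_double: "4 dvd 2 * n \<longleftrightarrow> even (n::int)"
  by presburger

lemma theta3_add_1: "\<theta>3 (z + 1) = \<theta>4 z"
  unfolding theta_def by (rule infsum_cong) (auto simp: w3_def w4_def gauss_add_1_even four_dvd_double elim!: evenE)

lemma theta4_add_1: "\<theta>4 (z + 1) = \<theta>3 z"
  unfolding theta_def by (rule infsum_cong) (auto simp: w3_def w4_def gauss_add_1_even four_dvd_double elim!: evenE)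

lemma theta2_add_1: "\<theta>2 (z + 1) = exp (of_real pi * \<i> / 4) * \<theta>2 z"
proof -
  have "\<theta>2 (z + 1) = (\<Sum>\<^sub>\<infinity>N\<in>UNIV. exp (of_real pi * \<i> / 4) * (w2 N * gauss z N))"
    unfolding theta_def by (rule infsum_cong) (auto simp: w2_def gauss_add_1_odd)
  then show ?thesis by (simp add: theta_def infsum_cmult_right')
qed

text \<open>\<open>\<delta>\<close> is the residue of N^2 modulo 4 on the support of the weight: 0
  for even and 1 for odd N. Splitting off exp(\<pi> i z \<delta>/4) leaves integral powers of
  exp(\<pi> i z).\<close>

definition theta_coeff :: "nat \<Rightarrow> (int \<Rightarrow> complex) \<Rightarrow> nat \<Rightarrow> complex"
  where "theta_coeff \<delta> \<kappa> n = (\<Sum>N | N ^ 2 = int (\<delta> + 4 * n). \<kappa> N)"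

lemma finite_int_sqrt: "finite {N::int. N ^ 2 = c}"
proof (rule finite_subset)
  show "{N::int. N ^ 2 = c} \<subseteq> {- \<bar>c\<bar>..\<bar>c\<bar>}"
  proof
    fix N :: int assume "N \<in> {N. N ^ 2 = c}"
    then have "\<bar>N\<bar> \<le> \<bar>c\<bar>" using abs_le_square_int[of N] by simp
    then show "N \<in> {- \<bar>c\<bar>..\<bar>c\<bar>}" by auto
  qed
qed simp

lemma theta_expansion:
  assumes z: "Im z > 0" and \<kappa>: "bounded_weight \<kappa>"
    and supp: "\<And>N. \<kappa> N \<noteq> 0 \<Longrightarrow> \<exists>n. N ^ 2 = int (\<delta> + 4 * n)"
  shows "(\<lambda>n. theta_coeff \<delta> \<kappa> n * exp (of_real pi * \<i> * z) ^ n) sums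
    (exp (- (of_real pi * \<i> * z * of_nat \<delta> / 4)) * theta \<kappa> z)"
proof -
  let ?B = "\<lambda>n. {N::int. N ^ 2 = int (\<delta> + 4 * n)}"
  let ?e = "exp (of_real pi * \<i> * z * of_nat \<delta> / 4)"
  have inj: "inj_on snd (Sigma (UNIV :: nat set) ?B)" by (auto simp: inj_on_def)
  have gauss: "gauss z N = ?e * exp (of_real pi * \<i> * z) ^ n" if "N \<in> ?B n" for N n
  proof -
    have "gauss z N = exp (of_real pi * \<i> * z / 4 * of_nat (\<delta> + 4 * n))"
      using that by (auto simp: gauss_def)
    also have "of_real pi * \<i> * z / 4 * of_nat (\<delta> + 4 * n)
        = of_real pi * \<i> * z * of_nat \<delta> / 4 + of_nat n * (of_real pi * \<i> * z)" by (simp add: field_simps)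
    finally show ?thesis by (simp add: exp_add exp_of_nat_mult)
  qed
  have "((\<lambda>N. \<kappa> N * gauss z N) has_sum theta \<kappa> z) (snd ` Sigma UNIV ?B)"
    using has_sum_theta[OF z \<kappa>] 
    by (subst has_sum_cong_neutral[where T = UNIV]) (use supp in \<open>auto simp: image_iff\<close>)
  then have "((\<lambda>(n, N). \<kappa> N * gauss z N) has_sum theta \<kappa> z) (Sigma UNIV ?B)"
    by (subst (asm) has_sum_reindex[OF inj]) (simp add: o_def case_prod_unfold)
  then have "((\<lambda>n. \<Sum>N\<in>?B n. \<kappa> N * gauss z N) has_sum theta \<kappa> z) UNIV"
    by (rule has_sum_Sigma') (auto intro!: has_sum_finiteI finite_int_sqrt)
  then have "(\<lambda>n. \<Sum>N\<in>?B n. \<kappa> N * gauss z N) sums theta \<kappa> z" by (rule has_sum_imp_sums)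
  moreover have "(\<Sum>N\<in>?B n. \<kappa> N * gauss z N) = theta_coeff \<delta> \<kappa> n * (?e * exp (of_real pi * \<i> * z) ^ n)" for n
    unfolding theta_coeff_def sum_distrib_right by (intro sum.cong) (auto simp: gauss)
  ultimately have "(\<lambda>n. exp (- (of_real pi * \<i> * z * of_nat \<delta> / 4)) *
      (theta_coeff \<delta> \<kappa> n * (?e * exp (of_real pi * \<i> * z) ^ n)))
     sums (exp (- (of_real pi * \<i> * z * of_nat \<delta> / 4)) * theta \<kappa> z)"
    by (intro sums_mult) simp
  moreover have e: "exp (- (of_real pi * \<i> * z * of_nat \<delta> / 4)) * ?e = 1" by (simp flip: exp_add)
  have "exp (- (of_real pi * \<i> * z * of_nat \<delta> / 4)) *
      (theta_coeff \<delta> \<kappa> n * (?e * exp (of_real pi * \<i> * z) ^ n))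
      = theta_coeff \<delta> \<kappa> n * exp (of_real pi * \<i> * z) ^ n" for n
  proof -
    have "exp (- (of_real pi * \<i> * z * of_nat \<delta> / 4)) * (theta_coeff \<delta> \<kappa> n * (?e * exp (of_real pi * \<i> * z) ^ n))
      = (exp (- (of_real pi * \<i> * z * of_nat \<delta> / 4)) * ?e) * (theta_coeff \<delta> \<kappa> n * exp (of_real pi * \<i> * z) ^ n)"
      by (simp only: mult_ac)
    then show ?thesis by (simp only: e mult_1)
  qed
  ultimately show ?thesis by simp
qed

lemma theta34_expansion:
  assumes "Im z > 0"
  shows "(\<lambda>n. theta_coeff 0 w3 n * exp (of_real pi * \<i> * z) ^ n) sums \<theta>3 z"
    and "(\<lambda>n. theta_coeff 0 w4 n * exp (of_real pi * \<i> * z) ^ n) sums \<theta>4 z"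
proof -
  have ex: "\<exists>n. N ^ 2 = int (0 + 4 * n)" if "even N" for N :: int
  proof -
    from that obtain m where "N = 2 * m" by (elim evenE)
    then have "N ^ 2 = int (0 + 4 * nat (m ^ 2))" by (simp add: power_mult_distrib)
    then show ?thesis ..
  qed
  show "(\<lambda>n. theta_coeff 0 w3 n * exp (of_real pi * \<i> * z) ^ n) sums \<theta>3 z"
    using theta_expansion[of z w3 0, OF assms _ ex] by (simp add: w3_def split: if_splits)
  show "(\<lambda>n. theta_coeff 0 w4 n * exp (of_real pi * \<i> * z) ^ n) sums \<theta>4 z"
    using theta_expansion[of z w4 0, OF assms _ ex] by (simp add: w4_def split: if_splits)
qed

lemma theta2_expansion:
  assumes "Im z > 0"
  shows "(\<lambda>n. theta_coeff 1 w2 n * exp (of_real pi * \<i> * z) ^ n) sums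
    (exp (- (of_real pi * \<i> * z / 4)) * \<theta>2 z)"
proof -
  have "\<exists>n. N ^ 2 = int (1 + 4 * n)" if "odd N" for N :: int
  proof -
    from that obtain m where "N = 2 * m + 1" by (elim oddE)
    then have "N ^ 2 = 1 + 4 * (m ^ 2 + m)" by (simp add: power2_eq_square algebra_simps)
    moreover have "0 \<le> m ^ 2 + m" using abs_le_square_int[of m] by linarith
    ultimately have "N ^ 2 = int (1 + 4 * nat (m ^ 2 + m))" by simp
    then show ?thesis ..
  qed
  then show ?thesis
    using theta_expansion[of z w2 1, OF assms] by (simp add: w2_def split: if_splits)
qed

lemma theta_coeff_0:
  "theta_coeff 0 w3 0 = 1" "theta_coeff 0 w4 0 = 1" "theta_coeff 1 w2 0 = 2"
proof -
  have "{N :: int. N ^ 2 = int (1 + 4 * 0)} = {1, -1}" by (auto simp: power2_eq_1_iff)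
  then show "theta_coeff 1 w2 0 = 2" by (simp only: theta_coeff_def) (simp add: w2_def)
qed (simp_all add: theta_coeff_def w3_def w4_def)

text \<open>The principal logarithm also bounds the real part; this confines points to one period
  strip of z \<mapsto> z + 2 in the maximum principle argument.\<close>

lemma exists_exp_pi:
  assumes "s \<noteq> 0" "norm s < 1"
  obtains z where "Im z > 0" "s = exp (of_real pi * \<i> * z)" "\<bar>Re z\<bar> \<le> 1"
proof
  let ?z = "Ln s / (of_real pi * \<i>)"
  have eq: "?z = - \<i> * Ln s / of_real pi" by (simp add: field_simps)
  have im: "Im ?z = - ln (norm s) / pi" "Re ?z = Im (Ln s) / pi"
    unfolding eq by (simp_all add: Re_Ln assms)
  show "Im ?z > 0" using assms by (simp add: im divide_neg_pos)
  show "s = exp (of_real pi * \<i> * ?z)" using assms by simp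
  show "\<bar>Re ?z\<bar> \<le> 1"
    using mpi_less_Im_Ln[OF assms(1)] Im_Ln_le_pi[OF assms(1)] by (simp add: im abs_le_iff)
qed

text \<open>Every punctured point of the disc is a value of exp(\<pi> i z), so the series converges
  at a real point of larger modulus than s.\<close>

lemma expansion_summable:
  assumes f: "\<And>z. Im z > 0 \<Longrightarrow> (\<lambda>n. c n * exp (of_real pi * \<i> * z) ^ n) sums f z"
    and s: "norm s < 1"
  shows "summable (\<lambda>n. norm (c n * s ^ n))"
proof -
  obtain r where r: "norm s < r" "r < 1" using s dense by blast
  then have r0: "r > 0" using norm_ge_zero[of s] by linarith
  obtain z where "Im z > 0" "complex_of_real r = exp (of_real pi * \<i> * z)"
    using exists_exp_pi[of "of_real r"] r r0 by auto
  then have "summable (\<lambda>n. c n * of_real r ^ n)" using f sums_summable by metis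
  then show ?thesis by (rule powser_insidea) (use r r0 in simp)
qed

text \<open>The extension F fills in the puncture s = 0, which is the cusp.\<close>

lemma expansion_holomorphic:
  assumes f: "\<And>z. Im z > 0 \<Longrightarrow> (\<lambda>n. c n * exp (of_real pi * \<i> * z) ^ n) sums f z"
  obtains F where "F holomorphic_on ball 0 1" "F 0 = c 0"
    "\<And>z. Im z > 0 \<Longrightarrow> f z = F (exp (of_real pi * \<i> * z))"
    "\<And>s. norm s < 1 \<Longrightarrow> (\<lambda>n. c n * s ^ n) sums F s"
proof
  let ?F = "\<lambda>s. suminf (\<lambda>n. c n * s ^ n)"
  show sums: "(\<lambda>n. c n * s ^ n) sums ?F s" if "norm s < 1" for s
    using expansion_summable[OF f that] by (intro summable_sums) (rule summable_norm_cancel)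
  show "?F holomorphic_on ball 0 1"
    by (rule power_series_holomorphic[where a = c]) (use sums in \<open>simp add: dist_norm\<close>)
  show "?F 0 = c 0" by (rule sums_unique2[OF sums]) (auto simp: powser_sums_zero)
  show "f z = ?F (exp (of_real pi * \<i> * z))" if "Im z > 0" for z
    using f[OF that] by (rule sums_unique)
qed

lemma open_upper_half_plane: "open {z. Im z > 0}"
  by (rule open_halfspace_Im_gt)

lemma expansion_holomorphic_upper_half_plane:
  assumes f: "\<And>z. Im z > 0 \<Longrightarrow> (\<lambda>n. c n * exp (of_real pi * \<i> * z) ^ n) sums f z"
  shows "f holomorphic_on {z. Im z > 0}"
proof -
  obtain F where F: "F holomorphic_on ball 0 1" "\<And>z. Im z > 0 \<Longrightarrow> f z = F (exp (of_real pi * \<i> * z))"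
    using expansion_holomorphic[OF f] by metis
  have "(\<lambda>z. F (exp (of_real pi * \<i> * z))) holomorphic_on {z. Im z > 0}"
    by (rule holomorphic_on_compose_gen[OF _ F(1), unfolded o_def])
       (auto intro!: holomorphic_intros)
  then show ?thesis using F(2) by (metis (mono_tags, lifting) holomorphic_cong mem_Collect_eq)
qed

lemma tendsto_exp_pi_at_i_infinity:
  assumes "filterlim (\<lambda>n. Im (z n)) at_top F"
  shows "((\<lambda>n. exp (of_real pi * \<i> * z n)) \<longlongrightarrow> 0) F"
proof (rule tendsto_norm_zero_cancel)
  have "filterlim (\<lambda>n. - (pi * Im (z n))) at_bot F"
    unfolding filterlim_uminus_at_bot minus_minus
    by (rule filterlim_tendsto_pos_mult_at_top[OF tendsto_const pi_gt_zero assms])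
  then show "((\<lambda>n. norm (exp (of_real pi * \<i> * z n))) \<longlongrightarrow> 0) F"
    using filterlim_compose[OF exp_at_bot] by simp
qed

text \<open>An arbitrary filter is allowed because the limit is taken both along z, 2z, 4z, ... and
  along the points i (n + 1).\<close>

lemma expansion_tendsto:
  assumes f: "\<And>z. Im z > 0 \<Longrightarrow> (\<lambda>n. c n * exp (of_real pi * \<i> * z) ^ n) sums f z"
    and z: "filterlim (\<lambda>n. Im (z n)) at_top F"
  shows "((\<lambda>n. f (z n)) \<longlongrightarrow> c 0) F"
proof -
  obtain H where H: "H holomorphic_on ball 0 1" "H 0 = c 0"
      "\<And>z. Im z > 0 \<Longrightarrow> f z = H (exp (of_real pi * \<i> * z))"
    using expansion_holomorphic[OF f] by metis
  have "isCont H 0"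
    using H(1) by (meson centre_in_ball continuous_on_interior holomorphic_on_imp_continuous_on
        interior_open open_ball zero_less_one continuous_at_imp_continuous_at_within continuous_on_eq_continuous_at)
  then have "((\<lambda>n. H (exp (of_real pi * \<i> * z n))) \<longlongrightarrow> c 0) F"
    using isCont_tendsto_compose[OF _ tendsto_exp_pi_at_i_infinity[OF z]] H(2) by metis
  moreover have "\<forall>\<^sub>F n in F. H (exp (of_real pi * \<i> * z n)) = f (z n)"
  proof -
    have "\<forall>\<^sub>F n in F. 0 < Im (z n)" using z unfolding filterlim_at_top_dense by blast
    then show ?thesis by (rule eventually_mono) (simp add: H(3))
  qed
  ultimately show ?thesis by (rule Lim_transform_eventually)
qed

section \<open>Non-vanishing of the theta constants\<close>

lemma filterlim_Im_double:
  assumes "Im z > 0"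
  shows "filterlim (\<lambda>n::nat. Im (2 ^ n * z)) at_top sequentially"
proof -
  have "filterlim (\<lambda>n::nat. (2::real) ^ n) at_top sequentially"
    by (intro filterlim_at_infinity_imp_filterlim_at_top filterlim_realpow_sequentially_gt1) auto
  then have "filterlim (\<lambda>n::nat. Im z * 2 ^ n) at_top sequentially"
    by (rule filterlim_tendsto_pos_mult_at_top[OF tendsto_const assms])
  moreover have "Im (2 ^ n * z) = Im z * 2 ^ n" for n
  proof -
    have "(2 :: complex) ^ n * z = of_real (2 ^ n) * z" by simp
    then show ?thesis by (simp only: Im_complex_of_real Re_complex_of_real times_complex.sel) simp
  qed
  ultimately show ?thesis by (simp add: mult.commute)
qed

lemma Im_double_pos: "Im z > 0 \<Longrightarrow> Im (2 ^ n * z) > 0"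
proof (induction n)
  case (Suc n)
  have "2 ^ Suc n * z = 2 * (2 ^ n * z)" by simp
  then show ?case using Suc by (simp only:) simp
qed simp

lemma theta34_double_tendsto:
  assumes "Im z > 0"
  shows "(\<lambda>n. \<theta>3 (2 ^ n * z)) \<longlonglongrightarrow> 1" "(\<lambda>n. \<theta>4 (2 ^ n * z)) \<longlonglongrightarrow> 1"
  using expansion_tendsto[OF theta34_expansion(1) filterlim_Im_double[OF assms]]
    expansion_tendsto[OF theta34_expansion(2) filterlim_Im_double[OF assms]]
  by (simp_all add: theta_coeff_0)

text \<open>By \<theta>_3(z) \<theta>_4(z) = \<theta>_4(2z)^2 a zero would propagate to all 2^n z,
  against the limit 1 at the cusp.\<close>

lemma theta4_nonzero:
  assumes "Im z > 0"
  shows "\<theta>4 z \<noteq> 0"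
proof
  assume "\<theta>4 z = 0"
  then have "\<theta>4 (2 ^ n * z) = 0" for n
  proof (induction n)
    case (Suc n)
    then show ?case
      using theta3_theta4[OF Im_double_pos[OF assms, of n]] by (simp add: mult.assoc)
  qed simp
  then show False
    using theta34_double_tendsto(2)[OF assms] LIMSEQ_unique[OF tendsto_const] by fastforce
qed

lemma theta3_nonzero: "Im z > 0 \<Longrightarrow> \<theta>3 z \<noteq> 0"
  using theta3_theta4[of z] theta4_nonzero[of "2 * z"] by auto

text \<open>The same propagation, against the limit 2 of exp(-\<pi> i z/4) \<theta>_2(z) at the
  cusp.\<close>

lemma theta2_nonzero:
  assumes "Im z > 0"
  shows "\<theta>2 z \<noteq> 0"
proof
  assume "\<theta>2 z = 0"
  then have "\<theta>2 (2 ^ n * z) = 0" for n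
  proof (induction n)
    case (Suc n)
    then have "\<theta>2 (2 * (2 ^ n * z)) * \<theta>3 (2 * (2 ^ n * z)) = 0"
      using theta2_sq[OF Im_double_pos[OF assms, of n]] by simp
    moreover have "\<theta>3 (2 * (2 ^ n * z)) \<noteq> 0"
      using Im_double_pos[OF assms, of "Suc n"] by (intro theta3_nonzero) (simp add: mult.assoc)
    ultimately show ?case by (simp add: mult.assoc)
  qed simp
  then have "(\<lambda>n::nat. 0) \<longlonglongrightarrow> theta_coeff 1 w2 0"
    using expansion_tendsto[OF theta2_expansion filterlim_Im_double[OF assms]] by simp
  from LIMSEQ_unique[OF this tendsto_const] show False by (simp add: theta_coeff_0 del: One_nat_def)
qed

section \<open>Behaviour on the imaginary axis\<close>

lemma theta_real:
  assumes "\<And>N. \<kappa> N \<in> \<real>"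
  shows "theta \<kappa> (\<i> * of_real y) \<in> \<real>"
proof -
  have "\<kappa> N * gauss (\<i> * of_real y) N = of_real (Re (\<kappa> N) * exp (- pi * y / 4 * of_int (N ^ 2)))" for N
  proof -
    have "of_real pi * \<i> * (\<i> * of_real y) / 4 * of_int (N ^ 2) = of_real (- pi * y / 4 * of_int (N ^ 2))"
      by (simp add: algebra_simps)
    then have "gauss (\<i> * of_real y) N = of_real (exp (- pi * y / 4 * of_int (N ^ 2)))"
      by (simp only: gauss_def exp_of_real)
    then show ?thesis using of_real_Re[OF assms, of N] by simp
  qed
  then have Im0: "Im (\<kappa> N * gauss (\<i> * of_real y) N) = 0" for N by (simp only: Im_complex_of_real)
  show ?thesis
  proof (cases "(\<lambda>N. \<kappa> N * gauss (\<i> * of_real y) N) summable_on UNIV")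
    case True
    then have "((\<lambda>N. \<kappa> N * gauss (\<i> * of_real y) N) has_sum theta \<kappa> (\<i> * of_real y)) UNIV"
      unfolding theta_def by (rule has_sum_infsum)
    from has_sum_Im[OF this] have "((\<lambda>N::int. 0) has_sum Im (theta \<kappa> (\<i> * of_real y))) UNIV"
      by (simp only: Im0)
    from has_sum_unique[OF this has_sum_0] show ?thesis by (simp add: complex_is_Real_iff)
  next
    \<comment> \<open>A sum that fails to converge has the default value 0, which is real, so that y
      may be any real number.\<close>
    case False
    then show ?thesis unfolding theta_def by (simp only: infsum_not_exists Reals_0 not_False_eq_True)
  qed
qed

lemma weights_real: "w2 N \<in> \<real>" "w3 N \<in> \<real>" "w4 N \<in> \<real>"
  by (auto simp: w2_def w3_def w4_def)

text \<open>The squares a, b, c of \<theta>_3, \<theta>_4, \<theta>_2 are the quantities that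
  Landen's transformation turns into an arithmetic-geometric mean iteration.\<close>

definition axis_sq :: "(int \<Rightarrow> complex) \<Rightarrow> real \<Rightarrow> real"
  where "axis_sq \<kappa> y = Re (theta \<kappa> (\<i> * of_real y)) ^ 2"

lemma of_real_axis_sq:
  "(\<And>N. \<kappa> N \<in> \<real>) \<Longrightarrow> of_real (axis_sq \<kappa> y) = theta \<kappa> (\<i> * of_real y) ^ 2"
  using of_real_Re[OF theta_real[of \<kappa> y]] by (simp add: axis_sq_def)

abbreviation "ax \<equiv> axis_sq w3"
abbreviation "bx \<equiv> axis_sq w4"
abbreviation "cx \<equiv> axis_sq w2"

lemma axis_sq_pos:
  assumes "y > 0"
  shows "ax y > 0" "bx y > 0" "cx y > 0"
proof -
  have im: "Im (\<i> * of_real y) > 0" using assms by simp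
  have "axis_sq \<kappa> y > 0" if "\<And>N. \<kappa> N \<in> \<real>" "theta \<kappa> (\<i> * of_real y) \<noteq> 0" for \<kappa>
  proof -
    have "axis_sq \<kappa> y \<noteq> 0" using of_real_axis_sq[of \<kappa> y] that by auto
    then show ?thesis by (simp add: axis_sq_def)
  qed
  then show "ax y > 0" "bx y > 0" "cx y > 0"
    using theta2_nonzero[OF im] theta3_nonzero[OF im] theta4_nonzero[OF im] weights_real by blast+
qed

lemma axis_landen:
  assumes "y > 0"
  shows "ax y = ax (2 * y) + cx (2 * y)" "bx y = ax (2 * y) - cx (2 * y)"
    "cx y ^ 2 = 4 * cx (2 * y) * ax (2 * y)" "ax y * bx y = bx (2 * y) ^ 2"
proof -
  let ?z = "\<i> * of_real y"
  have im: "Im ?z > 0" using assms by simp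
  have 2: "\<i> * of_real (2 * y) = 2 * ?z" by simp
  note ax = of_real_axis_sq[of w3, OF weights_real(2)]
    and bx = of_real_axis_sq[of w4, OF weights_real(3)]
    and cx = of_real_axis_sq[of w2, OF weights_real(1)]
  have "complex_of_real (ax y) = of_real (ax (2 * y) + cx (2 * y))"
    unfolding of_real_add ax cx 2 using theta3_sq[OF im] .
  then show "ax y = ax (2 * y) + cx (2 * y)" by (simp only: of_real_eq_iff)
  have "complex_of_real (bx y) = of_real (ax (2 * y) - cx (2 * y))"
    unfolding of_real_diff ax bx cx 2 using theta4_sq[OF im] .
  then show "bx y = ax (2 * y) - cx (2 * y)" by (simp only: of_real_eq_iff)
  have "complex_of_real (cx y ^ 2) = of_real (4 * cx (2 * y) * ax (2 * y))"
    unfolding of_real_mult of_real_power ax cx 2 theta2_sq[OF im]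
    by (simp add: power_mult_distrib mult.left_commute[of 2 \<i>])
  then show "cx y ^ 2 = 4 * cx (2 * y) * ax (2 * y)" by (simp only: of_real_eq_iff)
  have "complex_of_real (ax y * bx y) = of_real (bx (2 * y) ^ 2)"
    unfolding of_real_mult of_real_power ax bx 2 using theta3_theta4[OF im]
    by (simp add: mult.left_commute[of 2 \<i>] flip: power_mult_distrib)
  then show "ax y * bx y = bx (2 * y) ^ 2" by (simp only: of_real_eq_iff)
qed

lemma axis_tendsto_i_infinity:
  assumes "y > 0"
  shows "(\<lambda>n. ax (2 ^ n * y)) \<longlonglongrightarrow> 1"
proof -
  have im: "Im (\<i> * of_real y) > 0" using assms by simp
  have "(\<lambda>n. Re (\<theta>3 (2 ^ n * (\<i> * of_real y))) ^ 2) \<longlonglongrightarrow> Re 1 ^ 2"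
    by (intro tendsto_intros theta34_double_tendsto[OF im])
  moreover have "2 ^ n * (\<i> * of_real y) = \<i> * of_real (2 ^ n * y)" for n by simp
  ultimately show ?thesis by (simp only: axis_sq_def) simp
qed

section \<open>Asymptotics at 0 from Riemann sums of the Gaussian\<close>

lemma gauss_integral: "((\<lambda>x::real. exp (- x\<^sup>2)) has_integral (sqrt pi / 2)) {0..}"
proof -
  have "has_bochner_integral lborel (\<lambda>x. indicator {0..} x *\<^sub>R exp (- x\<^sup>2)) (sqrt pi / 2)"
    by (rule gaussian_moment_0)
  then have "((\<lambda>x. indicator {0..} x *\<^sub>R exp (- x\<^sup>2)) has_integral (sqrt pi / 2)) UNIV"
    using has_integral_integral_lborel by (metis (no_types, lifting) has_bochner_integral_iff)
  moreover have "(\<lambda>x. indicator {0..} x *\<^sub>R exp (- x\<^sup>2)) = (\<lambda>x::real. if x \<in> {0..} then exp (- x\<^sup>2) else 0)"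
    by (auto simp: indicator_def)
  ultimately show ?thesis by (simp only: has_integral_restrict_UNIV)
qed

text \<open>exp(-x^2) decreases for x \<ge> 0, so the left and right sums of mesh h enclose the
  integral and differ by h.\<close>

lemma gauss_riemann_sum:
  fixes h :: real
  assumes h: "h > 0"
  shows "summable (\<lambda>n. exp (- (real n * h)\<^sup>2))"
    "sqrt pi / 2 \<le> h * suminf (\<lambda>n. exp (- (real n * h)\<^sup>2))"
    "h * suminf (\<lambda>n. exp (- (real n * h)\<^sup>2)) \<le> sqrt pi / 2 + h"
proof -
  let ?f = "\<lambda>x::real. exp (- x\<^sup>2)"
  have int: "?f integrable_on {a..b}" for a b
    by (intro integrable_continuous_interval continuous_intros)
  have mono: "?f y \<le> ?f x" if "0 \<le> x" "x \<le> y" for x y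
    using that by (simp add: power_mono)
  have step: "h * ?f (real (Suc n) * h) \<le> integral {real n * h..real (Suc n) * h} ?f"
      "integral {real n * h..real (Suc n) * h} ?f \<le> h * ?f (real n * h)" for n
  proof -
    have len: "real (Suc n) * h - real n * h = h" by (simp add: algebra_simps)
    have le: "real n * h \<le> real (Suc n) * h" using h by simp
    have "integral {real n * h..real (Suc n) * h} (\<lambda>_. ?f (real (Suc n) * h))
        \<le> integral {real n * h..real (Suc n) * h} ?f"
      using h by (intro integral_le int integrable_const_ivl mono)
        (auto intro: order.trans[of 0 "real n * h"])
    then show "h * ?f (real (Suc n) * h) \<le> integral {real n * h..real (Suc n) * h} ?f"
      using le by (simp add: len del: of_nat_Suc)
    have "integral {real n * h..real (Suc n) * h} ?f
        \<le> integral {real n * h..real (Suc n) * h} (\<lambda>_. ?f (real n * h))"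
      using h by (intro integral_le int integrable_const_ivl mono) auto
    then show "integral {real n * h..real (Suc n) * h} ?f \<le> h * ?f (real n * h)"
      using le by (simp add: len del: of_nat_Suc)
  qed
  have int_sum: "integral {0..real N * h} ?f = (\<Sum>n<N. integral {real n * h..real (Suc n) * h} ?f)" for N
  proof (induction N)
    case (Suc N)
    have "integral {0..real N * h} ?f + integral {real N * h..real (Suc N) * h} ?f = integral {0..real (Suc N) * h} ?f"
      using h by (intro Henstock_Kurzweil_Integration.integral_combine int) auto
    then show ?case using Suc by simp
  qed simp
  have lim: "(\<lambda>N. integral {0..real N * h} ?f) \<longlonglongrightarrow> sqrt pi / 2"
  proof -
    have "(\<lambda>N. integral {0..} (\<lambda>x. if x \<in> {0..real N * h} then ?f x else 0)) \<longlonglongrightarrow> integral {0..} ?f"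
    proof (rule dominated_convergence(2)[where h = ?f])
      show "(\<lambda>x. if x \<in> {0..real N * h} then ?f x else 0) integrable_on {0..}" for N
        using int[of 0 "real N * h"] by (subst integrable_restrict_Int) (simp add: Int_absorb2)
      show "?f integrable_on {0..}" using gauss_integral by blast
      fix x :: real assume x: "x \<in> {0..}"
      obtain K where K: "x / h \<le> real K" using real_arch_simple by blast
      have "\<forall>\<^sub>F N in sequentially. (if x \<in> {0..real N * h} then ?f x else 0) = ?f x"
        using eventually_ge_at_top[of K]
      proof (rule eventually_mono)
        fix N assume "K \<le> N"
        then have "x / h \<le> real N" using K by linarith
        then have "x \<le> real N * h" using h by (simp add: field_simps)
        then show "(if x \<in> {0..real N * h} then ?f x else 0) = ?f x" using x by simp
      qed
      then show "(\<lambda>N. if x \<in> {0..real N * h} then ?f x else 0) \<longlonglongrightarrow> ?f x"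
        by (rule tendsto_eventually)
    qed auto
    moreover have "integral {0..} (\<lambda>x. if x \<in> {0..real N * h} then ?f x else 0) = integral {0..real N * h} ?f" for N
      by (subst integral_restrict_Int) (simp add: Int_absorb1)
    ultimately show ?thesis using integral_unique[OF gauss_integral] by simp
  qed
  have le_int: "integral {0..real N * h} ?f \<le> sqrt pi / 2" for N
    using integral_subset_le[of "{0..real N * h}" "{0..}" ?f] int gauss_integral integral_unique[OF gauss_integral]
    by auto
  have upper: "(\<Sum>n<N. h * ?f (real (Suc n) * h)) \<le> sqrt pi / 2" for N
    using sum_mono[of "{..<N}", OF step(1)] le_int[of N] unfolding int_sum by (meson order.trans)
  have summ: "summable (\<lambda>n. h * ?f (real (Suc n) * h))"
    by (rule summableI_nonneg_bounded[OF _ upper]) (use h in simp)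
  then have "summable (\<lambda>n. ?f (real (Suc n) * h))" using h by (simp add: summable_cmult_iff)
  then show s: "summable (\<lambda>n. ?f (real n * h))" by (subst (asm) summable_Suc_iff)
  have hs: "summable (\<lambda>n. h * ?f (real n * h))" using s by (rule summable_mult)
  have eq: "h * suminf (\<lambda>n. ?f (real n * h)) = suminf (\<lambda>n. h * ?f (real n * h))"
    using s by (rule suminf_mult[symmetric])
  show "sqrt pi / 2 \<le> h * suminf (\<lambda>n. ?f (real n * h))"
  proof (rule LIMSEQ_le_const2[OF lim], intro exI allI impI)
    fix N
    have "integral {0..real N * h} ?f \<le> (\<Sum>n<N. h * ?f (real n * h))"
      unfolding int_sum by (intro sum_mono step(2))
    also have "\<dots> \<le> suminf (\<lambda>n. h * ?f (real n * h))"
      using h by (intro sum_le_suminf hs) auto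
    finally show "integral {0..real N * h} ?f \<le> h * suminf (\<lambda>n. ?f (real n * h))" by (simp only: eq)
  qed
  have "suminf (\<lambda>n. h * ?f (real (Suc n) * h)) \<le> sqrt pi / 2"
    by (rule suminf_le_const[OF summ upper])
  then show "h * suminf (\<lambda>n. ?f (real n * h)) \<le> sqrt pi / 2 + h"
    unfolding eq using suminf_split_head[OF hs] by simp
qed

text \<open>With h = sqrt(\<pi> y) the series is a two-sided Riemann sum, twice the half-line sum
  minus the term at 0. Its error h, divided by sqrt \<pi>, is sqrt y.\<close>

lemma theta3_axis_bound:
  assumes y: "y > 0"
  shows "\<bar>sqrt y * Re (\<theta>3 (\<i> * of_real y)) - 1\<bar> \<le> sqrt y"
proof -
  define h where "h = sqrt (pi * y)"
  have h: "h > 0" "h ^ 2 = pi * y" using y by (simp_all add: h_def)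
  let ?g = "\<lambda>n::int. exp (- (real_of_int n * h)\<^sup>2)"
  let ?S = "suminf (\<lambda>n. exp (- (real n * h)\<^sup>2))"
  note S = gauss_riemann_sum[OF h(1)]
  have im: "Im (\<i> * of_real y / 4) > 0" using y by simp
  have g: "gauss (16 * (\<i> * of_real y / 4)) n = of_real (?g n)" for n
  proof -
    have "of_real pi * \<i> * (16 * (\<i> * of_real y / 4)) / 4 * of_int (n ^ 2) = of_real (- (real_of_int n * h)\<^sup>2)"
      unfolding power_mult_distrib h(2) by (simp add: algebra_simps)
    then show ?thesis by (simp only: gauss_def exp_of_real)
  qed
  have "(?g has_sum (?S + (?S - 1))) UNIV"
  proof -
    have nn: "((\<lambda>n. exp (- (real n * h)\<^sup>2)) has_sum ?S) UNIV"
      using S(1) by (intro sums_nonneg_imp_has_sum summable_sums) auto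
    have "summable (\<lambda>n. exp (- (real (Suc n) * h)\<^sup>2))" using S(1) by (subst summable_Suc_iff)
    then have "((\<lambda>n. exp (- (real (Suc n) * h)\<^sup>2)) has_sum (?S - 1)) UNIV"
      using suminf_split_head[OF S(1)] summable_sums[of "\<lambda>n. exp (- (real (Suc n) * h)\<^sup>2)"]
      by (intro sums_nonneg_imp_has_sum) auto
    then have neg: "(?g has_sum (?S - 1)) (range (\<lambda>n. - int (Suc n)))"
      by (subst has_sum_reindex) (auto simp: inj_on_def o_def algebra_simps power2_eq_square)
    have pos: "(?g has_sum ?S) (range int)"
      using nn by (subst has_sum_reindex) (auto simp: o_def)
    have "(?g has_sum (?S + (?S - 1))) (range int \<union> range (\<lambda>n. - int (Suc n)))"
      using pos neg by (rule has_sum_Un_disjoint) auto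
    then show ?thesis by (simp only: int_UNIV_split)
  qed
  from has_sum_of_real[OF this, where 'a = complex]
  have "(\<Sum>\<^sub>\<infinity>n\<in>UNIV. gauss (16 * (\<i> * of_real y / 4)) n) = of_real (?S + (?S - 1))"
    unfolding g by (rule infsumI)
  then have "\<theta>3 (\<i> * of_real y) = of_real (?S + (?S - 1))"
    using theta3_quarter[OF im] by simp
  then have "Re (\<theta>3 (\<i> * of_real y)) = 2 * ?S - 1" by simp
  then have "h * Re (\<theta>3 (\<i> * of_real y)) = 2 * (h * ?S) - h"
    by (simp only: right_diff_distrib mult.left_commute mult_1_right)
  then have "\<bar>h * Re (\<theta>3 (\<i> * of_real y)) - sqrt pi\<bar> \<le> h" using S(2,3) by linarith
  moreover have "h * Re (\<theta>3 (\<i> * of_real y)) - sqrt pi = sqrt pi * (sqrt y * Re (\<theta>3 (\<i> * of_real y)) - 1)"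
    by (simp add: h_def real_sqrt_mult algebra_simps)
  ultimately have "sqrt pi * \<bar>sqrt y * Re (\<theta>3 (\<i> * of_real y)) - 1\<bar> \<le> sqrt pi * sqrt y"
    by (simp add: abs_mult h_def real_sqrt_mult)
  then show ?thesis by simp
qed

lemma axis_tendsto_0:
  assumes "y > 0"
  shows "(\<lambda>n. (y / 2 ^ n) * ax (y / 2 ^ n)) \<longlonglongrightarrow> 1" "(\<lambda>n. (y / 2 ^ n) * cx (y / 2 ^ n)) \<longlonglongrightarrow> 1"
proof -
  define s where "s n = y / 2 ^ n" for n :: nat
  have s: "s n > 0" for n using assms by (simp add: s_def)
  have s0: "s \<longlonglongrightarrow> 0" unfolding s_def
    using LIMSEQ_divide_realpow_zero[of 2 y] by simp
  have lim3: "(\<lambda>n. sqrt (u n) * Re (\<theta>3 (\<i> * of_real (u n)))) \<longlonglongrightarrow> 1"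
    if u: "\<And>n. u n > 0" and u0: "u \<longlonglongrightarrow> 0" for u :: "nat \<Rightarrow> real"
  proof (rule Lim_null_comparison[THEN LIM_zero_cancel])
    show "\<forall>\<^sub>F n in sequentially. norm (sqrt (u n) * Re (\<theta>3 (\<i> * of_real (u n))) - 1) \<le> sqrt (u n)"
      using theta3_axis_bound[OF u] by (intro always_eventually) simp
    show "(\<lambda>n. sqrt (u n)) \<longlonglongrightarrow> 0" using tendsto_real_sqrt[OF u0] by simp
  qed
  have sq: "(s n) * axis_sq \<kappa> (s n) = (sqrt (s n) * Re (theta \<kappa> (\<i> * of_real (s n)))) ^ 2" for n \<kappa>
    using s[of n] by (simp add: axis_sq_def power_mult_distrib)
  have "(\<lambda>n. (sqrt (s n) * Re (\<theta>3 (\<i> * of_real (s n)))) ^ 2) \<longlonglongrightarrow> 1 ^ 2"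
    by (intro tendsto_power lim3 s s0)
  then have "(\<lambda>n. s n * ax (s n)) \<longlonglongrightarrow> 1" by (simp only: sq power_one)
  then show "(\<lambda>n. (y / 2 ^ n) * ax (y / 2 ^ n)) \<longlonglongrightarrow> 1" by (simp only: s_def)
  have "(\<lambda>n. s n / 4) \<longlonglongrightarrow> 0 / 4" by (intro tendsto_divide s0 tendsto_const) simp
  then have l4: "(\<lambda>n. sqrt (s n / 4) * Re (\<theta>3 (\<i> * of_real (s n / 4)))) \<longlonglongrightarrow> 1"
    using s by (intro lim3) simp_all
  \<comment> \<open>\<theta>_2(i y) = \<theta>_3(i y/4) - \<theta>_3(i y); after multiplication by
    sqrt y the two terms tend to 2 and 1.\<close>
  have "(\<lambda>n. 2 * (sqrt (s n / 4) * Re (\<theta>3 (\<i> * of_real (s n / 4)))) - sqrt (s n) * Re (\<theta>3 (\<i> * of_real (s n)))) \<longlonglongrightarrow> 2 * 1 - 1"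
    by (intro tendsto_diff tendsto_mult[OF tendsto_const] l4 lim3[OF s s0])
  moreover have "2 * (sqrt (s n / 4) * Re (\<theta>3 (\<i> * of_real (s n / 4)))) - sqrt (s n) * Re (\<theta>3 (\<i> * of_real (s n)))
      = sqrt (s n) * Re (\<theta>2 (\<i> * of_real (s n)))" for n
  proof -
    have "\<theta>3 (4 * (\<i> * of_real (s n / 4))) + \<theta>2 (4 * (\<i> * of_real (s n / 4))) = \<theta>3 (\<i> * of_real (s n / 4))"
      using s[of n] by (intro theta3_add_theta2) simp
    then have "Re (\<theta>3 (\<i> * of_real (s n / 4))) = Re (\<theta>3 (\<i> * of_real (s n))) + Re (\<theta>2 (\<i> * of_real (s n)))"
      by (simp flip: plus_complex.sel)
    then show ?thesis by (simp add: real_sqrt_divide algebra_simps)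
  qed
  ultimately have "(\<lambda>n. (sqrt (s n) * Re (\<theta>2 (\<i> * of_real (s n)))) ^ 2) \<longlonglongrightarrow> 1 ^ 2"
    by (intro tendsto_power) simp
  then have "(\<lambda>n. s n * cx (s n)) \<longlonglongrightarrow> 1" by (simp only: sq power_one)
  then show "(\<lambda>n. (y / 2 ^ n) * cx (y / 2 ^ n)) \<longlonglongrightarrow> 1" by (simp only: s_def)
qed

section \<open>The inversion formula\<close>

text \<open>The limit of the arithmetic-geometric mean iteration is monotone in the ratio of the
  initial values.\<close>

lemma agm_compare:
  fixes x y X Y :: "nat \<Rightarrow> real"
  assumes x: "\<And>n. x (Suc n) = (x n + y n) / 2" and y: "\<And>n. y (Suc n) ^ 2 = x n * y n"
    and X: "\<And>n. X (Suc n) = (X n + Y n) / 2" and Y: "\<And>n. Y (Suc n) ^ 2 = X n * Y n"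
    and pos: "\<And>n. x n > 0" "\<And>n. y n > 0" "\<And>n. X n > 0" "\<And>n. Y n > 0"
    and lim: "x \<longlonglongrightarrow> 1" "X \<longlonglongrightarrow> 1"
    and le: "y 0 * X 0 \<le> Y 0 * x 0"
  shows "X 0 \<le> x 0"
proof (rule ccontr)
  assume "\<not> X 0 \<le> x 0"
  define r where "r = X 0 / x 0"
  have r: "r > 1" using \<open>\<not> X 0 \<le> x 0\<close> pos(1)[of 0] by (simp add: r_def)
  \<comment> \<open>Both means are monotone and homogeneous, so the factor r > 1 between the initial
    values survives every step, although both limits are 1.\<close>
  have "r * x n \<le> X n \<and> r * y n \<le> Y n" for n
  proof (induction n)
    case 0
    then show ?case using pos(1)[of 0] le by (simp add: r_def field_simps)
  next
    case (Suc n)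
    have "(r * y (Suc n)) ^ 2 = (r * x n) * (r * y n)"
      by (simp add: power_mult_distrib y) (simp add: power2_eq_square)
    also have "\<dots> \<le> X n * Y n"
      using Suc r pos[of n] by (intro mult_mono) (auto intro: less_imp_le)
    finally have "(r * y (Suc n)) ^ 2 \<le> Y (Suc n) ^ 2" by (simp add: Y)
    then have "r * y (Suc n) \<le> Y (Suc n)"
      by (rule power2_le_imp_le) (rule less_imp_le, rule pos)
    moreover have "r * (x n + y n) \<le> X n + Y n" using Suc by (simp add: distrib_left)
    then have "r * x (Suc n) \<le> X (Suc n)" unfolding x X by simp
    ultimately show ?case by simp
  qed
  then have "r * 1 \<le> 1"
    using LIMSEQ_le[OF tendsto_mult[OF tendsto_const lim(1)] lim(2)] by blast
  then show False using r by simp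
qed

text \<open>Both \<open>(a(y), b(y), c(y))\<close> and \<open>(a(1/y)/y, c(1/y)/y, b(1/y)/y)\<close> solve
  Landen's equations, and in both cases the means of the first two entries and, after
  multiplication by y, of the first and third entries are 1.
  Since the squares of the second and third entries add up to that of the first, comparing the
  ratios in both ways shows that the triples agree.\<close>

lemma axis_inversion_le:
  fixes a b c A B C :: "real \<Rightarrow> real"
  assumes pos: "\<And>y. y > 0 \<Longrightarrow> a y > 0 \<and> b y > 0 \<and> c y > 0 \<and> A y > 0 \<and> B y > 0 \<and> C y > 0"
    and l: "\<And>y. y > 0 \<Longrightarrow> a (2 * y) = (a y + b y) / 2 \<and> b (2 * y) ^ 2 = a y * b y"
      "\<And>y. y > 0 \<Longrightarrow> a y = a (2 * y) + c (2 * y) \<and> c y ^ 2 = 4 * (a (2 * y) * c (2 * y))"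
      "\<And>y. y > 0 \<Longrightarrow> b y ^ 2 + c y ^ 2 = a y ^ 2"
    and L: "\<And>y. y > 0 \<Longrightarrow> A (2 * y) = (A y + B y) / 2 \<and> B (2 * y) ^ 2 = A y * B y"
      "\<And>y. y > 0 \<Longrightarrow> A y = A (2 * y) + C (2 * y) \<and> C y ^ 2 = 4 * (A (2 * y) * C (2 * y))"
      "\<And>y. y > 0 \<Longrightarrow> B y ^ 2 + C y ^ 2 = A y ^ 2"
    and lim: "\<And>y. y > 0 \<Longrightarrow> (\<lambda>n. a (2 ^ n * y)) \<longlonglongrightarrow> 1" "\<And>y. y > 0 \<Longrightarrow> (\<lambda>n. A (2 ^ n * y)) \<longlonglongrightarrow> 1"
      "\<And>y. y > 0 \<Longrightarrow> (\<lambda>n. (y / 2 ^ n) * a (y / 2 ^ n)) \<longlonglongrightarrow> 1" "\<And>y. y > 0 \<Longrightarrow> (\<lambda>n. (y / 2 ^ n) * A (y / 2 ^ n)) \<longlonglongrightarrow> 1"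
    and y: "y > 0" and le: "b y * A y \<le> B y * a y"
  shows "a y = A y"
proof (rule antisym)
  have double: "2 ^ Suc n * y = 2 * (2 ^ n * y)" for n by simp
  have p: "2 ^ n * y > 0" "y / 2 ^ n > 0" for n using y by simp_all
  show "A y \<le> a y"
    using agm_compare[of "\<lambda>n. a (2 ^ n * y)" "\<lambda>n. b (2 ^ n * y)" "\<lambda>n. A (2 ^ n * y)" "\<lambda>n. B (2 ^ n * y)"]
      l(1)[OF p(1)] L(1)[OF p(1)] pos[OF p(1)] lim(1,2)[OF y] le
    unfolding double by simp
  have "(b y * A y) ^ 2 \<le> (B y * a y) ^ 2"
    using le pos[OF y] by (intro power_mono) auto
  then have "(b y ^ 2) * (A y ^ 2) \<le> (B y ^ 2) * (a y ^ 2)" by (simp only: power_mult_distrib)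
  \<comment> \<open>The squares of b/a and c/a add up to 1, so an inequality between the ratios b/a
    reverses for c/a.\<close>
  then have "(C y ^ 2) * (a y ^ 2) \<le> (c y ^ 2) * (A y ^ 2)"
    unfolding l(3)[OF y, symmetric] L(3)[OF y, symmetric] by (simp add: algebra_simps)
  then have "(C y * a y) ^ 2 \<le> (c y * A y) ^ 2" by (simp only: power_mult_distrib)
  then have le': "C y * a y \<le> c y * A y"
    by (rule power2_le_imp_le) (use pos[OF y] in simp)
  have half: "2 * (y / 2 ^ Suc n) = y / 2 ^ n" for n by simp
  \<comment> \<open>Multiplied by their arguments, the solutions of Landen's equations make an
    arithmetic-geometric mean step from 2u to u.\<close>
  have st: "u * f u = (2 * u * f (2 * u) + 2 * u * g (2 * u)) / 2"
    "(u * g u) ^ 2 = (2 * u * f (2 * u)) * (2 * u * g (2 * u))"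
    if "f u = f (2 * u) + g (2 * u) \<and> g u ^ 2 = 4 * (f (2 * u) * g (2 * u))" for f g :: "real \<Rightarrow> real" and u
    using that by (simp_all add: power_mult_distrib) (simp_all add: power2_eq_square distrib_left)
  have "y / 2 ^ 0 * a (y / 2 ^ 0) \<le> y / 2 ^ 0 * A (y / 2 ^ 0)"
  proof (rule agm_compare[of "\<lambda>n. y / 2 ^ n * A (y / 2 ^ n)" "\<lambda>n. y / 2 ^ n * C (y / 2 ^ n)"
      "\<lambda>n. y / 2 ^ n * a (y / 2 ^ n)" "\<lambda>n. y / 2 ^ n * c (y / 2 ^ n)"])
    show "y / 2 ^ 0 * C (y / 2 ^ 0) * (y / 2 ^ 0 * a (y / 2 ^ 0)) \<le> y / 2 ^ 0 * c (y / 2 ^ 0) * (y / 2 ^ 0 * A (y / 2 ^ 0))"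
      using mult_left_mono[OF le', of "y * y"] y by (simp add: mult_ac)
    fix n
    show "y / 2 ^ Suc n * A (y / 2 ^ Suc n) = (y / 2 ^ n * A (y / 2 ^ n) + y / 2 ^ n * C (y / 2 ^ n)) / 2"
      "(y / 2 ^ Suc n * C (y / 2 ^ Suc n)) ^ 2 = (y / 2 ^ n * A (y / 2 ^ n)) * (y / 2 ^ n * C (y / 2 ^ n))"
      using st[OF L(2)[OF p(2)[of "Suc n"]]] by (simp_all only: half)
    show "y / 2 ^ Suc n * a (y / 2 ^ Suc n) = (y / 2 ^ n * a (y / 2 ^ n) + y / 2 ^ n * c (y / 2 ^ n)) / 2"
      "(y / 2 ^ Suc n * c (y / 2 ^ Suc n)) ^ 2 = (y / 2 ^ n * a (y / 2 ^ n)) * (y / 2 ^ n * c (y / 2 ^ n))"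
      using st[OF l(2)[OF p(2)[of "Suc n"]]] by (simp_all only: half)
    show "y / 2 ^ n * A (y / 2 ^ n) > 0" "y / 2 ^ n * C (y / 2 ^ n) > 0"
      "y / 2 ^ n * a (y / 2 ^ n) > 0" "y / 2 ^ n * c (y / 2 ^ n) > 0"
      using pos[OF p(2)[of n]] y by (simp_all add: zero_less_divide_iff zero_less_mult_iff)
  qed (fact lim(3,4)[OF y])+
  then show "a y \<le> A y" using y by simp
qed

lemma axis_inversion:
  assumes y: "y > 0"
  shows "ax (1 / y) = y * ax y" "cx (1 / y) = y * bx y"
proof -
  define A B C where "A y = ax (1 / y) / y" and "B y = cx (1 / y) / y" and "C y = bx (1 / y) / y" for y
  have pos: "ax y > 0 \<and> bx y > 0 \<and> cx y > 0 \<and> A y > 0 \<and> B y > 0 \<and> C y > 0" if "y > 0" for y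
    using that axis_sq_pos[of y] axis_sq_pos[of "1 / y"] by (simp add: A_def B_def C_def)
  have pos': "A y > 0 \<and> B y > 0 \<and> C y > 0 \<and> ax y > 0 \<and> bx y > 0 \<and> cx y > 0" if "y > 0" for y
    using pos[OF that] by simp
  have l1: "ax (2 * y) = (ax y + bx y) / 2 \<and> bx (2 * y) ^ 2 = ax y * bx y" if "y > 0" for y
    using axis_landen[OF that] by simp
  have l2: "ax y = ax (2 * y) + cx (2 * y) \<and> cx y ^ 2 = 4 * (ax (2 * y) * cx (2 * y))" if "y > 0" for y
    using axis_landen[OF that] by simp
  have l3: "bx y ^ 2 + cx y ^ 2 = ax y ^ 2" if "y > 0" for y
    by (simp only: axis_landen(1,2,3)[OF that]) (simp add: power2_eq_square algebra_simps)
  have half: "1 / y = 2 * (1 / (2 * y))" for y :: real by simp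
  have L1: "A (2 * y) = (A y + B y) / 2 \<and> B (2 * y) ^ 2 = A y * B y" if "y > 0" for y
    using that l2[of "1 / (2 * y)"] by (simp add: A_def B_def power_divide power2_eq_square field_simps)
  have L2: "A y = A (2 * y) + C (2 * y) \<and> C y ^ 2 = 4 * (A (2 * y) * C (2 * y))" if "y > 0" for y
    using that l1[of "1 / (2 * y)"] by (simp add: A_def C_def power_divide power2_eq_square field_simps)
  have L3: "B y ^ 2 + C y ^ 2 = A y ^ 2" if "y > 0" for y
    using l3[of "1 / y"] that by (simp add: A_def B_def C_def power_divide add_divide_distrib[symmetric] add.commute)
  have lim: "(\<lambda>n. A (2 ^ n * y)) \<longlonglongrightarrow> 1" "(\<lambda>n. (y / 2 ^ n) * A (y / 2 ^ n)) \<longlonglongrightarrow> 1" if "y > 0" for y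
    using axis_tendsto_0(1)[of "1 / y"] axis_tendsto_i_infinity[of "1 / y"] that
    by (simp_all add: A_def divide_simps mult_ac)
  \<comment> \<open>The two triples play symmetric roles, so one of the two possible inequalities
    between the ratios always applies.\<close>
  have eq: "ax y = A y" if "y > 0" for y
  proof (cases "bx y * A y \<le> B y * ax y")
    case True
    show ?thesis
      by (rule axis_inversion_le[of ax bx cx A B C]) (fact pos l1 l2 l3 L1 L2 L3 axis_tendsto_i_infinity axis_tendsto_0(1) lim that True)+
  next
    case False
    then have "B y * ax y \<le> bx y * A y" by simp
    have "A y = ax y"
      by (rule axis_inversion_le[of A B C ax bx cx]) (fact pos' l1 l2 l3 L1 L2 L3 axis_tendsto_i_infinity axis_tendsto_0(1) lim that \<open>B y * ax y \<le> bx y * A y\<close>)+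
    then show ?thesis by simp
  qed
  show "ax (1 / y) = y * ax y" using eq[OF y] y by (simp add: A_def)
  \<comment> \<open>The arithmetic mean equation recovers the second entry at y from the first
    entries at y and 2y.\<close>
  have "bx y = B y" using eq[OF y] eq[of "2 * y"] l1[OF y] L1[OF y] y by simp
  then show "cx (1 / y) = y * bx y" using y by (simp add: B_def)
qed

section \<open>From the imaginary axis to the half plane\<close>

lemma theta_holomorphic:
  shows "(\<lambda>z. \<theta>3 z) holomorphic_on {z. Im z > 0}" "(\<lambda>z. \<theta>4 z) holomorphic_on {z. Im z > 0}"
    "(\<lambda>z. \<theta>2 z) holomorphic_on {z. Im z > 0}"
proof -
  show "(\<lambda>z. \<theta>3 z) holomorphic_on {z. Im z > 0}" "(\<lambda>z. \<theta>4 z) holomorphic_on {z. Im z > 0}"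
    using expansion_holomorphic_upper_half_plane[OF theta34_expansion(1)]
      expansion_holomorphic_upper_half_plane[OF theta34_expansion(2)] by simp_all
  have "(\<lambda>z. exp (of_real pi * \<i> * z / 4)) holomorphic_on {z. Im z > 0}"
    by (intro holomorphic_intros) simp_all
  then have "(\<lambda>z. exp (of_real pi * \<i> * z / 4) * (exp (- (of_real pi * \<i> * z / 4)) * \<theta>2 z)) holomorphic_on {z. Im z > 0}"
    by (rule holomorphic_on_mult) (rule expansion_holomorphic_upper_half_plane[OF theta2_expansion])
  moreover have "exp (of_real pi * \<i> * z / 4) * (exp (- (of_real pi * \<i> * z / 4)) * \<theta>2 z) = \<theta>2 z" for z
    by (simp add: exp_minus)
  ultimately show "(\<lambda>z. \<theta>2 z) holomorphic_on {z. Im z > 0}" by simp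
qed

lemma Im_minus_inverse: "Im z > 0 \<Longrightarrow> Im (- 1 / z) > 0"
  by (simp add: Im_divide sum_power2_gt_zero_iff complex_eq_iff)

lemma axis_identity:
  assumes f: "f holomorphic_on {z. Im z > 0}" and axis: "\<And>y. y > 0 \<Longrightarrow> f (\<i> * of_real y) = 0"
    and z: "Im z > 0"
  shows "f z = 0"
proof (rule analytic_continuation[OF f open_upper_half_plane])
  let ?U = "{\<i> * of_real y |y. y > 0}"
  show "connected {z. Im z > 0}" by (intro convex_connected convex_halfspace_Im_gt)
  show "?U \<subseteq> {z. Im z > 0}" "\<i> \<in> {z. Im z > 0}" "z \<in> {z. Im z > 0}" using z by auto
  show "\<i> islimpt ?U"
    unfolding islimpt_approachable
  proof (intro allI impI)
    fix e :: real assume e: "e > 0"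
    let ?x = "\<i> * of_real (1 + e / 2)"
    have "?x \<in> ?U" using e by (intro CollectI exI[of _ "1 + e / 2"]) simp
    moreover have d: "?x - \<i> = \<i> * of_real (e / 2)" by (simp add: algebra_simps)
    then have "?x \<noteq> \<i>" using e by (auto simp: complex_eq_iff)
    moreover have "dist ?x \<i> < e" unfolding dist_norm d using e by (simp add: norm_mult)
    ultimately show "\<exists>x'\<in>?U. x' \<noteq> \<i> \<and> dist x' \<i> < e" by blast
  qed
  fix w assume "w \<in> ?U"
  then show "f w = 0" using axis by auto
qed

text \<open>Stating it for squares avoids a branch of the square root of -i z; both sides are
  holomorphic and agree on the imaginary axis.\<close>

lemma theta_inversion:
  assumes z: "Im z > 0"
  shows "\<theta>3 (- 1 / z) ^ 2 = - \<i> * z * \<theta>3 z ^ 2"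
    and "\<theta>2 (- 1 / z) ^ 2 = - \<i> * z * \<theta>4 z ^ 2"
proof -
  have hol: "(\<lambda>z. f (- 1 / z)) holomorphic_on {z. Im z > 0}" if "f holomorphic_on {z. Im z > 0}" for f
    by (rule holomorphic_on_compose_gen[OF _ that, unfolded o_def])
       (auto intro!: holomorphic_intros dest: Im_minus_inverse)
  have inv: "- 1 / (\<i> * of_real y) = \<i> * of_real (1 / y)" for y :: real
    by (cases "y = 0") (simp_all add: field_simps)
  note ax = of_real_axis_sq[of w3, OF weights_real(2), symmetric]
    and bx = of_real_axis_sq[of w4, OF weights_real(3), symmetric]
    and cx = of_real_axis_sq[of w2, OF weights_real(1), symmetric]
  have "\<theta>3 (- 1 / z) ^ 2 - (- \<i> * z * \<theta>3 z ^ 2) = 0"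
  proof (rule axis_identity[OF _ _ z])
    show "(\<lambda>z. \<theta>3 (- 1 / z) ^ 2 - (- \<i> * z * \<theta>3 z ^ 2)) holomorphic_on {z. Im z > 0}"
      by (intro holomorphic_intros hol theta_holomorphic)
  qed (simp only: inv ax axis_inversion, simp)
  then show "\<theta>3 (- 1 / z) ^ 2 = - \<i> * z * \<theta>3 z ^ 2" by (rule iffD2[OF eq_iff_diff_eq_0])
  have "\<theta>2 (- 1 / z) ^ 2 - (- \<i> * z * \<theta>4 z ^ 2) = 0"
  proof (rule axis_identity[OF _ _ z])
    show "(\<lambda>z. \<theta>2 (- 1 / z) ^ 2 - (- \<i> * z * \<theta>4 z ^ 2)) holomorphic_on {z. Im z > 0}"
      by (intro holomorphic_intros hol theta_holomorphic)
  qed (simp only: inv bx cx axis_inversion, simp)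
  then show "\<theta>2 (- 1 / z) ^ 2 = - \<i> * z * \<theta>4 z ^ 2" by (rule iffD2[OF eq_iff_diff_eq_0])
qed

section \<open>Action of the generators on fourth powers of theta constants\<close>

lemma exp_quarter_turn:
  "exp (of_real pi * \<i> / 4) ^ 2 = \<i>" "exp (of_real pi * \<i> / 4) ^ 4 = -1"
proof -
  have "exp (of_real pi * \<i> / 4) ^ 2 = exp (of_real (pi / 2) * \<i>)"
    by (simp add: mult.commute[of \<i>] flip: exp_of_nat_mult)
  also have "\<dots> = \<i>" by (simp add: complex_eq_iff Re_exp Im_exp)
  finally show 2: "exp (of_real pi * \<i> / 4) ^ 2 = \<i>" .
  have "x ^ 4 = (x ^ 2) ^ 2" for x :: complex by simp
  then show "exp (of_real pi * \<i> / 4) ^ 4 = -1" by (simp only: 2) simp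
qed

text \<open>With v = (z + 1)/2 the rotation is v \<mapsto> 1 - 1/v. Translation and inversion lead
  back to v, Landen's transformation leads from v to 2v = z + 1, and translation from there to
  z.\<close>

lemma theta_fourth_powers_rotation:
  assumes z: "Im z > 0"
  shows "\<theta>2 ((z - 1) / (z + 1)) ^ 4 = ((z + 1) / 2) ^ 2 * (\<theta>4 z ^ 2 - \<i> * \<theta>2 z ^ 2) ^ 2"
    and "\<theta>4 ((z - 1) / (z + 1)) ^ 4 = - ((z + 1) / 2)\<^sup>2 * (\<theta>4 z ^ 2 + \<i> * \<theta>2 z ^ 2) ^ 2"
proof -
  define v where "v = (z + 1) / 2"
  have v: "Im v > 0" "2 * v = z + 1" using z by (simp_all add: v_def)
  have z1: "z + 1 \<noteq> 0" using z by (auto simp: complex_eq_iff)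
  have w: "(z - 1) / (z + 1) = - 1 / v + 1" using z1 by (simp add: v_def field_simps)
  note e = exp_quarter_turn
  have four: "(x :: complex) ^ 4 = (x ^ 2) ^ 2" for x by simp
  have t2: "\<theta>2 (z + 1) ^ 2 = \<i> * \<theta>2 z ^ 2" by (simp add: theta2_add_1 power_mult_distrib e)
  have t4: "\<theta>4 v ^ 2 = \<theta>4 z ^ 2 - \<i> * \<theta>2 z ^ 2"
    using theta4_sq[OF v(1)] unfolding v(2) t2 theta3_add_1 .
  have t3: "\<theta>3 v ^ 2 = \<theta>4 z ^ 2 + \<i> * \<theta>2 z ^ 2"
    using theta3_sq[OF v(1)] unfolding v(2) t2 theta3_add_1 .
  have "\<theta>2 ((z - 1) / (z + 1)) ^ 4 = - (\<theta>2 (- 1 / v) ^ 2)\<^sup>2"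
    unfolding w theta2_add_1 power_mult_distrib e by simp
  also have "\<dots> = v ^ 2 * (\<theta>4 v ^ 2) ^ 2"
    unfolding theta_inversion(2)[OF v(1)] by (simp add: power_mult_distrib)
  finally show "\<theta>2 ((z - 1) / (z + 1)) ^ 4 = ((z + 1) / 2) ^ 2 * (\<theta>4 z ^ 2 - \<i> * \<theta>2 z ^ 2) ^ 2"
    unfolding t4 unfolding v_def .
  have "\<theta>4 ((z - 1) / (z + 1)) ^ 4 = (\<theta>3 (- 1 / v) ^ 2) ^ 2"
    unfolding w theta4_add_1 by simp
  also have "\<dots> = - v\<^sup>2 * (\<theta>3 v ^ 2) ^ 2"
    unfolding theta_inversion(1)[OF v(1)] by (simp add: power_mult_distrib)
  finally show "\<theta>4 ((z - 1) / (z + 1)) ^ 4 = - ((z + 1) / 2)\<^sup>2 * (\<theta>4 z ^ 2 + \<i> * \<theta>2 z ^ 2) ^ 2"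
    unfolding t3 unfolding v_def .
qed

lemma theta_fourth_powers_add_2:
  "\<theta>2 (z + 2) ^ 4 = \<theta>2 z ^ 4" "\<theta>4 (z + 2) ^ 4 = \<theta>4 z ^ 4"
proof -
  have 2: "z + 2 = (z + 1) + 1" by simp
  show "\<theta>4 (z + 2) ^ 4 = \<theta>4 z ^ 4" unfolding 2 theta4_add_1 theta3_add_1 ..
  have "exp (of_real pi * \<i> / 4) ^ 8 = (exp (of_real pi * \<i> / 4) ^ 4) ^ 2"
    by (simp only: flip: power_mult) simp
  then have "exp (of_real pi * \<i> / 4) ^ 8 = 1" by (simp only: exp_quarter_turn) simp
  moreover have "\<theta>2 (z + 2) ^ 4 = exp (of_real pi * \<i> / 4) ^ 8 * \<theta>2 z ^ 4"
    unfolding 2 theta2_add_1 power_mult_distrib by (simp flip: power_add mult.assoc)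
  ultimately show "\<theta>2 (z + 2) ^ 4 = \<theta>2 z ^ 4" by simp
qed

section \<open>Generation of the group\<close>

abbreviation mat22 :: "complex \<Rightarrow> complex \<Rightarrow> complex \<Rightarrow> complex \<Rightarrow> complex^2^2"
  where "mat22 a b c d \<equiv> vector [vector [a, b], vector [c, d]]"

lemma mat22_eq_iff: "(g :: complex^2^2) = h \<longleftrightarrow>
    g$1$1 = h$1$1 \<and> g$1$2 = h$1$2 \<and> g$2$1 = h$2$1 \<and> g$2$2 = h$2$2"
  by (auto simp: vec_eq_iff forall_2)

lemma mat22_mult:
  fixes g h :: "complex^2^2"
  shows "(g ** h) $ i $ j = g $ i $ 1 * h $ 1 $ j + g $ i $ 2 * h $ 2 $ j"
  by (simp add: matrix_matrix_mult_def sum_2)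

lemma mat22_one: "(mat 1 :: complex^2^2) $ 1 $ 1 = 1" "(mat 1 :: complex^2^2) $ 1 $ 2 = 0"
    "(mat 1 :: complex^2^2) $ 2 $ 1 = 0" "(mat 1 :: complex^2^2) $ 2 $ 2 = 1"
  by (simp_all add: mat_def)

lemmas mat22_simps = mat22_eq_iff mat22_mult mat22_one vector_2

lemma sqrt2_sq: "complex_of_real (sqrt 2) * complex_of_real (sqrt 2) = 2"
  by (simp flip: of_real_mult)

abbreviation "rsqrt2 \<equiv> 1 / complex_of_real (sqrt 2)"

definition g0_inv :: "complex^2^2"
  where "g0_inv = mat22 rsqrt2 (- \<i> * rsqrt2) (- \<i> * rsqrt2) rsqrt2"

lemma g0_eq: "g0 = mat22 rsqrt2 (\<i> * rsqrt2) (\<i> * rsqrt2) rsqrt2"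
  unfolding mat22_eq_iff
  by (simp only: g0_def vector_scaleR_component vector_2) (simp add: scaleR_conv_of_real)

lemma matrix_inv_g0: "matrix_inv g0 = g0_inv"
proof -
  have 1: "g0 ** g0_inv = mat 1" "g0_inv ** g0 = mat 1"
    by (simp_all add: g0_eq g0_inv_def mat22_simps sqrt2_sq)
  have "g0 ** matrix_inv g0 = mat 1 \<and> matrix_inv g0 ** g0 = mat 1"
    unfolding matrix_inv_def by (rule someI[of _ g0_inv]) (use 1 in simp)
  then show ?thesis using 1 by (metis matrix_mul_assoc matrix_mul_lid matrix_mul_rid)
qed

definition cay :: "complex^2^2 \<Rightarrow> complex^2^2"
  where "cay g = g0 ** g ** matrix_inv g0"

lemma G_eq: "G = cay ` U11"
  by (simp add: G_def cay_def[abs_def])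

lemma cay_nth:
  "cay g $ 1 $ 1 = (g$1$1 + g$2$2 + \<i> * (g$2$1 - g$1$2)) / 2"
  "cay g $ 1 $ 2 = (g$2$1 + g$1$2 + \<i> * (g$2$2 - g$1$1)) / 2"
  "cay g $ 2 $ 1 = (g$2$1 + g$1$2 + \<i> * (g$1$1 - g$2$2)) / 2"
  "cay g $ 2 $ 2 = (g$1$1 + g$2$2 + \<i> * (g$1$2 - g$2$1)) / 2"
proof -
  define r where "r = rsqrt2"
  have r: "r * r = 1 / 2" by (simp add: r_def sqrt2_sq)
  have "cay g $ 1 $ 1 = (r * r) * (g$1$1 + g$2$2 + \<i> * (g$2$1 - g$1$2))"
    "cay g $ 1 $ 2 = (r * r) * (g$2$1 + g$1$2 + \<i> * (g$2$2 - g$1$1))"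
    "cay g $ 2 $ 1 = (r * r) * (g$2$1 + g$1$2 + \<i> * (g$1$1 - g$2$2))"
    "cay g $ 2 $ 2 = (r * r) * (g$1$1 + g$2$2 + \<i> * (g$1$2 - g$2$1))"
    unfolding cay_def matrix_inv_g0 unfolding g0_eq g0_inv_def r_def[symmetric]
    by (simp_all only: mat22_mult vector_2) (simp_all add: algebra_simps)
  then show "cay g $ 1 $ 1 = (g$1$1 + g$2$2 + \<i> * (g$2$1 - g$1$2)) / 2"
    "cay g $ 1 $ 2 = (g$2$1 + g$1$2 + \<i> * (g$2$2 - g$1$1)) / 2"
    "cay g $ 2 $ 1 = (g$2$1 + g$1$2 + \<i> * (g$1$1 - g$2$2)) / 2"
    "cay g $ 2 $ 2 = (g$1$1 + g$2$2 + \<i> * (g$1$2 - g$2$1)) / 2"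
    unfolding r by simp_all
qed

lemma cay_mult: "cay (g ** h) = cay g ** cay h"
  by (simp add: mat22_eq_iff mat22_mult cay_nth) (simp add: field_simps)

section \<open>Unitary matrices over the Gaussian integers\<close>

lemma gauss_ints_closed:
  "0 \<in> gauss_ints" "1 \<in> gauss_ints" "\<i> \<in> gauss_ints"
  "x \<in> gauss_ints \<Longrightarrow> - x \<in> gauss_ints" "x \<in> gauss_ints \<Longrightarrow> cnj x \<in> gauss_ints"
  "x \<in> gauss_ints \<Longrightarrow> y \<in> gauss_ints \<Longrightarrow> x + y \<in> gauss_ints"
  "x \<in> gauss_ints \<Longrightarrow> y \<in> gauss_ints \<Longrightarrow> x - y \<in> gauss_ints"
  "x \<in> gauss_ints \<Longrightarrow> y \<in> gauss_ints \<Longrightarrow> x * y \<in> gauss_ints"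
  by (auto simp: gauss_ints_def)

lemma gauss_intsE:
  assumes "x \<in> gauss_ints"
  obtains m n :: int where "x = of_int m + \<i> * of_int n"
proof -
  obtain m n where "Re x = of_int m" "Im x = of_int n"
    using assms by (auto simp: gauss_ints_def elim!: Ints_cases)
  then have "x = of_int m + \<i> * of_int n" by (simp add: complex_eq_iff)
  then show ?thesis by (rule that)
qed

lemma U11_iff: "g \<in> U11 \<longleftrightarrow> (\<forall>i j. g $ i $ j \<in> gauss_ints) \<and>
    cnj (g$1$1) * g$1$1 - cnj (g$2$1) * g$2$1 = 1 \<and> cnj (g$1$1) * g$1$2 - cnj (g$2$1) * g$2$2 = 0 \<and>
    cnj (g$1$2) * g$1$1 - cnj (g$2$2) * g$2$1 = 0 \<and> cnj (g$1$2) * g$1$2 - cnj (g$2$2) * g$2$2 = -1"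
  by (simp add: U11_def mat22_simps conj_tr_def Hform_def)

lemma U11_mult:
  assumes "g \<in> U11" "h \<in> U11"
  shows "g ** h \<in> U11"
proof -
  have "conj_tr (g ** h) = conj_tr h ** conj_tr g"
    by (simp add: mat22_eq_iff mat22_mult conj_tr_def)
  then have "conj_tr (g ** h) ** Hform ** (g ** h) = conj_tr h ** (conj_tr g ** Hform ** g) ** h"
    by (simp add: matrix_mul_assoc)
  then show ?thesis
    using assms by (auto simp: U11_def mat22_mult intro!: gauss_ints_closed)
qed

definition gauss_units :: "complex set"
  where "gauss_units = {1, -1, \<i>, -\<i>}"

lemma gauss_unit_iff:
  assumes "x \<in> gauss_ints" "cnj x * x = 1"
  shows "x \<in> gauss_units"
proof -
  obtain m n :: int where x: "x = of_int m + \<i> * of_int n" using assms(1) by (rule gauss_intsE)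
  have "cnj x * x = of_int (m ^ 2 + n ^ 2)"
    by (simp add: x algebra_simps power2_eq_square)
  then have mn: "m ^ 2 + n ^ 2 = 1" using assms(2) by (metis of_int_1 of_int_eq_iff)
  have sq: "k ^ 2 = 0 \<or> k ^ 2 \<ge> 1" for k :: int by (cases "k = 0") (auto simp: int_one_le_iff_zero_less)
  have "m ^ 2 \<ge> 0" "n ^ 2 \<ge> 0" by simp_all
  then have "(m ^ 2 = 0 \<and> n ^ 2 = 1) \<or> (m ^ 2 = 1 \<and> n ^ 2 = 0)" using mn sq[of m] sq[of n] by linarith
  then show ?thesis by (auto simp: x gauss_units_def power2_eq_1_iff)
qed

text \<open>The elements whose conjugates in \<open>G\<close> are the translations by -2 and 2, see
  \<open>cay_generators\<close>.\<close>

abbreviation "Tinv \<equiv> mat22 (1 - \<i>) (- 1) (- 1) (1 + \<i>)"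
abbreviation "Tmat \<equiv> mat22 (1 + \<i>) 1 1 (1 - \<i>)"

lemma U11_generators:
  "Tmat \<in> U11" "u \<in> gauss_units \<Longrightarrow> v \<in> gauss_units \<Longrightarrow> mat22 u 0 0 v \<in> U11"
  by (auto simp: U11_iff forall_2 vector_2 gauss_units_def algebra_simps intro!: gauss_ints_closed)

text \<open>A descent on \<open>|c|\<^sup>2\<close>, where \<open>(a, c)\<close> is the first column: since
  \<open>|a|\<^sup>2 = |c|\<^sup>2 + 1\<close>, some unit w makes \<open>w a + (1 - \<i>) c\<close> shorter than c.\<close>

lemma U11_descent:
  assumes ac: "a \<in> gauss_ints" "c \<in> gauss_ints" "cnj a * a - cnj c * c = 1" and c: "c \<noteq> 0"
  obtains w where "w \<in> gauss_units" "norm (w * a + (1 - \<i>) * c) ^ 2 < norm c ^ 2"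
proof -
  obtain a1 a2 :: int where a: "a = of_int a1 + \<i> * of_int a2" using ac(1) by (rule gauss_intsE)
  obtain c1 c2 :: int where c': "c = of_int c1 + \<i> * of_int c2" using ac(2) by (rule gauss_intsE)
  define N where "N = c1 ^ 2 + c2 ^ 2"
  have "cnj a * a - cnj c * c = of_int (a1 ^ 2 + a2 ^ 2 - N)"
    by (simp add: a c' N_def algebra_simps power2_eq_square)
  then have aN: "a1 ^ 2 + a2 ^ 2 = N + 1" using ac(3) by (metis add.commute diff_eq_eq of_int_1 of_int_eq_iff)
  have N: "N > 0" using c unfolding c' N_def
    by (metis add.left_neutral mult_zero_right of_int_0 sum_power2_gt_zero_iff)
  text \<open>\<open>X + \<i> Y = a cnj c (1 + \<i>)\<close>\<close>
  define X where "X = a1 * c1 + a2 * c2 - a2 * c1 + a1 * c2"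
  define Y where "Y = a1 * c1 + a2 * c2 + a2 * c1 - a1 * c2"
  have XY: "X ^ 2 + Y ^ 2 = 2 * N * (N + 1)"
  proof -
    have "X ^ 2 + Y ^ 2 = 2 * (c1 ^ 2 + c2 ^ 2) * (a1 ^ 2 + a2 ^ 2)"
      by (simp add: X_def Y_def algebra_simps power2_eq_square)
    then show ?thesis by (simp only: aN N_def[symmetric])
  qed
  \<comment> \<open>If both were at most N, then X^2 + Y^2 \<le> 2 N^2 < 2 N (N + 1).\<close>
  have "\<bar>X\<bar> \<ge> N + 1 \<or> \<bar>Y\<bar> \<ge> N + 1"
  proof (rule ccontr)
    assume "\<not> ?thesis"
    then have "\<bar>X\<bar> \<le> N" "\<bar>Y\<bar> \<le> N" by auto
    then have "\<bar>X\<bar> ^ 2 \<le> N ^ 2" "\<bar>Y\<bar> ^ 2 \<le> N ^ 2" 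
      by (intro power_mono; simp)+
    then have "2 * N * (N + 1) \<le> 2 * N ^ 2" using XY by simp
    then show False using N by (simp add: power2_eq_square algebra_simps)
  qed
  \<comment> \<open>The new norm is |a|^2 + 2 |c|^2 plus twice the cross term, at most (N + 1) + 2N
    - 2 (N + 1) = N - 1. The four sign cases of X and Y below correspond to w = 1, -1, -i,
    i.\<close>
  moreover have key: "norm (w * a + (1 - \<i>) * c) ^ 2 < norm c ^ 2"
    if "w * a = of_int p + \<i> * of_int q" "p ^ 2 + q ^ 2 = N + 1"
      "p * c1 + q * c2 - q * c1 + p * c2 \<le> - (N + 1)" for w p q
  proof -
    have "w * a + (1 - \<i>) * c = Complex (of_int (p + c1 + c2)) (of_int (q + c2 - c1))"
      unfolding that(1) c' by (simp add: complex_eq_iff)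
    then have "norm (w * a + (1 - \<i>) * c) ^ 2 = of_int ((p + c1 + c2) ^ 2 + (q + c2 - c1) ^ 2)"
      by (simp add: cmod_power2)
    also have "(p + c1 + c2) ^ 2 + (q + c2 - c1) ^ 2 = (p ^ 2 + q ^ 2) + 2 * N + 2 * (p * c1 + q * c2 - q * c1 + p * c2)"
      by (simp add: N_def power2_eq_square algebra_simps)
    also have "\<dots> < N"
    proof -
      have "2 * (p * c1 + q * c2 - q * c1 + p * c2) \<le> 2 * (- (N + 1))"
        using that(3) by (rule mult_left_mono) simp
      then show ?thesis unfolding that(2) by simp
    qed
    finally show ?thesis by (simp add: c' cmod_power2 N_def)
  qed
  ultimately consider "X \<le> - (N + 1)" | "- X \<le> - (N + 1)" | "Y \<le> - (N + 1)" | "- Y \<le> - (N + 1)"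
    by linarith
  then show ?thesis
  proof cases
    case 1
    then have "norm (1 * a + (1 - \<i>) * c) ^ 2 < norm c ^ 2"
      using aN by (intro key[of _ a1 a2]) (auto simp: a X_def)
    then show ?thesis by (intro that[of 1]) (auto simp: gauss_units_def)
  next
    case 2
    then have "norm ((- 1) * a + (1 - \<i>) * c) ^ 2 < norm c ^ 2"
      using aN by (intro key[of _ "- a1" "- a2"]) (auto simp: a X_def)
    then show ?thesis by (intro that[of "- 1"]) (auto simp: gauss_units_def)
  next
    case 3
    then have "norm (- \<i> * a + (1 - \<i>) * c) ^ 2 < norm c ^ 2"
      using aN by (intro key[of _ "a2" "- a1"]) (auto simp: a Y_def algebra_simps)
    then show ?thesis by (intro that[of "- \<i>"]) (auto simp: gauss_units_def)
  next
    case 4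
    then have "norm (\<i> * a + (1 - \<i>) * c) ^ 2 < norm c ^ 2"
      using aN by (intro key[of _ "- a2" "a1"]) (auto simp: a Y_def algebra_simps)
    then show ?thesis by (intro that[of "\<i>"]) (auto simp: gauss_units_def)
  qed
qed

text \<open>Induction on the integer |c|^2. If c = 0, the matrix is diagonal with unit entries;
  otherwise a diagonal unit matrix followed by \<open>Tmat\<close> shortens c, and undoing this
  multiplies by \<open>Tinv\<close>.\<close>

lemma U11_generated:
  assumes mult: "\<And>g h. g \<in> S \<Longrightarrow> h \<in> S \<Longrightarrow> g ** h \<in> S"
    and diag: "\<And>u v. u \<in> gauss_units \<Longrightarrow> v \<in> gauss_units \<Longrightarrow> mat22 u 0 0 v \<in> S"
    and T: "Tinv \<in> S"
    and g: "g \<in> U11"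
  shows "g \<in> S"
  using g
proof (induction "nat \<lfloor>norm (g $ 2 $ 1) ^ 2\<rfloor>" arbitrary: g rule: less_induct)
  case less
  have ints: "g $ i $ j \<in> gauss_ints" for i j using less.prems by (simp add: U11_iff)
  have norm1: "cnj (g$1$1) * g$1$1 - cnj (g$2$1) * g$2$1 = 1" using less.prems by (simp add: U11_iff)
  show ?case
  proof (cases "g $ 2 $ 1 = 0")
    case True
    then have a: "cnj (g$1$1) * g$1$1 = 1" using norm1 by simp
    then have b: "g$1$2 = 0" using less.prems True by (auto simp: U11_iff)
    then have "cnj (g$2$2) * g$2$2 = 1" using less.prems by (simp add: U11_iff)
    then have "mat22 (g$1$1) 0 0 (g$2$2) \<in> S"
      using a ints by (intro diag gauss_unit_iff) auto
    moreover have "mat22 (g$1$1) 0 0 (g$2$2) = g" using True b by (simp add: mat22_eq_iff)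
    ultimately show ?thesis by simp
  next
    case False
    then obtain w where w: "w \<in> gauss_units"
      "norm (w * g$1$1 + (1 - \<i>) * g$2$1) ^ 2 < norm (g$2$1) ^ 2"
      using U11_descent[OF ints ints norm1] by blast
    define h where "h = Tmat ** (mat22 w 0 0 1 ** g)"
    have h: "h \<in> U11"
      unfolding h_def using w less.prems by (intro U11_mult U11_generators) (auto simp: gauss_units_def)
    have h21: "h $ 2 $ 1 = w * g$1$1 + (1 - \<i>) * g$2$1" by (simp add: h_def mat22_mult)
    have int: "\<exists>m::int. norm x ^ 2 = of_int m" if x: "x \<in> gauss_ints" for x
    proof -
      obtain m n :: int where "x = of_int m + \<i> * of_int n" using x by (rule gauss_intsE)
      then have "norm x ^ 2 = of_int (m ^ 2 + n ^ 2)" by (simp add: cmod_power2)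
      then show ?thesis ..
    qed
    obtain m n where mn: "norm (h $ 2 $ 1) ^ 2 = of_int m" "norm (g $ 2 $ 1) ^ 2 = of_int n"
      using int ints h by (metis U11_iff)
    then have "m < n" using w(2) h21 by simp
    moreover have "0 \<le> m" using mn(1) by (metis of_int_0_le_iff zero_le_power2)
    ultimately have "nat \<lfloor>norm (h $ 2 $ 1) ^ 2\<rfloor> < nat \<lfloor>norm (g $ 2 $ 1) ^ 2\<rfloor>" by (simp add: mn)
    then have hS: "h \<in> S" using less.hyps h by blast
    obtain w' where w': "w' \<in> gauss_units" "w' * w = 1"
      using w(1) by (auto simp: gauss_units_def intro: that[of 1] that[of "- 1"] that[of "- \<i>"] that[of "\<i>"])
    have "g = mat22 w' 0 0 1 ** (Tinv ** h)"
    proof -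
      have "Tinv ** Tmat = mat 1" by (simp add: mat22_simps algebra_simps)
      moreover have "mat22 w' 0 0 1 ** mat22 w 0 0 1 = mat 1" using w'(2) by (simp add: mat22_simps)
      ultimately have "mat22 w' 0 0 1 ** ((Tinv ** Tmat) ** mat22 w 0 0 1) ** g = g" by simp
      then show ?thesis by (simp add: h_def matrix_mul_assoc)
    qed
    moreover have "mat22 w' 0 0 1 \<in> S" using w' by (intro diag) (auto simp: gauss_units_def)
    ultimately show ?thesis using T hS mult by metis
  qed
qed

section \<open>Automorphy\<close>

lemma Im_Rep_uhp [simp]: "Im (Rep_uhp \<tau>) > 0"
  using Rep_uhp[of \<tau>] by simp

lemma Rep_Abs_uhp: "Im z > 0 \<Longrightarrow> Rep_uhp (Abs_uhp z) = z"
  by (simp add: Abs_uhp_inverse)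

text \<open>The nonzero denominator and the positive imaginary part belong to the condition because
  they make \<open>Abs_uhp\<close> meaningful, and hence the set closed under products.\<close>

definition slash_inv :: "int \<Rightarrow> (uhp \<Rightarrow> complex) \<Rightarrow> (complex^2^2) set"
  where "slash_inv k f = {g. \<forall>\<tau>. g $ 2 $ 1 * Rep_uhp \<tau> + g $ 2 $ 2 \<noteq> 0 \<and>
    Im ((g $ 1 $ 1 * Rep_uhp \<tau> + g $ 1 $ 2) / (g $ 2 $ 1 * Rep_uhp \<tau> + g $ 2 $ 2)) > 0 \<and>
    f (moebius g \<tau>) = (g $ 2 $ 1 * Rep_uhp \<tau> + g $ 2 $ 2) powi k * f \<tau>}"

lemma slash_inv_mult:
  assumes "g \<in> slash_inv k f" "h \<in> slash_inv k f"
  shows "g ** h \<in> slash_inv k f"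
  unfolding slash_inv_def
proof (intro CollectI allI)
  fix \<tau>
  let ?z = "Rep_uhp \<tau>"
  let ?jh = "h $ 2 $ 1 * ?z + h $ 2 $ 2"
  define \<tau>' where "\<tau>' = moebius h \<tau>"
  have jh: "?jh \<noteq> 0" and hf: "f \<tau>' = ?jh powi k * f \<tau>"
    and im: "Im ((h $ 1 $ 1 * ?z + h $ 1 $ 2) / ?jh) > 0"
    using assms(2) by (auto simp: slash_inv_def \<tau>'_def)
  have z': "Rep_uhp \<tau>' = (h $ 1 $ 1 * ?z + h $ 1 $ 2) / ?jh"
    unfolding \<tau>'_def moebius_def using im by (rule Rep_Abs_uhp)
  let ?jg = "g $ 2 $ 1 * Rep_uhp \<tau>' + g $ 2 $ 2"
  have jg: "?jg \<noteq> 0" and gf: "f (moebius g \<tau>') = ?jg powi k * f \<tau>'"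
    and im': "Im ((g $ 1 $ 1 * Rep_uhp \<tau>' + g $ 1 $ 2) / ?jg) > 0"
    using assms(1) by (auto simp: slash_inv_def)
  have j: "(g ** h) $ 2 $ 1 * ?z + (g ** h) $ 2 $ 2 = ?jg * ?jh"
    using jh by (simp add: z' mat22_mult field_simps)
  have n: "(g ** h) $ 1 $ 1 * ?z + (g ** h) $ 1 $ 2 = (g $ 1 $ 1 * Rep_uhp \<tau>' + g $ 1 $ 2) * ?jh"
    using jh by (simp add: z' mat22_mult field_simps)
  have q: "((g ** h) $ 1 $ 1 * ?z + (g ** h) $ 1 $ 2) / ((g ** h) $ 2 $ 1 * ?z + (g ** h) $ 2 $ 2)
      = (g $ 1 $ 1 * Rep_uhp \<tau>' + g $ 1 $ 2) / ?jg"
    unfolding j n using jh by simp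
  have "moebius (g ** h) \<tau> = moebius g \<tau>'" unfolding moebius_def q ..
  then show "(g ** h) $ 2 $ 1 * ?z + (g ** h) $ 2 $ 2 \<noteq> 0 \<and>
    Im (((g ** h) $ 1 $ 1 * ?z + (g ** h) $ 1 $ 2) / ((g ** h) $ 2 $ 1 * ?z + (g ** h) $ 2 $ 2)) > 0 \<and>
    f (moebius (g ** h) \<tau>) = ((g ** h) $ 2 $ 1 * ?z + (g ** h) $ 2 $ 2) powi k * f \<tau>"
    unfolding q unfolding j using jg jh im' gf hf by (simp add: power_int_mult_distrib)
qed

abbreviation "Rmat \<equiv> mat22 1 0 0 \<i>"

lemma cay_generators:
  "cay Tmat = mat22 1 2 0 1" "cay Tinv = mat22 1 (- 2) 0 1"
  "cay (mat22 u 0 0 u) = mat22 u 0 0 u"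
  "cay Rmat = mat22 ((1 + \<i>) / 2) (- ((1 + \<i>) / 2)) ((1 + \<i>) / 2) ((1 + \<i>) / 2)"
  "cay (mat22 1 0 0 (- \<i>)) = mat22 ((1 - \<i>) / 2) ((1 - \<i>) / 2) (- ((1 - \<i>) / 2)) ((1 - \<i>) / 2)"
  by (simp_all add: mat22_eq_iff cay_nth vector_2 complex_eq_iff)

lemma Im_rotation:
  assumes "Im z > 0"
  shows "Im ((z - 1) / (z + 1)) = 2 * Im z / norm (z + 1) ^ 2"
    "Im ((z + 1) / (1 - z)) = 2 * Im z / norm (z - 1) ^ 2"
  by (simp_all add: Im_divide cmod_power2) (simp_all add: power2_eq_square algebra_simps)

lemma uhp_add_1_nonzero: "Im z > 0 \<Longrightarrow> z + 1 \<noteq> 0" "Im z > 0 \<Longrightarrow> 1 - z \<noteq> 0"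
  by (auto simp: complex_eq_iff)

text \<open>A diagonal unit matrix is a scalar times a power of \<open>Rmat\<close>, and scalar
  units have trivial automorphy factor when 4 divides the weight. So only the translation and the
  rotation have to be checked.\<close>

lemma G_subset_slash_inv:
  assumes F: "\<And>\<tau>. f \<tau> = F (Rep_uhp \<tau>)"
    and T: "\<And>z. Im z > 0 \<Longrightarrow> F (z - 2) = F z"
    and R: "\<And>z. Im z > 0 \<Longrightarrow> F ((z - 1) / (z + 1)) = ((1 + \<i>) / 2 * (z + 1)) powi k * F z"
    and k: "4 dvd k"
  shows "G \<subseteq> slash_inv k f"
proof -
  have powk: "u powi k = 1" if "u \<in> gauss_units" for u
  proof -
    obtain m where "k = 4 * m" using k by (elim dvdE)
    moreover have "u powi 4 = 1" using that by (auto simp: gauss_units_def)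
    ultimately show ?thesis by (simp add: power_int_mult)
  qed
  have scal: "mat22 u 0 0 u \<in> slash_inv k f" if "u \<in> gauss_units" for u
  proof -
    have "u \<noteq> 0" using that by (auto simp: gauss_units_def)
    then show ?thesis
      by (simp add: slash_inv_def vector_2 moebius_def Rep_uhp_inverse powk[OF that])
  qed
  have rot: "cay Rmat \<in> slash_inv k f"
  proof -
    define r where "r = (1 + \<i>) / 2"
    have r0: "r \<noteq> 0" by (auto simp: r_def complex_eq_iff)
    have den: "cay Rmat $ 2 $ 1 * z + cay Rmat $ 2 $ 2 = r * (z + 1)" for z
      by (simp only: cay_generators vector_2 distrib_left mult_1_right r_def)
    have num: "cay Rmat $ 1 $ 1 * z + cay Rmat $ 1 $ 2 = r * (z - 1)" for z
      by (simp only: cay_generators vector_2 diff_conv_add_uminus distrib_left mult_minus_right mult_1_right r_def)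
    have im: "Im ((z - 1) / (z + 1)) > 0" if "Im z > 0" for z
      using that uhp_add_1_nonzero[OF that] by (simp add: Im_rotation)
    show ?thesis
      unfolding slash_inv_def mem_Collect_eq moebius_def den num mult_divide_mult_cancel_left[OF r0] F
      using r0 uhp_add_1_nonzero(1)[OF Im_Rep_uhp] im[OF Im_Rep_uhp] R[OF Im_Rep_uhp]
      by (simp add: Rep_Abs_uhp flip: r_def)
  qed
  have trans: "cay Tinv \<in> slash_inv k f"
    by (simp add: slash_inv_def cay_generators vector_2 moebius_def F Rep_Abs_uhp T)
  have "g \<in> {g. cay g \<in> slash_inv k f}" if "g \<in> U11" for g
  proof (rule U11_generated[OF _ _ _ that])
    show "Tinv \<in> {g. cay g \<in> slash_inv k f}" using trans by simp
    show "g ** h \<in> {g. cay g \<in> slash_inv k f}"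
      if "g \<in> {g. cay g \<in> slash_inv k f}" "h \<in> {g. cay g \<in> slash_inv k f}" for g h
      using that by (simp add: cay_mult slash_inv_mult)
    fix u v assume u: "u \<in> gauss_units" and v: "v \<in> gauss_units"
    have s: "cay (mat22 u 0 0 u) \<in> slash_inv k f" using scal[OF u] by (simp add: cay_generators)
    have r: "v = u \<or> v = \<i> * u \<or> v = \<i> * (\<i> * u) \<or> v = \<i> * (\<i> * (\<i> * u))"
      using u v by (auto simp: gauss_units_def)
    have step: "cay (mat22 u 0 0 (\<i> * v)) \<in> slash_inv k f" if "cay (mat22 u 0 0 v) \<in> slash_inv k f" for v
    proof -
      have "mat22 u 0 0 (\<i> * v) = Rmat ** mat22 u 0 0 v" by (simp add: mat22_simps)
      then show ?thesis using slash_inv_mult[OF rot that] by (simp add: cay_mult)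
    qed
    show "mat22 u 0 0 v \<in> {g. cay g \<in> slash_inv k f}"
      using r s step[OF s] step[OF step[OF s]] step[OF step[OF step[OF s]]]
      by (elim disjE) (simp_all only: mem_Collect_eq)
  qed
  then show ?thesis by (auto simp: G_eq)
qed

section \<open>Expansions at the cusp\<close>

abbreviation nome :: "uhp \<Rightarrow> complex"
  where "nome \<tau> \<equiv> exp (of_real pi * \<i> * Rep_uhp \<tau>)"

text \<open>The constant term is recorded because it is the value at the cusp and fixes the multiple
  of a power of \<alpha> to be subtracted.\<close>

definition expands :: "complex set \<Rightarrow> complex \<Rightarrow> (uhp \<Rightarrow> complex) \<Rightarrow> bool"
  where "expands R a f \<longleftrightarrow> (\<exists>c. range c \<subseteq> R \<and> c 0 = a \<and> has_q_expansion f c)"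

lemma expands_mono: "R \<subseteq> R' \<Longrightarrow> expands R a f \<Longrightarrow> expands R' a f"
  by (auto simp: expands_def)

lemma has_q_expansion_upper_half_plane:
  "has_q_expansion f c \<Longrightarrow> Im z > 0 \<Longrightarrow> (\<lambda>n. c n * exp (of_real pi * \<i> * z) ^ n) sums f (Abs_uhp z)"
  unfolding has_q_expansion_def by (metis Rep_Abs_uhp)

lemma has_q_expansion_summable:
  assumes "has_q_expansion f c" "norm s < 1"
  shows "summable (\<lambda>n. norm (c n * s ^ n))"
  by (rule expansion_summable[OF has_q_expansion_upper_half_plane[OF assms(1)] assms(2)])

lemma has_q_expansion_holomorphic:
  assumes "has_q_expansion f c"
  obtains F where "F holomorphic_on ball 0 1" "F 0 = c 0" "\<And>\<tau>. f \<tau> = F (nome \<tau>)"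
    "\<And>s. norm s < 1 \<Longrightarrow> (\<lambda>n. c n * s ^ n) sums F s"
proof -
  obtain F where F: "F holomorphic_on ball 0 1" "F 0 = c 0"
    "\<And>z. Im z > 0 \<Longrightarrow> f (Abs_uhp z) = F (exp (of_real pi * \<i> * z))"
    "\<And>s. norm s < 1 \<Longrightarrow> (\<lambda>n. c n * s ^ n) sums F s"
    using expansion_holomorphic[OF has_q_expansion_upper_half_plane[OF assms]] by metis
  have "f \<tau> = F (nome \<tau>)" for \<tau> using F(3)[of "Rep_uhp \<tau>"] by (simp add: Rep_uhp_inverse)
  with F that show ?thesis by metis
qed

lemma norm_nome: "norm (nome \<tau>) < 1"
  by simp

lemma exists_nome:
  assumes "s \<noteq> 0" "norm s < 1"
  obtains \<tau> where "s = nome \<tau>" "\<bar>Re (Rep_uhp \<tau>)\<bar> \<le> 1"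
  using exists_exp_pi[OF assms] by (metis Rep_Abs_uhp)

lemma expands_const:
  assumes "unital_subring R" "a \<in> R"
  shows "expands R a (\<lambda>_. a)"
proof -
  interpret unital_subring R by fact
  have "(\<lambda>n. (if n = 0 then a else 0) * s ^ n) sums a" for s
    using sums_single[of 0 "\<lambda>_. a"] by (rule sums_cong[THEN iffD1, rotated]) auto
  then show ?thesis
    unfolding expands_def has_q_expansion_def
    by (intro exI[of _ "\<lambda>n. if n = 0 then a else 0"]) (use assms in auto)
qed

lemma expands_add:
  assumes "unital_subring R" "expands R a f" "expands R b g"
  shows "expands R (a + b) (\<lambda>\<tau>. f \<tau> + g \<tau>)"
proof -
  interpret unital_subring R by fact
  obtain c d where "range c \<subseteq> R" "c 0 = a" "has_q_expansion f c" "range d \<subseteq> R" "d 0 = b" "has_q_expansion g d"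
    using assms by (auto simp: expands_def)
  then show ?thesis
    unfolding expands_def has_q_expansion_def
    by (intro exI[of _ "\<lambda>n. c n + d n"]) (auto simp: distrib_right intro!: sums_add add_mem)
qed

lemma has_q_expansion_mult:
  assumes cd: "has_q_expansion f c" "has_q_expansion g d"
  shows "has_q_expansion (\<lambda>\<tau>. f \<tau> * g \<tau>) (\<lambda>n. \<Sum>i\<le>n. c i * d (n - i))"
  unfolding has_q_expansion_def
proof
  fix \<tau>
  let ?s = "nome \<tau>"
  have "(\<lambda>n. \<Sum>i\<le>n. (c i * ?s ^ i) * (d (n - i) * ?s ^ (n - i))) sums
      (suminf (\<lambda>n. c n * ?s ^ n) * suminf (\<lambda>n. d n * ?s ^ n))"
    by (intro Cauchy_product_sums has_q_expansion_summable[OF cd(1) norm_nome]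
        has_q_expansion_summable[OF cd(2) norm_nome])
  moreover have "suminf (\<lambda>n. c n * ?s ^ n) = f \<tau>" "suminf (\<lambda>n. d n * ?s ^ n) = g \<tau>"
    using cd by (auto simp: has_q_expansion_def sums_iff)
  moreover have "(\<Sum>i\<le>n. (c i * ?s ^ i) * (d (n - i) * ?s ^ (n - i))) = (\<Sum>i\<le>n. c i * d (n - i)) * ?s ^ n" for n
    unfolding sum_distrib_right
  proof (intro sum.cong refl)
    fix i assume "i \<in> {..n}"
    then have "?s ^ n = ?s ^ i * ?s ^ (n - i)" by (simp flip: power_add)
    then show "(c i * ?s ^ i) * (d (n - i) * ?s ^ (n - i)) = c i * d (n - i) * ?s ^ n" by (simp add: mult_ac)
  qed
  ultimately show "(\<lambda>n. (\<Sum>i\<le>n. c i * d (n - i)) * ?s ^ n) sums (f \<tau> * g \<tau>)" by simp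
qed

lemma expands_mult:
  assumes "unital_subring R" "expands R a f" "expands R b g"
  shows "expands R (a * b) (\<lambda>\<tau>. f \<tau> * g \<tau>)"
proof -
  interpret unital_subring R by fact
  obtain c d where cd: "range c \<subseteq> R" "c 0 = a" "has_q_expansion f c" "range d \<subseteq> R" "d 0 = b" "has_q_expansion g d"
    using assms by (auto simp: expands_def)
  have "has_q_expansion (\<lambda>\<tau>. f \<tau> * g \<tau>) (\<lambda>n. \<Sum>i\<le>n. c i * d (n - i))"
    using cd(3,6) by (rule has_q_expansion_mult)
  moreover have "range (\<lambda>n. \<Sum>i\<le>n. c i * d (n - i)) \<subseteq> R"
    using cd by (auto intro!: sum_mem mult_mem)
  ultimately show ?thesis
    unfolding expands_def using cd(2,5) by (intro exI[of _ "\<lambda>n. \<Sum>i\<le>n. c i * d (n - i)"]) simp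
qed

lemma expands_diff:
  assumes "unital_subring R" "expands R a f" "expands R b g"
  shows "expands R (a - b) (\<lambda>\<tau>. f \<tau> - g \<tau>)"
proof -
  interpret unital_subring R by fact
  have "expands R (- 1) (\<lambda>_. - 1)" using assms(1) by (intro expands_const uminus_mem one_mem)
  from expands_add[OF assms(1,2) expands_mult[OF assms(1) this assms(3)]] show ?thesis by simp
qed

lemma expands_power:
  assumes "unital_subring R" "expands R a f"
  shows "expands R (a ^ n) (\<lambda>\<tau>. f \<tau> ^ n)"
proof (induction n)
  case 0
  interpret unital_subring R by fact
  show ?case using expands_const[OF assms(1) one_mem] by simp
qed (simp add: expands_mult[OF assms])

lemma expands_nome_mult:
  assumes "unital_subring R" "expands R a f"
  shows "expands R 0 (\<lambda>\<tau>. nome \<tau> * f \<tau>)"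
proof -
  interpret unital_subring R by fact
  obtain c where c: "range c \<subseteq> R" "has_q_expansion f c" using assms by (auto simp: expands_def)
  let ?d = "\<lambda>n. case n of 0 \<Rightarrow> 0 | Suc m \<Rightarrow> c m"
  have "(\<lambda>n. ?d n * nome \<tau> ^ n) sums (nome \<tau> * f \<tau>)" for \<tau>
  proof -
    have "(\<lambda>n. nome \<tau> * (c n * nome \<tau> ^ n)) sums (nome \<tau> * f \<tau>)"
      using c(2) by (intro sums_mult) (simp add: has_q_expansion_def)
    then have "(\<lambda>n. ?d (Suc n) * nome \<tau> ^ Suc n) sums (nome \<tau> * f \<tau>)"
      by (simp add: mult_ac)
    then show ?thesis by (subst (asm) sums_Suc_iff) simp
  qed
  then show ?thesis
    unfolding expands_def has_q_expansion_def
    by (intro exI[of _ ?d]) (use range_subsetD[OF c(1)] in \<open>auto split: nat.splits\<close>)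
qed

section \<open>Uniqueness and division of expansions\<close>

lemma power_series_eq_0:
  fixes a :: "nat \<Rightarrow> complex"
  assumes "\<And>s. norm s < 1 \<Longrightarrow> (\<lambda>n. a n * s ^ n) sums 0"
  shows "a n = 0"
proof (rule ccontr)
  assume a: "a n \<noteq> 0"
  have "a 0 = 0" using assms[of 0] by simp
  then have "n > 0" using a by (cases n) auto
  obtain r where r: "0 < r" "\<And>z::complex. z \<in> cball 0 r - {0} \<Longrightarrow> (0::complex) \<noteq> 0"
    by (rule powser_0_nonzero[where r = 1 and \<xi> = "0::complex" and a = a and f = "\<lambda>_. 0" and m = n])
       (use assms a \<open>n > 0\<close> in auto)
  then show False using r(2)[of "of_real r"] by auto
qed

lemma has_q_expansion_unique:
  assumes "has_q_expansion f c" "has_q_expansion f d"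
  shows "c = d"
proof
  fix n
  obtain F where F: "\<And>\<tau>. f \<tau> = F (nome \<tau>)" "\<And>s. norm s < 1 \<Longrightarrow> (\<lambda>n. c n * s ^ n) sums F s" "F holomorphic_on ball 0 1"
    using has_q_expansion_holomorphic[OF assms(1)] by metis
  obtain H where H: "\<And>\<tau>. f \<tau> = H (nome \<tau>)" "\<And>s. norm s < 1 \<Longrightarrow> (\<lambda>n. d n * s ^ n) sums H s" "H holomorphic_on ball 0 1"
    using has_q_expansion_holomorphic[OF assms(2)] by metis
  have eq: "F s = H s" if "norm s < 1" "s \<noteq> 0" for s
    using exists_nome[OF that(2,1)] F(1) H(1) by metis
  \<comment> \<open>\<open>nome\<close> omits the value 0, so equality there comes by continuation
    across the puncture.\<close>
  have "F 0 = H 0"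
  proof (rule analytic_continuation_open[of "ball 0 1 - {0}" "ball 0 1" F H])
    show "ball 0 1 - {0::complex} \<noteq> {}"
      by (rule ex_in_conv[THEN iffD1], rule exI[of _ "1/2"]) simp
  qed (use F(3) H(3) eq in \<open>auto intro: open_delete\<close>)
  then have "(\<lambda>n. (c n - d n) * s ^ n) sums 0" if "norm s < 1" for s
    using sums_diff[OF F(2) H(2), OF that that] eq[OF that] by (cases "s = 0") (simp_all add: left_diff_distrib)
  from power_series_eq_0[of "\<lambda>n. c n - d n", OF this] show "c n = d n" by simp
qed

text \<open>F has no zeros on the disc, its value at the centre being d \<noteq> 0, so the quotient
  is holomorphic there. Its coefficients stay in R because the convolution with those of F is solved
  recursively using only the inverse e of d.\<close>

lemma expands_divide:
  assumes R: "unital_subring R" and f: "expands R 0 f"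
    and D: "\<And>\<tau>. D \<tau> = nome \<tau> * F \<tau>" and F: "expands R d F" and d: "d * e = 1" "e \<in> R"
    and nz: "\<And>\<tau>. F \<tau> \<noteq> 0"
  shows "\<exists>a. expands R a (\<lambda>\<tau>. f \<tau> / D \<tau>)"
proof -
  interpret R: unital_subring R by fact
  obtain c where c: "range c \<subseteq> R" "c 0 = 0" "has_q_expansion f c" using f by (auto simp: expands_def)
  obtain b where b: "range b \<subseteq> R" "b 0 = d" "has_q_expansion F b" using F by (auto simp: expands_def)
  obtain B where B: "B holomorphic_on ball 0 1" "B 0 = b 0" "\<And>\<tau>. F \<tau> = B (nome \<tau>)"
    "\<And>s. norm s < 1 \<Longrightarrow> (\<lambda>n. b n * s ^ n) sums B s"
    using has_q_expansion_holomorphic[OF b(3)] by metis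
  have d0: "d \<noteq> 0" using d by auto
  have Bnz: "B s \<noteq> 0" if s: "norm s < 1" for s
  proof (cases "s = 0")
    case True
    then show ?thesis using B(2) b(2) d0 by simp
  next
    case False
    then obtain \<tau> where "s = nome \<tau>" using exists_nome[OF False s] by blast
    then show ?thesis using B(3)[of \<tau>] nz[of \<tau>] by simp
  qed
  have c': "has_q_expansion (\<lambda>\<tau>. f \<tau> / nome \<tau>) (\<lambda>n. c (Suc n))"
    unfolding has_q_expansion_def
  proof
    fix \<tau>
    have "(\<lambda>n. c n * nome \<tau> ^ n) sums f \<tau>" using c(3) by (simp add: has_q_expansion_def)
    then have "(\<lambda>n. c (Suc n) * nome \<tau> ^ Suc n) sums f \<tau>" by (subst sums_Suc_iff) (simp add: c)
    then have "(\<lambda>n. c (Suc n) * nome \<tau> ^ Suc n / nome \<tau>) sums (f \<tau> / nome \<tau>)" by (rule sums_divide)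
    then show "(\<lambda>n. c (Suc n) * nome \<tau> ^ n) sums (f \<tau> / nome \<tau>)" by simp
  qed
  obtain C where C: "C holomorphic_on ball 0 1" "\<And>\<tau>. f \<tau> / nome \<tau> = C (nome \<tau>)"
    "\<And>s. norm s < 1 \<Longrightarrow> (\<lambda>n. c (Suc n) * s ^ n) sums C s"
    using has_q_expansion_holomorphic[OF c'] by metis
  let ?Q = "\<lambda>s. C s / B s"
  have Qh: "?Q holomorphic_on ball 0 1"
    using C(1) B(1) Bnz by (intro holomorphic_on_divide) auto
  define q where "q n = (deriv ^^ n) ?Q 0 / fact n" for n
  have q: "(\<lambda>n. q n * s ^ n) sums ?Q s" if "norm s < 1" for s
    using holomorphic_power_series[OF Qh, of s] that by (simp add: q_def dist_norm)
  have expQ: "has_q_expansion (\<lambda>\<tau>. f \<tau> / D \<tau>) q"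
    unfolding has_q_expansion_def
  proof
    fix \<tau>
    have "f \<tau> / D \<tau> = ?Q (nome \<tau>)" using C(2) B(3) by (simp add: D flip: C(2))
    then show "(\<lambda>n. q n * nome \<tau> ^ n) sums (f \<tau> / D \<tau>)" using q[OF norm_nome] by simp
  qed
  have conv: "(\<lambda>n. \<Sum>i\<le>n. q i * b (n - i)) = (\<lambda>n. c (Suc n))"
  proof (rule has_q_expansion_unique[OF _ c'])
    have "f \<tau> / D \<tau> * F \<tau> = f \<tau> / nome \<tau>" for \<tau> using nz[of \<tau>] by (simp add: D)
    then show "has_q_expansion (\<lambda>\<tau>. f \<tau> / nome \<tau>) (\<lambda>n. \<Sum>i\<le>n. q i * b (n - i))"
      using has_q_expansion_mult[OF expQ b(3)] by simp
  qed
  have "q n \<in> R" for n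
  proof (induction n rule: less_induct)
    case (less n)
    have "q n * d + (\<Sum>i<n. q i * b (n - i)) = c (Suc n)"
      using fun_cong[OF conv, of n] b(2) by (simp add: lessThan_Suc_atMost[symmetric] add.commute)
    then have "q n = (c (Suc n) - (\<Sum>i<n. q i * b (n - i))) * e"
      using d(1) by (metis add_diff_cancel_right' mult.assoc mult.right_neutral)
    then show ?case
      using less c(1) b(1) d(2) by (auto intro!: R.mult_mem R.diff_mem R.sum_mem)
  qed
  then show ?thesis using expQ by (auto simp: expands_def)
qed

section \<open>The forms alpha and beta\<close>

lemma theta10_theta01_eq:
  "theta10 \<tau> = \<theta>2 (Rep_uhp \<tau>)" "theta01 \<tau> = \<theta>4 (Rep_uhp \<tau>)"
proof -
  let ?z = "Rep_uhp \<tau>"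
  have "theta w2 ?z = (\<Sum>\<^sub>\<infinity>N\<in>{N. odd N}. gauss ?z N)"
    unfolding theta_def by (rule infsum_cong_neutral) (auto simp: w2_def)
  also have "\<dots> = theta10 \<tau>"
    unfolding theta10_def
    by (rule infsum_reindex_bij_witness[of _ "\<lambda>n. 2 * n + 1" "\<lambda>N. (N - 1) div 2"])
       (auto simp: gauss_def power2_eq_square field_simps elim!: oddE)
  finally show "theta10 \<tau> = \<theta>2 ?z" by simp
  have "theta w4 ?z = (\<Sum>\<^sub>\<infinity>N\<in>{N. even N}. w4 N * gauss ?z N)"
    unfolding theta_def by (rule infsum_cong_neutral) (auto simp: w4_def)
  also have "\<dots> = theta01 \<tau>"
    unfolding theta01_def
  proof (rule infsum_reindex_bij_witness[of _ "\<lambda>n. 2 * n" "\<lambda>N. N div 2"])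
    fix N :: int assume "N \<in> {N. even N}"
    then obtain n where N: "N = 2 * n" by auto
    have "w4 (2 * n) = (- 1) powi n" by (simp add: w4_def four_dvd_double power_int_minus_left)
    then show "(- 1) powi (N div 2) * exp (of_real pi * \<i> * (of_int (N div 2))\<^sup>2 * ?z) = w4 N * gauss ?z N"
      by (simp add: N gauss_def power_mult_distrib mult_ac)
  qed auto
  finally show "theta01 \<tau> = \<theta>4 ?z" by simp
qed

abbreviation "xf z \<equiv> \<theta>2 z ^ 4"
abbreviation "yf z \<equiv> \<theta>4 z ^ 4"

lemma alpha_fun_eq: "alpha_fun \<tau> = xf (Rep_uhp \<tau>) ^ 2 + 6 * xf (Rep_uhp \<tau>) * yf (Rep_uhp \<tau>) + yf (Rep_uhp \<tau>) ^ 2"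
  by (simp add: alpha_fun_def epsilon'_def delta'_def theta10_theta01_eq power2_eq_square field_simps)

lemma beta_fun_eq: "beta_fun \<tau> = (xf (Rep_uhp \<tau>) - yf (Rep_uhp \<tau>)) ^ 4"
  by (simp add: beta_fun_def delta'_def theta10_theta01_eq power_divide)

definition disc_fun :: "uhp \<Rightarrow> complex"
  where "disc_fun \<tau> = alpha_fun \<tau> ^ 2 - beta_fun \<tau>"

lemma jacobi_identity: "Im z > 0 \<Longrightarrow> \<theta>3 z ^ 4 = xf z + yf z"
proof -
  assume z: "Im z > 0"
  have four: "u ^ 4 = (u ^ 2) ^ 2" for u :: complex by simp
  show ?thesis unfolding four theta3_sq[OF z] theta4_sq[OF z] theta2_sq[OF z]
    by (simp add: power2_eq_square algebra_simps)
qed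

text \<open>By Jacobi's identity x + y is \<theta>_3^4, so the factorization consists of theta
  constants, which have no zeros.\<close>

lemma disc_fun_eq: "disc_fun \<tau> = 16 * xf (Rep_uhp \<tau>) * yf (Rep_uhp \<tau>) * (\<theta>3 (Rep_uhp \<tau>) ^ 4) ^ 2"
  unfolding jacobi_identity[OF Im_Rep_uhp] disc_fun_def alpha_fun_eq beta_fun_eq
  by (simp add: power2_eq_square power4_eq_xxxx algebra_simps)

lemma disc_fun_nonzero: "disc_fun \<tau> \<noteq> 0"
  by (simp add: disc_fun_eq theta2_nonzero theta3_nonzero theta4_nonzero)

lemma unital_subring_Ints: "unital_subring (\<int> :: complex set)"
  by unfold_locales auto

lemma theta_coeff_Ints: "(\<And>N. \<kappa> N \<in> \<int>) \<Longrightarrow> theta_coeff \<delta> \<kappa> n \<in> \<int>"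
  unfolding theta_coeff_def by (rule Ints_sum)

lemma expands_theta4: "expands \<int> 1 (\<lambda>\<tau>. \<theta>4 (Rep_uhp \<tau>))"
  unfolding expands_def has_q_expansion_def
  by (intro exI[of _ "theta_coeff 0 w4"])
     (auto simp: theta_coeff_0 w4_def intro!: theta_coeff_Ints theta34_expansion)

lemma expands_theta2: "expands \<int> 2 (\<lambda>\<tau>. exp (- (of_real pi * \<i> * Rep_uhp \<tau> / 4)) * \<theta>2 (Rep_uhp \<tau>))"
  unfolding expands_def has_q_expansion_def
  by (intro exI[of _ "theta_coeff 1 w2"])
     (auto simp: theta_coeff_0[unfolded One_nat_def] w2_def intro!: theta_coeff_Ints theta2_expansion[unfolded One_nat_def])

text \<open>The cofactor of the simple zero of \<theta>_2^4 at the cusp; its constant term is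
  2^4.\<close>

definition x_unit :: "uhp \<Rightarrow> complex"
  where "x_unit \<tau> = (exp (- (of_real pi * \<i> * Rep_uhp \<tau> / 4)) * \<theta>2 (Rep_uhp \<tau>)) ^ 4"

lemma xf_eq_nome_x_unit: "xf (Rep_uhp \<tau>) = nome \<tau> * x_unit \<tau>"
proof -
  have "exp (- (of_real pi * \<i> * Rep_uhp \<tau> / 4)) ^ 4 = exp (- (of_real pi * \<i> * Rep_uhp \<tau>))"
    by (simp flip: exp_of_nat_mult)
  then show ?thesis
    unfolding x_unit_def power_mult_distrib by (simp add: exp_minus flip: mult.assoc)
qed

lemma expands_x_unit: "expands \<int> 16 x_unit"
  using expands_power[OF unital_subring_Ints expands_theta2, of 4] by (simp add: x_unit_def[abs_def])

lemma expands_xf: "expands \<int> 0 (\<lambda>\<tau>. xf (Rep_uhp \<tau>))"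
  unfolding xf_eq_nome_x_unit by (rule expands_nome_mult[OF unital_subring_Ints expands_x_unit])

lemma expands_yf: "expands \<int> 1 (\<lambda>\<tau>. yf (Rep_uhp \<tau>))"
  using expands_power[OF unital_subring_Ints expands_theta4, of 4] by simp

lemma expands_alpha: "expands \<int> 1 alpha_fun"
proof -
  note Z = unital_subring_Ints
  have six: "expands \<int> 6 (\<lambda>_. 6)" by (rule expands_const[OF Z]) simp
  have "expands \<int> (0 ^ 2 + 6 * 0 * 1 + 1 ^ 2) alpha_fun"
    unfolding alpha_fun_eq[abs_def]
    by (intro expands_add[OF Z] expands_mult[OF Z] expands_power[OF Z] six expands_xf expands_yf)
  then show ?thesis by simp
qed

lemma expands_beta: "expands \<int> 1 beta_fun"
proof -
  note Z = unital_subring_Ints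
  have "expands \<int> ((0 - 1) ^ 4) beta_fun"
    unfolding beta_fun_eq[abs_def]
    by (intro expands_diff[OF Z] expands_power[OF Z] expands_xf expands_yf)
  then show ?thesis by simp
qed

definition disc_unit :: "uhp \<Rightarrow> complex"
  where "disc_unit \<tau> = 16 * x_unit \<tau> * yf (Rep_uhp \<tau>) * (xf (Rep_uhp \<tau>) + yf (Rep_uhp \<tau>)) ^ 2"

lemma disc_fun_eq_nome: "disc_fun \<tau> = nome \<tau> * disc_unit \<tau>"
  by (simp add: disc_fun_eq jacobi_identity disc_unit_def xf_eq_nome_x_unit)

lemma disc_unit_nonzero: "disc_unit \<tau> \<noteq> 0"
  using disc_fun_nonzero[of \<tau>] by (auto simp: disc_fun_eq_nome)

lemma expands_disc_unit: "expands \<int> 256 disc_unit"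
proof -
  note Z = unital_subring_Ints
  have c: "expands \<int> 16 (\<lambda>_. 16)" by (rule expands_const[OF Z]) simp
  \<comment> \<open>One factor 16 is the numerical constant, the other is the constant term of
    \<open>x_unit\<close>.\<close>
  have "expands \<int> (16 * 16 * 1 * (0 + 1) ^ 2) disc_unit"
    unfolding disc_unit_def[abs_def]
    by (intro expands_add[OF Z] expands_mult[OF Z] expands_power[OF Z] c expands_x_unit expands_xf expands_yf)
  then show ?thesis by simp
qed

section \<open>Automorphic forms\<close>

text \<open>Holomorphy follows from the expansion as a power series in exp(\<pi> i \<tau>).\<close>

lemma automorphic_formI:
  assumes "expands R a f"
    and "\<And>g \<tau>. g \<in> G \<Longrightarrow> f (moebius g \<tau>) = (g $ 2 $ 1 * Rep_uhp \<tau> + g $ 2 $ 2) powi k * f \<tau>"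
  shows "automorphic_form k f"
proof -
  obtain c where c: "has_q_expansion f c" using assms by (auto simp: expands_def)
  have "(\<lambda>z. f (Abs_uhp z)) holomorphic_on {z. Im z > 0}"
    by (rule expansion_holomorphic_upper_half_plane[OF has_q_expansion_upper_half_plane[OF c]])
  then show ?thesis using assms c by (auto simp: automorphic_form_def)
qed

lemma automorphic_formI_slash_inv:
  "expands R a f \<Longrightarrow> G \<subseteq> slash_inv k f \<Longrightarrow> automorphic_form k f"
  by (rule automorphic_formI) (auto simp: slash_inv_def)

section \<open>Automorphy of \<alpha> and \<beta>\<close>

lemma rotation_factor: "((1 + \<i>) / 2 * (z + 1)) ^ 4 = - (4 * ((z + 1) / 2) ^ 4)" for z :: complex
proof -
  have "(1 + \<i>) ^ 4 = -4" by (simp add: power4_eq_xxxx algebra_simps)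
  then show ?thesis by (simp add: power_mult_distrib power_divide)
qed

text \<open>Here p, q stand for the squares of \<theta>_2, \<theta>_4 and v for (z + 1)/2; the
  factor -4 v^4 is the automorphy factor of weight 4.\<close>

lemma alpha_rotation_identity:
  fixes v p q :: complex
  shows "(v\<^sup>2 * (q - \<i> * p) ^ 2) ^ 2 + 6 * (v\<^sup>2 * (q - \<i> * p) ^ 2) * (- v\<^sup>2 * (q + \<i> * p) ^ 2)
      + (- v\<^sup>2 * (q + \<i> * p) ^ 2) ^ 2
    = - (4 * v ^ 4) * ((p ^ 2) ^ 2 + 6 * p ^ 2 * q ^ 2 + (q ^ 2) ^ 2)"
  by (simp add: power2_eq_square power4_eq_xxxx algebra_simps)

lemma beta_rotation_identity:
  fixes v p q :: complex
  shows "(v\<^sup>2 * (q - \<i> * p) ^ 2 - (- v\<^sup>2 * (q + \<i> * p) ^ 2)) ^ 4 = (- (4 * v ^ 4)) ^ 2 * (p ^ 2 - q ^ 2) ^ 4"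
proof -
  have "v\<^sup>2 * (q - \<i> * p) ^ 2 - (- v\<^sup>2 * (q + \<i> * p) ^ 2) = - 2 * (v ^ 2 * (p ^ 2 - q ^ 2))"
    by (simp add: power2_eq_square algebra_simps)
  then show ?thesis by (simp add: power_mult_distrib)
qed

lemma automorphic_alpha: "automorphic_form 4 alpha_fun"
proof (rule automorphic_formI_slash_inv[OF expands_alpha], rule G_subset_slash_inv[where F = "\<lambda>z. xf z ^ 2 + 6 * xf z * yf z + yf z ^ 2"])
  fix z :: complex assume z: "Im z > 0"
  show "xf (z - 2) ^ 2 + 6 * xf (z - 2) * yf (z - 2) + yf (z - 2) ^ 2 = xf z ^ 2 + 6 * xf z * yf z + yf z ^ 2"
    using theta_fourth_powers_add_2[of "z - 2"] by simp
  define p q where "p = \<theta>2 z ^ 2" and "q = \<theta>4 z ^ 2"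
  have pq: "xf z = p ^ 2" "yf z = q ^ 2" by (simp_all add: p_def q_def)
  show "xf ((z - 1) / (z + 1)) ^ 2 + 6 * xf ((z - 1) / (z + 1)) * yf ((z - 1) / (z + 1)) + yf ((z - 1) / (z + 1)) ^ 2
      = ((1 + \<i>) / 2 * (z + 1)) powi 4 * (xf z ^ 2 + 6 * xf z * yf z + yf z ^ 2)"
    unfolding theta_fourth_powers_rotation[OF z] power_int_numeral rotation_factor pq
    unfolding p_def[symmetric] q_def[symmetric] by (rule alpha_rotation_identity)
qed (simp_all add: alpha_fun_eq)

lemma automorphic_beta: "automorphic_form 8 beta_fun"
proof (rule automorphic_formI_slash_inv[OF expands_beta], rule G_subset_slash_inv[where F = "\<lambda>z. (xf z - yf z) ^ 4"])
  fix z :: complex assume z: "Im z > 0"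
  show "(xf (z - 2) - yf (z - 2)) ^ 4 = (xf z - yf z) ^ 4"
    using theta_fourth_powers_add_2[of "z - 2"] by simp
  define p q where "p = \<theta>2 z ^ 2" and "q = \<theta>4 z ^ 2"
  have pq: "xf z = p ^ 2" "yf z = q ^ 2" by (simp_all add: p_def q_def)
  have eight: "((1 + \<i>) / 2 * (z + 1)) ^ 8 = (((1 + \<i>) / 2 * (z + 1)) ^ 4) ^ 2"
    by (simp only: flip: power_mult) simp
  show "(xf ((z - 1) / (z + 1)) - yf ((z - 1) / (z + 1))) ^ 4
      = ((1 + \<i>) / 2 * (z + 1)) powi 8 * (xf z - yf z) ^ 4"
    unfolding theta_fourth_powers_rotation[OF z] power_int_numeral eight rotation_factor pq
    unfolding p_def[symmetric] q_def[symmetric] by (rule beta_rotation_identity)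
qed (simp_all add: beta_fun_eq)

text \<open>The zero function satisfies every transformation law, so membership in its
  \<open>slash_inv\<close> leaves just the conditions on the matrix.\<close>

lemma G_den_nonzero:
  assumes "g \<in> G"
  shows "g $ 2 $ 1 * Rep_uhp \<tau> + g $ 2 $ 2 \<noteq> 0"
proof -
  have "G \<subseteq> slash_inv 0 (\<lambda>_. 0)" by (rule G_subset_slash_inv[where F = "\<lambda>_. 0"]) simp_all
  then show ?thesis using assms by (auto simp: slash_inv_def)
qed

lemma automorphic_expands:
  assumes "automorphic_form k f"
  obtains a where "expands UNIV a f"
  using assms by (auto simp: automorphic_form_def expands_def)

lemma automorphic_transform:
  "automorphic_form k f \<Longrightarrow> g \<in> G \<Longrightarrow>
    f (moebius g \<tau>) = (g $ 2 $ 1 * Rep_uhp \<tau> + g $ 2 $ 2) powi k * f \<tau>"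
  by (simp add: automorphic_form_def)

lemma unital_subring_UNIV: "unital_subring UNIV"
  by unfold_locales auto

lemma automorphic_mult:
  assumes "automorphic_form k f" "automorphic_form l g"
  shows "automorphic_form (k + l) (\<lambda>\<tau>. f \<tau> * g \<tau>)"
proof -
  obtain a b where "expands UNIV a f" "expands UNIV b g"
    using assms automorphic_expands by metis
  then have "expands UNIV (a * b) (\<lambda>\<tau>. f \<tau> * g \<tau>)" by (rule expands_mult[OF unital_subring_UNIV])
  then show ?thesis
    by (rule automorphic_formI)
      (simp add: automorphic_transform[OF assms(1)] automorphic_transform[OF assms(2)] power_int_add G_den_nonzero)
qed

lemma automorphic_diff:
  assumes "automorphic_form k f" "automorphic_form k g"
  shows "automorphic_form k (\<lambda>\<tau>. f \<tau> - g \<tau>)"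
proof -
  obtain a b where "expands UNIV a f" "expands UNIV b g"
    using assms automorphic_expands by metis
  then have "expands UNIV (a - b) (\<lambda>\<tau>. f \<tau> - g \<tau>)" by (rule expands_diff[OF unital_subring_UNIV])
  then show ?thesis
    by (rule automorphic_formI)
      (simp add: automorphic_transform[OF assms(1)] automorphic_transform[OF assms(2)] right_diff_distrib)
qed

lemma automorphic_const: "automorphic_form 0 (\<lambda>_. a)"
  by (rule automorphic_formI[OF expands_const[OF unital_subring_UNIV]]) simp_all

lemma automorphic_zero: "automorphic_form k (\<lambda>_. 0)"
  by (rule automorphic_formI[OF expands_const[OF unital_subring_UNIV]]) simp_all

lemma automorphic_power: "automorphic_form k f \<Longrightarrow> automorphic_form (int n * k) (\<lambda>\<tau>. f \<tau> ^ n)"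
proof (induction n)
  case 0
  show ?case using automorphic_const[of 1] by simp
next
  case (Suc n)
  then show ?case using automorphic_mult[OF Suc.prems Suc.IH] by (simp add: algebra_simps)
qed

lemma automorphic_disc: "automorphic_form 8 disc_fun"
  using automorphic_diff[OF automorphic_power[OF automorphic_alpha, of 2, simplified] automorphic_beta]
  by (simp add: disc_fun_def[abs_def])

lemma cay_mem_G: "u \<in> gauss_units \<Longrightarrow> v \<in> gauss_units \<Longrightarrow> cay (mat22 u 0 0 v) \<in> G"
  unfolding G_eq by (intro imageI U11_generators)

text \<open>The scalar matrix i lies in G and acts trivially on the half plane, but with automorphy
  factor i^k.\<close>

lemma automorphic_weight_dvd:
  assumes f: "automorphic_form k f" and k: "\<not> 4 dvd k"
  shows "f = (\<lambda>_. 0)"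
proof
  fix \<tau>
  have "cay (mat22 \<i> 0 0 \<i>) \<in> G" by (rule cay_mem_G) (simp_all add: gauss_units_def)
  from automorphic_transform[OF f this, of \<tau>] have "f \<tau> = \<i> powi k * f \<tau>"
    by (simp add: cay_generators vector_2 moebius_def Rep_uhp_inverse)
  moreover have "\<i> powi k \<noteq> 1"
  proof -
    have "k = 4 * (k div 4) + k mod 4" by simp
    then have "\<i> powi k = (\<i> powi 4) powi (k div 4) * \<i> powi (k mod 4)"
      by (metis power_int_add power_int_mult complex_i_not_zero)
    then have "\<i> powi k = \<i> powi (k mod 4)" by simp
    moreover have "k mod 4 = 1 \<or> k mod 4 = 2 \<or> k mod 4 = 3" using k by presburger
    ultimately show ?thesis by (auto simp: power3_eq_cube complex_eq_iff)
  qed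
  ultimately show "f \<tau> = 0" by simp
qed

section \<open>Forms of non-positive weight\<close>

text \<open>By the maximum principle: a boundary point of the disc \<open>\<bar>q\<^bsup>1/2\<^esup>\<bar> \<le> e\<^bsup>-\<pi>/2\<^esup>\<close> is moved
  to the interior by one of the two rotations of order 4 about i.\<close>

lemma automorphic_weight_0:
  assumes h: "automorphic_form 0 h"
  obtains a where "h = (\<lambda>_. a)"
proof -
  obtain c where c: "has_q_expansion h c" using h by (auto simp: automorphic_form_def)
  obtain F where F: "F holomorphic_on ball 0 1" "\<And>\<tau>. h \<tau> = F (nome \<tau>)"
    using has_q_expansion_holomorphic[OF c] by metis
  define r where "r = exp (- (pi / 2))"
  have r: "0 < r" "r < 1" by (simp_all add: r_def)
  have "continuous_on (cball 0 r) F"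
    using F(1) r by (intro holomorphic_on_imp_continuous_on holomorphic_on_subset[OF F(1)]) auto
  then have "continuous_on (cball 0 r) (\<lambda>s. norm (F s))" by (rule continuous_on_norm)
  then obtain s1 where s1: "norm s1 \<le> r" "\<And>s. norm s \<le> r \<Longrightarrow> norm (F s) \<le> norm (F s1)"
    using continuous_attains_sup[of "cball (0::complex) r" "\<lambda>s. norm (F s)"] r by (auto simp: dist_norm)
  obtain s2 where s2: "norm s2 < r" "norm (F s2) = norm (F s1)"
  proof (cases "norm s1 < r")
    case True
    then show ?thesis using that by blast
  next
    case False
    then have eq: "norm s1 = r" using s1(1) by simp
    then have "s1 \<noteq> 0" "norm s1 < 1" using r by auto
    then obtain \<tau> where \<tau>: "s1 = nome \<tau>" "\<bar>Re (Rep_uhp \<tau>)\<bar> \<le> 1" by (rule exists_nome)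
    let ?z = "Rep_uhp \<tau>"
    have im: "Im ?z = 1 / 2" using eq by (simp add: \<tau>(1) r_def)
    \<comment> \<open>A point z of height 1/2 is rotated to height 1/|z + 1|^2 or 1/|z - 1|^2.
      Choosing by the sign of Re z makes the denominator at most 5/4 and the new height at least
      4/5. Any h < 1 would serve in place of 1/2, as 2h/(1 + h^2) > h.\<close>
    obtain u where u: "Im u > 1 / 2" "h (Abs_uhp u) = h \<tau>"
    proof (cases "Re ?z \<le> 0")
      case True
      have "cay Rmat \<in> G" by (rule cay_mem_G) (simp_all add: gauss_units_def)
      from automorphic_transform[OF h this, of \<tau>] have hm: "h (moebius (cay Rmat) \<tau>) = h \<tau>" by simp
      define e where "e = (1 + \<i>) / 2"
      have e: "e \<noteq> 0" by (auto simp: e_def complex_eq_iff)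
      have "(e * ?z + - e) / (e * ?z + e) = (?z - 1) / (?z + 1)"
      proof -
        have "e * ?z + - e = e * (?z - 1)" "e * ?z + e = e * (?z + 1)" by (simp_all add: algebra_simps)
        then show ?thesis by (simp only: mult_divide_mult_cancel_left[OF e])
      qed
      then have "moebius (cay Rmat) \<tau> = Abs_uhp ((?z - 1) / (?z + 1))"
        unfolding moebius_def cay_generators vector_2 by (simp only: e_def)
      moreover have "Im ((?z - 1) / (?z + 1)) > 1 / 2"
      proof -
        have "(Re ?z + 1) ^ 2 \<le> 1 ^ 2" using True \<tau>(2) by (intro power_mono) auto
        moreover have "norm (?z + 1) ^ 2 = (Re ?z + 1) ^ 2 + 1 / 4"
          by (simp add: cmod_power2 im power_divide)
        ultimately have "norm (?z + 1) ^ 2 \<le> 1 + 1 / 4" by simp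
        moreover have "norm (?z + 1) ^ 2 > 0" using uhp_add_1_nonzero(1)[OF Im_Rep_uhp] by simp
        ultimately show ?thesis
          unfolding Im_rotation(1)[OF Im_Rep_uhp] im by (simp only: pos_less_divide_eq)
      qed
      ultimately show ?thesis using that hm by metis
    next
      case False
      have "cay (mat22 1 0 0 (- \<i>)) \<in> G" by (rule cay_mem_G) (simp_all add: gauss_units_def)
      from automorphic_transform[OF h this, of \<tau>] have hm: "h (moebius (cay (mat22 1 0 0 (- \<i>))) \<tau>) = h \<tau>" by simp
      define e where "e = (1 - \<i>) / 2"
      have e: "e \<noteq> 0" by (auto simp: e_def complex_eq_iff)
      have "(e * ?z + e) / (- e * ?z + e) = (?z + 1) / (1 - ?z)"
      proof -
        have "e * ?z + e = e * (?z + 1)" "- e * ?z + e = e * (1 - ?z)" by (simp_all add: algebra_simps)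
        then show ?thesis by (simp only: mult_divide_mult_cancel_left[OF e])
      qed
      then have "moebius (cay (mat22 1 0 0 (- \<i>))) \<tau> = Abs_uhp ((?z + 1) / (1 - ?z))"
        unfolding moebius_def cay_generators vector_2 by (simp only: e_def)
      moreover have "Im ((?z + 1) / (1 - ?z)) > 1 / 2"
      proof -
        have "(1 - Re ?z) ^ 2 \<le> 1 ^ 2" using False \<tau>(2) by (intro power_mono) auto
        then have "(Re ?z - 1) ^ 2 \<le> 1" by (simp add: power2_commute)
        moreover have "norm (?z - 1) ^ 2 = (Re ?z - 1) ^ 2 + 1 / 4"
          by (simp add: cmod_power2 im power_divide)
        ultimately have "norm (?z - 1) ^ 2 \<le> 1 + 1 / 4" by simp
        moreover have "norm (?z - 1) ^ 2 > 0" using uhp_add_1_nonzero(2)[OF Im_Rep_uhp, of \<tau>] by auto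
        ultimately show ?thesis
          unfolding Im_rotation(2)[OF Im_Rep_uhp] im by (simp only: pos_less_divide_eq)
      qed
      ultimately show ?thesis using that hm by metis
    qed
    let ?s = "nome (Abs_uhp u)"
    have "norm ?s < r" using u(1) by (simp add: r_def Rep_Abs_uhp)
    moreover have "F ?s = F s1" using u(2) F(2) \<tau>(1) by metis
    ultimately show ?thesis using that by metis
  qed
  have "F constant_on ball 0 1"
  proof (rule maximum_modulus_principle[OF F(1), where U = "ball 0 r" and \<xi> = s2])
    show "norm (F s) \<le> norm (F s2)" if "s \<in> ball 0 r" for s
      using that s1(2)[of s] s2(2) by (simp add: dist_norm)
  qed (use r s2(1) in \<open>auto simp: dist_norm\<close>)
  then obtain a where "\<And>s. norm s < 1 \<Longrightarrow> F s = a" by (auto simp: constant_on_def)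
  then have "h \<tau> = a" for \<tau> using F(2) norm_nome by metis
  then show ?thesis using that by blast
qed

text \<open>f is squared so that the weights of f^2 and of the j-th power of \<open>disc_fun\<close>
  cancel. The product is constant and vanishes at the cusp, while \<open>disc_fun\<close> has no
  zeros.\<close>

lemma automorphic_negative_weight:
  assumes f: "automorphic_form (- 4 * int j) f" and j: "j > 0"
  shows "f = (\<lambda>_. 0)"
proof -
  let ?h = "\<lambda>\<tau>. f \<tau> ^ 2 * disc_fun \<tau> ^ j"
  have "automorphic_form (int 2 * (- 4 * int j) + int j * 8) ?h"
    by (intro automorphic_mult automorphic_power f automorphic_disc)
  then have "automorphic_form 0 ?h" by simp
  then obtain a where a: "?h = (\<lambda>_. a)" by (rule automorphic_weight_0)
  obtain b where b: "expands UNIV b f" using f by (rule automorphic_expands)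
  have "expands UNIV 0 disc_fun"
    unfolding disc_fun_eq_nome[abs_def]
    by (rule expands_nome_mult[OF unital_subring_UNIV expands_mono[OF _ expands_disc_unit]]) simp
  then have "expands UNIV (b ^ 2 * 0 ^ j) ?h"
    by (intro expands_mult[OF unital_subring_UNIV] expands_power[OF unital_subring_UNIV] b)
  moreover have "expands UNIV a ?h" unfolding a by (rule expands_const[OF unital_subring_UNIV]) simp
  ultimately have "b ^ 2 * 0 ^ j = a"
    unfolding expands_def using has_q_expansion_unique by metis
  moreover have "(0 :: complex) ^ j = 0" using j by (rule zero_power)
  ultimately have "a = 0" by simp
  then show ?thesis using fun_cong[OF a] disc_fun_nonzero by (intro ext) (simp add: power_0_left)
qed

section \<open>The ring of automorphic forms\<close>

lemma automorphic_divide_disc: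
  assumes R: "unital_subring R" and e: "256 * e = 1" "e \<in> R"
    and f: "automorphic_form k f" "expands R 0 f"
  obtains b g where "automorphic_form (k - 8) g" "expands R b g" "f = (\<lambda>\<tau>. disc_fun \<tau> * g \<tau>)"
proof -
  interpret unital_subring R by fact
  have "\<int> \<subseteq> R" by (auto elim!: Ints_cases)
  then have "expands R 256 disc_unit" using expands_disc_unit by (rule expands_mono)
  from expands_divide[OF R f(2) disc_fun_eq_nome this e disc_unit_nonzero]
  obtain b where b: "expands R b (\<lambda>\<tau>. f \<tau> / disc_fun \<tau>)" ..
  then have "automorphic_form (k - 8) (\<lambda>\<tau>. f \<tau> / disc_fun \<tau>)"
    by (rule automorphic_formI)
       (simp add: automorphic_transform[OF f(1)] automorphic_transform[OF automorphic_disc]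
          power_int_diff G_den_nonzero)
  moreover have "f = (\<lambda>\<tau>. disc_fun \<tau> * (f \<tau> / disc_fun \<tau>))" using disc_fun_nonzero by auto
  ultimately show ?thesis using b that by blast
qed

text \<open>\<alpha> has constant term 1, so f minus a \<alpha>^j vanishes at the cusp and is
  divisible by \<open>disc_fun\<close>, which lowers j by 2. The inverse of 256 keeps the quotient
  over R.\<close>

lemma automorphic_form_induct:
  assumes R: "unital_subring R" and e: "256 * e = 1" "e \<in> R"
    and zero: "\<And>j. Q j (\<lambda>_. 0)"
    and alpha: "\<And>j r. r \<in> R \<Longrightarrow> Q j (\<lambda>\<tau>. r * alpha_fun \<tau> ^ j)"
    and add: "\<And>j f g. Q j f \<Longrightarrow> Q j g \<Longrightarrow> Q j (\<lambda>\<tau>. f \<tau> + g \<tau>)"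
    and disc: "\<And>j g. Q j g \<Longrightarrow> Q (j + 2) (\<lambda>\<tau>. disc_fun \<tau> * g \<tau>)"
    and f: "automorphic_form (4 * int j) f" "expands R a f"
  shows "Q j f"
  using f
proof (induction j arbitrary: f a rule: less_induct)
  case (less j)
  interpret unital_subring R by fact
  have a: "a \<in> R" using less.prems(2) by (auto simp: expands_def)
  have ZR: "\<int> \<subseteq> R" by (auto elim!: Ints_cases)
  let ?f0 = "\<lambda>\<tau>. f \<tau> - a * alpha_fun \<tau> ^ j"
  have "automorphic_form (0 + int j * 4) (\<lambda>\<tau>. a * alpha_fun \<tau> ^ j)"
    by (intro automorphic_mult automorphic_const automorphic_power automorphic_alpha)
  then have f0: "automorphic_form (4 * int j) ?f0"
    using less.prems(1) by (intro automorphic_diff) (simp_all add: mult.commute)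
  have "expands R (a - a * 1 ^ j) ?f0"
    by (intro expands_diff[OF R] expands_mult[OF R] expands_power[OF R] expands_const[OF R] less.prems a
        expands_mono[OF ZR expands_alpha])
  then have "expands R 0 ?f0" by simp
  then obtain b g where g: "automorphic_form (4 * int j - 8) g" "expands R b g" "?f0 = (\<lambda>\<tau>. disc_fun \<tau> * g \<tau>)"
    using automorphic_divide_disc[OF R e f0] by metis
  have "Q j ?f0"
  proof (cases "j \<ge> 2")
    case True
    then have "Q (j - 2) g" using g(1,2) by (intro less.IH) (auto simp: of_nat_diff algebra_simps)
    then have "Q (j - 2 + 2) (\<lambda>\<tau>. disc_fun \<tau> * g \<tau>)" by (rule disc)
    then show ?thesis unfolding g(3) using True by (simp only: le_add_diff_inverse2)
  next
    case False
    \<comment> \<open>For j < 2 the quotient has the negative weight -4 (2 - j).\<close>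
    then have "g = (\<lambda>_. 0)" using g(1) by (intro automorphic_negative_weight[of "2 - j"]) (simp_all add: of_nat_diff)
    then show ?thesis unfolding g(3) using zero by simp
  qed
  from add[OF this alpha[OF a]] show ?case by simp
qed

section \<open>The graded ring over a ring of coefficients\<close>

lemma forms_of_degree_iff:
  "f \<in> forms_of_degree R d \<longleftrightarrow>
    (if even d then automorphic_form (d div 2) f \<and> (\<exists>a. expands R a f) else f = 0)"
  by (auto simp: forms_of_degree_def expands_def)

context
  fixes R :: "complex set"
  assumes R: "unital_subring R"
begin

interpretation R: unital_subring R by (rule R)

lemma forms_zero: "0 \<in> forms_of_degree R d"
  using expands_const[OF R R.zero_mem] automorphic_zero by (auto simp: forms_of_degree_iff zero_fun_def)

lemma forms_diff:
  assumes "f \<in> forms_of_degree R d" "g \<in> forms_of_degree R d"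
  shows "f - g \<in> forms_of_degree R d"
proof (cases "even d")
  case True
  then obtain a b where "expands R a f" "expands R b g" using assms by (auto simp: forms_of_degree_iff)
  then have "expands R (a - b) (\<lambda>\<tau>. f \<tau> - g \<tau>)" by (rule expands_diff[OF R])
  then show ?thesis using assms True by (auto simp: forms_of_degree_iff fun_diff_def automorphic_diff)
qed (use assms in \<open>auto simp: forms_of_degree_iff\<close>)

lemma forms_mult:
  assumes "f \<in> forms_of_degree R d" "g \<in> forms_of_degree R e"
  shows "f * g \<in> forms_of_degree R (d + e)"
proof (cases "even d \<and> even e")
  case True
  then obtain a b where "expands R a f" "expands R b g" using assms by (auto simp: forms_of_degree_iff)
  then have ex: "expands R (a * b) (\<lambda>\<tau>. f \<tau> * g \<tau>)" by (rule expands_mult[OF R])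
  have "automorphic_form (d div 2 + e div 2) (\<lambda>\<tau>. f \<tau> * g \<tau>)"
    using assms True by (intro automorphic_mult) (auto simp: forms_of_degree_iff)
  moreover have "d div 2 + e div 2 = (d + e) div 2" using True by (simp add: div_plus_div_distrib_dvd_left)
  ultimately have "automorphic_form ((d + e) div 2) (\<lambda>\<tau>. f \<tau> * g \<tau>)" by (simp only:)
  moreover have "even (d + e)" using True by simp
  ultimately show ?thesis unfolding forms_of_degree_iff times_fun_def using ex by (simp only: if_True) blast
next
  case False
  then have "f * g = 0" using assms by (auto simp: forms_of_degree_iff)
  then show ?thesis using forms_zero by simp
qed

lemma MG_sum: "(\<And>i. i \<in> I \<Longrightarrow> F i \<in> MG R) \<Longrightarrow> sum F I \<in> MG R"
proof (induction I rule: infinite_finite_induct)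
  case (insert i I)
  have "f + g \<in> forms_of_degree R d" if "f \<in> forms_of_degree R d" "g \<in> forms_of_degree R d" for f g d
    using forms_diff[OF that(1) forms_diff[OF forms_zero that(2)]] by simp
  then show ?case using insert by (auto simp: MG_def lookup_add)
qed (simp_all add: MG_def forms_zero)

lemma single_mem_MG: "f \<in> forms_of_degree R d \<Longrightarrow> Poly_Mapping.single d f \<in> MG R"
  by (auto simp: MG_def lookup_single when_def forms_zero)

lemma unital_subring_MG: "unital_subring (MG R)"
proof
  have "(1 :: uhp \<Rightarrow> complex) \<in> forms_of_degree R 0"
    using expands_const[OF R R.one_mem] automorphic_const[of 1] by (auto simp: forms_of_degree_iff one_fun_def)
  then show "1 \<in> MG R" using single_mem_MG by (simp flip: single_one)
  fix F H assume FH: "F \<in> MG R" "H \<in> MG R"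
  then show "F - H \<in> MG R" by (auto simp: MG_def lookup_minus forms_diff)
  have "F * H = (\<Sum>d\<in>Poly_Mapping.keys F. \<Sum>e\<in>Poly_Mapping.keys H.
      Poly_Mapping.single (d + e) (Poly_Mapping.lookup F d * Poly_Mapping.lookup H e))"
    by (subst poly_mapping_sum_single[of F], subst poly_mapping_sum_single[of H])
       (simp add: sum_product mult_single)
  also have "\<dots> \<in> MG R"
    using FH by (intro MG_sum single_mem_MG forms_mult) (auto simp: MG_def)
  finally show "F * H \<in> MG R" .
qed

lemma graded_const_mem_MG:
  assumes "of_rat r \<in> R"
  shows "graded_const r \<in> MG R"
proof -
  have "(\<lambda>_. of_rat r) \<in> forms_of_degree R 0"
    using expands_const[OF R assms] automorphic_const by (auto simp: forms_of_degree_iff)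
  then show ?thesis unfolding graded_const_def by (rule single_mem_MG)
qed

lemma alpha_beta_mem_MG: "case_indet alpha beta v \<in> MG R"
proof -
  have ZR: "\<int> \<subseteq> R" by (auto elim!: Ints_cases)
  have "alpha_fun \<in> forms_of_degree R 8" "beta_fun \<in> forms_of_degree R 16"
    using automorphic_alpha automorphic_beta expands_mono[OF ZR expands_alpha] expands_mono[OF ZR expands_beta]
    by (auto simp: forms_of_degree_iff)
  then show ?thesis by (cases v) (simp_all add: alpha_def beta_def single_mem_MG)
qed

end

section \<open>Surjectivity of the evaluation at \<alpha> and \<beta>\<close>

lemma comm_ring_hom_graded_const: "comm_ring_hom graded_const"
proof
  show "graded_const 1 = 1" by (simp add: graded_const_def flip: single_one one_fun_def)
  fix r s
  show "graded_const (r + s) = graded_const r + graded_const s"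
    by (simp add: graded_const_def plus_fun_def of_rat_add flip: single_add)
  show "graded_const (r * s) = graded_const r * graded_const s"
    by (simp add: graded_const_def times_fun_def of_rat_mult mult_single)
qed

lemma eval_alpha_beta_eq: "eval_alpha_beta = peval graded_const (case_indet alpha beta)"
  by (rule ext) (simp add: eval_alpha_beta_def eval_at_def peval_def monom_at_def)

lemma comm_ring_hom_eval: "comm_ring_hom eval_alpha_beta"
  unfolding eval_alpha_beta_eq by (rule comm_ring_hom_peval[OF comm_ring_hom_graded_const])

interpretation eval_ab: comm_ring_hom eval_alpha_beta
  by (rule comm_ring_hom_eval)

lemma eval_qconst [simp]: "eval_alpha_beta (qconst r) = graded_const r"
  unfolding eval_alpha_beta_eq by (rule peval_qconst[OF comm_ring_hom_graded_const])

lemma eval_qvar [simp]: "eval_alpha_beta (qvar A) = alpha" "eval_alpha_beta (qvar B) = beta"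
  unfolding eval_alpha_beta_eq by (simp_all add: peval_qvar[OF comm_ring_hom_graded_const])

lemma comm_ring_hom_of_rat: "comm_ring_hom (of_rat :: rat \<Rightarrow> complex)"
  by unfold_locales (simp_all add: of_rat_add of_rat_mult)

lemma eval_mem_MG:
  assumes "unital_subring R" "P \<in> polys_over R"
  shows "eval_alpha_beta P \<in> MG (of_rat ` R)"
proof -
  have R: "unital_subring (of_rat ` R :: complex set)"
    by (rule unital_subring_image[OF comm_ring_hom_of_rat assms(1)])
  show ?thesis
    unfolding eval_alpha_beta_eq
    by (intro peval_mem[OF unital_subring_MG[OF R] comm_ring_hom_graded_const]
        graded_const_mem_MG[OF R] alpha_beta_mem_MG[OF R])
       (use assms(2) in \<open>auto simp: polys_over_def\<close>)
qed

lemma single_power_fun: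
  "Poly_Mapping.single d (f :: uhp \<Rightarrow> complex) ^ n = Poly_Mapping.single (int n * d) (\<lambda>\<tau>. f \<tau> ^ n)"
proof (induction n)
  case 0 then show ?case by (simp flip: single_one one_fun_def)
next
  case (Suc n)
  then show ?case by (simp add: mult_single times_fun_def algebra_simps)
qed

text \<open>Degree by degree: a nonzero component has weight 4j with j \<ge> 0, and
  \<open>automorphic_form_induct\<close> then builds a preimage, with A^2 - B mapped to
  \<open>disc_fun\<close>.\<close>

lemma eval_surj:
  assumes R: "unital_subring R" and e: "256 * e = 1" "e \<in> R" and F: "F \<in> MG (of_rat ` R)"
  shows "\<exists>P\<in>polys_over R. eval_alpha_beta P = F"
proof -
  interpret R: unital_subring R by fact
  interpret P: unital_subring "polys_over R :: indet qpoly set" by (rule unital_subring_polys_over[OF R])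
  let ?T = "of_rat ` R :: complex set"
  have T: "unital_subring ?T" by (rule unital_subring_image[OF comm_ring_hom_of_rat R])
  have e': "256 * of_rat e = (1 :: complex)" using arg_cong[OF e(1), of "of_rat :: rat \<Rightarrow> complex"] by (simp add: of_rat_mult)
  define Q where "Q j f \<longleftrightarrow> (\<exists>P\<in>polys_over R. eval_alpha_beta P = Poly_Mapping.single (8 * int j) f)" for j f
  have vars: "qvar v \<in> polys_over R" for v :: indet by (rule qvar_mem_polys_over) auto
  have Q: "Q j f" if "automorphic_form (4 * int j) f" "expands ?T a f" for j f a
  proof (rule automorphic_form_induct[OF T e' _ _ _ _ _ that])
    show "of_rat e \<in> ?T" using e by blast
    fix j
    show "Q j (\<lambda>_. 0)" unfolding Q_def by (intro bexI[of _ 0]) (auto simp flip: zero_fun_def)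
    show "Q j (\<lambda>\<tau>. r * alpha_fun \<tau> ^ j)" if r: "r \<in> ?T" for r
    proof -
      obtain s where s: "s \<in> R" "r = of_rat s" using r by blast
      have "eval_alpha_beta (qconst s * qvar A ^ j) = Poly_Mapping.single (8 * int j) (\<lambda>\<tau>. r * alpha_fun \<tau> ^ j)"
        by (simp add: eval_ab.hom_mult eval_ab.hom_power alpha_def single_power_fun graded_const_def s mult_single
            times_fun_def mult.commute)
      moreover have "qconst s * qvar A ^ j \<in> polys_over R"
        using s(1) by (intro P.mult_mem P.power_mem vars qconst_mem_polys_over) auto
      ultimately show ?thesis unfolding Q_def by blast
    qed
    fix f g
    show "Q j (\<lambda>\<tau>. f \<tau> + g \<tau>)" if fg: "Q j f" "Q j g"
    proof -
      obtain P1 P2 where "P1 \<in> polys_over R" "P2 \<in> polys_over R"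
        "eval_alpha_beta P1 = Poly_Mapping.single (8 * int j) f" "eval_alpha_beta P2 = Poly_Mapping.single (8 * int j) g"
        using fg unfolding Q_def by blast
      then show ?thesis
        unfolding Q_def
        by (intro bexI[of _ "P1 + P2"]) (auto simp: eval_ab.hom_add P.add_mem plus_fun_def simp flip: single_add)
    qed
    show "Q (j + 2) (\<lambda>\<tau>. disc_fun \<tau> * g \<tau>)" if g: "Q j g"
    proof -
      obtain P where P: "P \<in> polys_over R" "eval_alpha_beta P = Poly_Mapping.single (8 * int j) g"
        using g unfolding Q_def by blast
      have "eval_alpha_beta (qvar A ^ 2 - qvar B) = Poly_Mapping.single 16 disc_fun"
        by (simp add: eval_ab.hom_diff eval_ab.hom_power alpha_def beta_def single_power_fun disc_fun_def[abs_def]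
            fun_diff_def flip: single_diff)
      then have "eval_alpha_beta ((qvar A ^ 2 - qvar B) * P) = Poly_Mapping.single (8 * int (j + 2)) (\<lambda>\<tau>. disc_fun \<tau> * g \<tau>)"
        by (simp only: eval_ab.hom_mult P(2) mult_single times_fun_def) (simp add: add.commute)
      moreover have "(qvar A ^ 2 - qvar B) * P \<in> polys_over R"
        by (intro P.mult_mem P.diff_mem P.power_mem vars P(1))
      ultimately show ?thesis unfolding Q_def by blast
    qed
  qed
  have hom: "\<exists>P\<in>polys_over R. eval_alpha_beta P = Poly_Mapping.single d (Poly_Mapping.lookup F d)" for d
  proof (cases "Poly_Mapping.lookup F d = 0")
    case True
    then show ?thesis by (intro bexI[of _ 0]) auto
  next
    case False
    have mem: "Poly_Mapping.lookup F d \<in> forms_of_degree ?T d" using F by (simp add: MG_def)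
    then have ev: "even d" using False by (auto simp: forms_of_degree_iff)
    then obtain a where a: "automorphic_form (d div 2) (Poly_Mapping.lookup F d)" "expands ?T a (Poly_Mapping.lookup F d)"
      using mem by (auto simp: forms_of_degree_iff)
    then have "4 dvd d div 2" using automorphic_weight_dvd False by (auto simp: zero_fun_def)
    then obtain k where k: "d div 2 = 4 * k" by (elim dvdE)
    have "k \<ge> 0"
    proof (rule ccontr)
      assume "\<not> k \<ge> 0"
      then have n: "d div 2 = - 4 * int (nat (- k))" "nat (- k) > 0" using k by simp_all
      from automorphic_negative_weight[OF a(1)[unfolded n(1)] n(2)] show False
        using False by (simp add: zero_fun_def)
    qed
    then have "d div 2 = 4 * int (nat k)" "d = 8 * int (nat k)" using k ev by auto
    then show ?thesis using Q[of "nat k"] a unfolding Q_def by metis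
  qed
  then obtain p where p: "\<And>d. p d \<in> polys_over R"
      "\<And>d. eval_alpha_beta (p d) = Poly_Mapping.single d (Poly_Mapping.lookup F d)" by metis
  have "eval_alpha_beta (\<Sum>d\<in>Poly_Mapping.keys F. p d) = F"
    by (simp add: eval_ab.hom_sum p(2) flip: poly_mapping_sum_single)
  moreover have "(\<Sum>d\<in>Poly_Mapping.keys F. p d) \<in> polys_over R" using p(1) by (intro P.sum_mem)
  ultimately show ?thesis by blast
qed

section \<open>Algebraic independence of \<alpha> and \<beta>\<close>

lemma tendsto_at_cusp:
  assumes "expands R a f"
  shows "(\<lambda>n. f (Abs_uhp (\<i> * of_nat (Suc n)))) \<longlonglongrightarrow> a"
proof -
  obtain c where c: "has_q_expansion f c" "c 0 = a" using assms by (auto simp: expands_def)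
  have "filterlim (\<lambda>n. Im (\<i> * of_nat (Suc n))) at_top sequentially"
    using filterlim_compose[OF filterlim_real_sequentially filterlim_Suc] by simp
  from expansion_tendsto[OF has_q_expansion_upper_half_plane[OF c(1)] this] show ?thesis by (simp add: c(2))
qed

text \<open>Dividing a relation of degree j by \<open>\<alpha>\<^bsup>j\<^esup>\<close> gives a polynomial that vanishes at
  \<open>\<beta>/\<alpha>\<^sup>2\<close>; this function tends to 1 at the cusp but never takes the value 1.\<close>

lemma alpha_beta_independent:
  fixes Q :: "complex poly"
  assumes "\<And>\<tau>. alpha_fun \<tau> \<noteq> 0 \<Longrightarrow> poly Q (beta_fun \<tau> / alpha_fun \<tau> ^ 2) = 0"
  shows "Q = 0"
proof (rule ccontr)
  assume "Q \<noteq> 0"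
  \<comment> \<open>Split off all factors X - 1. They do not vanish at the values of
    \<beta>/\<alpha>^2, so the cofactor q does, and by continuity also at the limit 1.\<close>
  then obtain q where q: "Q = [:- 1, 1:] ^ Polynomial.order 1 Q * q" "\<not> [:- 1, 1:] dvd q"
    using order_decomp[of Q 1] by auto
  have ne: "beta_fun \<tau> / alpha_fun \<tau> ^ 2 \<noteq> 1" if "alpha_fun \<tau> \<noteq> 0" for \<tau>
    using disc_fun_nonzero[of \<tau>] that by (auto simp: disc_fun_def)
  have q0: "poly q (beta_fun \<tau> / alpha_fun \<tau> ^ 2) = 0" if "alpha_fun \<tau> \<noteq> 0" for \<tau>
  proof -
    have "poly Q (beta_fun \<tau> / alpha_fun \<tau> ^ 2) = (beta_fun \<tau> / alpha_fun \<tau> ^ 2 - 1) ^ Polynomial.order 1 Q * poly q (beta_fun \<tau> / alpha_fun \<tau> ^ 2)"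
      by (subst q(1)) (simp add: poly_power)
    then have "(beta_fun \<tau> / alpha_fun \<tau> ^ 2 - 1) ^ Polynomial.order 1 Q * poly q (beta_fun \<tau> / alpha_fun \<tau> ^ 2) = 0"
      using assms[OF that] by (simp only:)
    moreover have "(beta_fun \<tau> / alpha_fun \<tau> ^ 2 - 1) ^ Polynomial.order 1 Q \<noteq> 0"
      by (intro power_not_zero) (simp only: right_minus_eq ne[OF that] not_False_eq_True)
    ultimately show ?thesis by (simp only: mult_eq_0_iff) blast
  qed
  let ?t = "\<lambda>n. Abs_uhp (\<i> * of_nat (Suc n))"
  note lim = tendsto_at_cusp[OF expands_alpha] tendsto_at_cusp[OF expands_beta]
  have "(\<lambda>n. poly q (beta_fun (?t n) / alpha_fun (?t n) ^ 2)) \<longlonglongrightarrow> poly q (1 / 1 ^ 2)"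
    by (intro tendsto_intros lim) simp
  moreover have "\<forall>\<^sub>F n in sequentially. poly q (beta_fun (?t n) / alpha_fun (?t n) ^ 2) = 0"
    using tendsto_imp_eventually_ne[OF lim(1) one_neq_zero] by (rule eventually_mono) (rule q0)
  then have "(\<lambda>n. poly q (beta_fun (?t n) / alpha_fun (?t n) ^ 2)) \<longlonglongrightarrow> 0" by (rule tendsto_eventually)
  ultimately have "poly q (1 / 1 ^ 2) = 0" by (rule LIMSEQ_unique)
  then have "[:- 1, 1:] dvd q" by (simp add: poly_eq_0_iff_dvd)
  then show False using q(2) by simp
qed

lemma monom_at_indet:
  "monom_at x m = x A ^ Poly_Mapping.lookup m A * x B ^ Poly_Mapping.lookup m B"
proof -
  have "Poly_Mapping.keys m \<subseteq> {A, B}" using indet.exhaust by blast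
  then show ?thesis by (subst monom_at_superset[of "{A, B}"]) auto
qed

lemma sum_apply_fun: "sum f K x = (\<Sum>m\<in>K. f m x)" for f :: "'a \<Rightarrow> 'b \<Rightarrow> 'c::comm_monoid_add"
  by (induction K rule: infinite_finite_induct) simp_all

text \<open>Restrict the relation to the degree of one monomial and divide by a power of \<alpha>.
  The result is a polynomial in \<beta>/\<alpha>^2 with coefficients from P, since the degree and
  the exponent of B determine a monomial.\<close>

lemma eval_inj:
  assumes "eval_alpha_beta P = 0"
  shows "P = 0"
proof (rule ccontr)
  assume "P \<noteq> 0"
  then obtain m0 where m0: "m0 \<in> Poly_Mapping.keys P" 
    by (metis in_keys_iff lookup_zero poly_mapping_eqI)
  let ?a = "\<lambda>m :: indet \<Rightarrow>\<^sub>0 nat. Poly_Mapping.lookup m A"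
    and ?b = "\<lambda>m :: indet \<Rightarrow>\<^sub>0 nat. Poly_Mapping.lookup m B"
  let ?c = "\<lambda>m. of_rat (Poly_Mapping.lookup P m) :: complex"
  define w where "w m = ?a m + 2 * ?b m" for m
  define K where "K = {m \<in> Poly_Mapping.keys P. w m = w m0}"
  have fin: "finite K" by (simp add: K_def)
  have "eval_alpha_beta P = (\<Sum>m\<in>Poly_Mapping.keys P. Poly_Mapping.single (8 * int (w m))
      (\<lambda>\<tau>. ?c m * (alpha_fun \<tau> ^ ?a m * beta_fun \<tau> ^ ?b m)))"
    unfolding eval_alpha_beta_eq peval_def
    by (intro sum.cong refl)
       (simp add: monom_at_indet alpha_def beta_def single_power_fun graded_const_def mult_single times_fun_def
          w_def algebra_simps)
  then have "Poly_Mapping.lookup (eval_alpha_beta P) (8 * int (w m0))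
      = (\<Sum>m\<in>Poly_Mapping.keys P. if w m = w m0 then (\<lambda>\<tau>. ?c m * (alpha_fun \<tau> ^ ?a m * beta_fun \<tau> ^ ?b m)) else 0)"
    by (simp add: lookup_sum lookup_single when_def)
  also have "\<dots> = (\<Sum>m\<in>K. (\<lambda>\<tau>. ?c m * (alpha_fun \<tau> ^ ?a m * beta_fun \<tau> ^ ?b m)))"
    unfolding K_def by (simp add: sum.inter_filter)
  finally have "(\<Sum>m\<in>K. (\<lambda>\<tau>. ?c m * (alpha_fun \<tau> ^ ?a m * beta_fun \<tau> ^ ?b m))) = 0"
    using assms by simp
  then have zero: "(\<Sum>m\<in>K. ?c m * (alpha_fun \<tau> ^ ?a m * beta_fun \<tau> ^ ?b m)) = 0" for \<tau>
    using sum_apply_fun[of "\<lambda>m \<tau>. ?c m * (alpha_fun \<tau> ^ ?a m * beta_fun \<tau> ^ ?b m)" K \<tau>] by simp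
  define Q where "Q = (\<Sum>m\<in>K. Polynomial.monom (?c m) (?b m))"
  have "Q = 0"
  proof (rule alpha_beta_independent)
    fix \<tau> assume al: "alpha_fun \<tau> \<noteq> 0"
    let ?r = "beta_fun \<tau> / alpha_fun \<tau> ^ 2"
    have "alpha_fun \<tau> ^ w m0 * poly Q ?r = (\<Sum>m\<in>K. ?c m * (alpha_fun \<tau> ^ ?a m * beta_fun \<tau> ^ ?b m))"
      unfolding Q_def poly_sum sum_distrib_left
    proof (intro sum.cong refl)
      fix m assume "m \<in> K"
      then have "w m0 = ?a m + 2 * ?b m" by (simp add: K_def w_def)
      then show "alpha_fun \<tau> ^ w m0 * poly (Polynomial.monom (?c m) (?b m)) ?r
          = ?c m * (alpha_fun \<tau> ^ ?a m * beta_fun \<tau> ^ ?b m)"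
        using al by (simp add: poly_monom power_add power_divide flip: power_mult)
    qed
    then show "poly Q ?r = 0" using zero[of \<tau>] al by simp
  qed
  moreover have "Polynomial.coeff Q (?b m0) = ?c m0"
  proof -
    have "Polynomial.coeff Q (?b m0) = (\<Sum>m\<in>K. if m = m0 then ?c m0 else 0)"
      unfolding Q_def coeff_sum
    proof (intro sum.cong refl)
      fix m assume m: "m \<in> K"
      have "m = m0" if b: "?b m = ?b m0"
      proof (rule poly_mapping_eqI)
        fix v
        have "?a m = ?a m0" using m b by (simp add: K_def w_def)
        then show "Poly_Mapping.lookup m v = Poly_Mapping.lookup m0 v" using b by (cases v) auto
      qed
      then show "Polynomial.coeff (Polynomial.monom (?c m) (?b m)) (?b m0) = (if m = m0 then ?c m0 else 0)" by auto
    qed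
    also have "\<dots> = ?c m0" using m0 fin by (simp add: K_def)
    finally show ?thesis .
  qed
  ultimately show False using m0 by (simp add: in_keys_iff)
qed

lemma odd_prime_inverse_mem_Zloc:
  assumes "prime p" "p \<noteq> 2"
  shows "1 / 2 ^ n \<in> Zloc p"
proof -
  have "\<not> int p dvd 2 ^ n"
    using assms by (metis int_dvd_int_iff of_nat_numeral of_nat_power prime_dvd_power primes_dvd_imp_eq two_is_prime_nat)
  from Zloc_I[OF this, of 1] show ?thesis by simp
qed

lemma eval_ring_iso:
  assumes p: "prime p" "p \<noteq> 2"
  shows "eval_alpha_beta \<in> ring_iso (ring_of (polys_over (Zloc p))) (ring_of (MG (of_rat ` Zloc p)))"
proof -
  have Z: "unital_subring (Zloc p)" using p(1) by (rule unital_subring_Zloc)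
  have "256 * (1 / 2 ^ 8) = (1 :: rat)" by simp
  note surj = eval_surj[OF Z this odd_prime_inverse_mem_Zloc[OF p]]
  have "inj_on eval_alpha_beta (polys_over (Zloc p))"
  proof (rule inj_onI)
    fix P P' assume "eval_alpha_beta P = eval_alpha_beta P'"
    then show "P = P'" using eval_inj[of "P - P'"] by (simp add: eval_ab.hom_diff)
  qed
  moreover have "eval_alpha_beta ` polys_over (Zloc p) = MG (of_rat ` Zloc p)"
    using eval_mem_MG[OF Z] surj by (auto simp: image_iff)
  ultimately have "bij_betw eval_alpha_beta (polys_over (Zloc p)) (MG (of_rat ` Zloc p))"
    by (simp add: bij_betw_def)
  moreover have "eval_alpha_beta \<in> ring_hom (ring_of (polys_over (Zloc p))) (ring_of (MG (of_rat ` Zloc p)))"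
    using eval_mem_MG[OF Z] by (intro ring_hom_memI) (auto simp: ring_of_def eval_ab.hom_add eval_ab.hom_mult)
  ultimately show ?thesis by (simp add: ring_iso_def ring_of_def)
qed

section \<open>The genus\<close>

text \<open>The genus with values in Q[A, B], before automorphic forms enter. The variable k stands
  for the projective space of dimension k + 1.\<close>

definition legendre_hom :: "MUQ \<Rightarrow> indet qpoly"
  where "legendre_hom = peval qconst (\<lambda>k. if 4 dvd Suc k then legendre (Suc k div 4) else 0)"

interpretation legendre_hom: comm_ring_hom legendre_hom
  unfolding legendre_hom_def by (rule comm_ring_hom_peval[OF comm_ring_hom_qconst])

lemma legendre_hom_CP: "legendre_hom (CP l) = (if 4 dvd l then legendre (l div 4) else 0)"
  by (cases l) (simp add: CP_def legendre_0, simp add: CP_def legendre_hom_def peval_qvar[OF comm_ring_hom_qconst])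

lemma legendre_hom_qconst: "legendre_hom (qconst r) = qconst r"
  unfolding legendre_hom_def by (rule peval_qconst[OF comm_ring_hom_qconst])

lemma legendre_log_deriv_nth:
  "fps_nth legendre_log_deriv n = (if 4 dvd n then eval_alpha_beta (legendre (n div 4)) else 0)"
proof -
  have "fps_nth legendre_log_deriv n
      = (\<Sum>i=0..n. eval_alpha_beta (legendre i) * (if n = 4 * i then 1 else 0))"
    by (simp add: legendre_log_deriv_def fps_compose_nth flip: power_mult)
  also have "\<dots> = (\<Sum>i=0..n. if i = n div 4 then (if 4 dvd n then eval_alpha_beta (legendre (n div 4)) else 0) else 0)"
    by (intro sum.cong) auto
  finally show ?thesis by simp
qed

lemma rational_genus_hom:
  assumes "\<phi> \<in> rational_genera R"
  shows "comm_ring_hom \<phi>"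
  using assms by unfold_locales (auto simp: rational_genera_def ring_hom_def ring_of_def)

lemma is_legendre_genus_iff:
  "is_legendre_genus \<phi> \<longleftrightarrow> \<phi> \<in> rational_genera \<rat> \<and>
    (\<forall>l. \<phi> (CP l) = (if 4 dvd l then eval_alpha_beta (legendre (l div 4)) else 0))"
proof -
  interpret gc: comm_ring_hom graded_const by (rule comm_ring_hom_graded_const)
  have "fps_nth (fps_deriv (genus_log \<phi>)) l = \<phi> (CP l)" for l
  proof -
    have "of_nat (l + 1) * graded_const (1 / of_nat (l + 1)) = 1"
      unfolding gc.hom_of_nat[symmetric] gc.hom_mult[symmetric] by simp
    moreover have "fps_nth (fps_deriv (genus_log \<phi>)) l = (of_nat (l + 1) * graded_const (1 / of_nat (l + 1))) * \<phi> (CP l)"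
      by (simp add: genus_log_def mult.assoc)
    ultimately show ?thesis by simp
  qed
  then show ?thesis by (simp add: is_legendre_genus_def fps_eq_iff legendre_log_deriv_nth)
qed

text \<open>A ring homomorphism out of a rational polynomial ring is determined by the variables; on
  constants there is no choice by \<open>qpoly_hom_of_rat\<close>.\<close>

lemma legendre_genus_unique:
  assumes "is_legendre_genus \<phi>"
  shows "\<phi> = (\<lambda>x. eval_alpha_beta (legendre_hom x))"
proof
  fix x
  have \<phi>: "comm_ring_hom \<phi>" using assms rational_genus_hom is_legendre_genus_iff by blast
  have \<psi>: "comm_ring_hom (\<lambda>x. eval_alpha_beta (legendre_hom x))"
    using eval_ab.comm_ring_hom_axioms legendre_hom.comm_ring_hom_axioms by (rule comm_ring_hom_comp)
  have var: "\<phi> (qvar v) = eval_alpha_beta (legendre_hom (qvar v))" for v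
    using assms legendre_hom_CP[of "Suc v"] by (auto simp: is_legendre_genus_iff CP_def dest!: spec[of _ "Suc v"])
  have "\<phi> x = peval graded_const (\<lambda>v. \<phi> (qvar v)) x"
    by (subst hom_eq_peval[OF \<phi>]) (simp add: qpoly_hom_of_rat[OF \<phi> comm_ring_hom_graded_const])
  also have "\<dots> = eval_alpha_beta (legendre_hom x)"
    by (subst hom_eq_peval[OF \<psi>]) (simp add: qpoly_hom_of_rat[OF \<psi> comm_ring_hom_graded_const] var)
  finally show "\<phi> x = eval_alpha_beta (legendre_hom x)" .
qed

lemma legendre_genus_exists: "is_legendre_genus (\<lambda>x. eval_alpha_beta (legendre_hom x))"
proof -
  have "unital_subring (UNIV :: rat set)" by (rule unital_subring_UNIV)
  from eval_mem_MG[OF this] have "eval_alpha_beta P \<in> MG \<rat>" for P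
    by (simp add: polys_over_def Rats_def)
  then show ?thesis
    unfolding is_legendre_genus_iff rational_genera_def
    by (intro conjI ring_hom_memI)
       (auto simp: ring_of_def eval_ab.hom_add eval_ab.hom_mult legendre_hom.hom_add legendre_hom.hom_mult legendre_hom_CP)
qed

text \<open>The genus maps \<open>ell p n\<close> to the Legendre polynomial of index (p^n - 1)/4
  divided by p^n, a central coefficient, and preserves Hazewinkel's relation. As p is odd, (A^2 -
  B)/4 is p-integral.\<close>

lemma hazewinkel_integral:
  assumes p: "prime p" "p mod 4 = 1" and n: "n \<ge> 1"
  shows "legendre_hom (hazewinkel p n) \<in> polys_over (Zloc p)"
proof -
  let ?S = "polys_over (Zloc p) :: indet qpoly set"
  let ?d = "(vA ^ 2 - vB) * qconst (1/4)"
  interpret Z: unital_subring "Zloc p" using p(1) by (rule unital_subring_Zloc)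
  interpret S: unital_subring ?S by (rule unital_subring_polys_over) (rule Z.unital_subring_axioms)
  have p2: "p \<noteq> 2" using p(2) by auto
  have "1 / 4 \<in> Zloc p" using odd_prime_inverse_mem_Zloc[OF p(1) p2, of 2] by simp
  then have mem: "vA \<in> ?S" "?d \<in> ?S"
    by (auto intro!: S.mult_mem S.diff_mem S.power_mem qvar_mem_polys_over qconst_mem_polys_over)
  show ?thesis
  proof (rule central_hazewinkel_integral[OF frobenius_lift_frob[OF p(1)] p mem, where l = "\<lambda>n. legendre_hom (ell p n)"])
    fix n
    have "p ^ n mod 4 = 1" by (metis p(2) power_mod power_one mod_less one_less_numeral_iff semiring_norm(76))
    then have "4 dvd p ^ n - 1" by presburger
    then show "legendre_hom (ell p n) = qconst (1 / of_nat p) ^ n * trinom_poly vA ?d ((p ^ n - 1) div 4)"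
      by (simp add: ell_def legendre_hom.hom_mult legendre_hom_qconst legendre_hom_CP legendre_eq_trinom_poly
          power_one_over flip: qconst.hom_power)
  next
    fix n :: nat assume "n \<ge> 1"
    from arg_cong[OF hazewinkel_relation[OF this, of p], of legendre_hom]
    show "of_nat p * legendre_hom (ell p n) = (\<Sum>j<n. legendre_hom (ell p j) * legendre_hom (hazewinkel p (n - j)) ^ (p ^ j))"
      by (simp add: legendre_hom.hom_mult legendre_hom.hom_sum legendre_hom.hom_power)
  qed (rule n)
qed

lemma a_inv_ring_of: "\<ominus>\<^bsub>ring_of UNIV\<^esub> x = - x"
proof -
  interpret cring "ring_of (UNIV :: 'a set)" by (rule cring_ring_of_UNIV)
  show ?thesis by (rule minus_equality) (simp_all add: ring_of_def)
qed

lemma legendre_hom_BP: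
  assumes p: "prime p" "p mod 4 = 1" and x: "x \<in> BP p"
  shows "legendre_hom x \<in> polys_over (Zloc p)"
proof -
  interpret Z: unital_subring "Zloc p" using p(1) by (rule unital_subring_Zloc)
  interpret S: unital_subring "polys_over (Zloc p) :: indet qpoly set"
    by (rule unital_subring_polys_over) (rule Z.unital_subring_axioms)
  from x show ?thesis unfolding BP_def
  proof (induction rule: generate_ring.induct)
    case one
    then show ?case by (simp add: ring_of_def)
  next
    case (incl h)
    then show ?case using hazewinkel_integral[OF p] by (auto simp: legendre_hom_qconst intro!: qconst_mem_polys_over)
  next
    case (a_inv h)
    then show ?case by (simp add: a_inv_ring_of legendre_hom.hom_uminus S.uminus_mem)
  next
    case (eng_add h1 h2)
    then show ?case by (simp add: ring_of_def legendre_hom.hom_add S.add_mem)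
  next
    case (eng_mult h1 h2)
    then show ?case by (simp add: ring_of_def legendre_hom.hom_mult S.mult_mem)
  qed
qed

theorem mainTheorem1:
  shows "(\<exists>!\<phi>. is_legendre_genus \<phi>) \<and>
    (\<forall>\<phi>. is_legendre_genus \<phi> \<longrightarrow>
      (\<forall>l. \<phi> (CP l) = (if 4 dvd l then eval_alpha_beta (legendre (l div 4)) else 0)) \<and>
      (\<forall>p::nat. prime p \<and> p mod 4 = 1 \<longrightarrow>
        \<phi> ` BP p \<subseteq> MG (of_rat ` Zloc p) \<and>
        eval_alpha_beta \<in> ring_iso (ring_of (polys_over (Zloc p))) (ring_of (MG (of_rat ` Zloc p)))))"
proof (intro conjI allI impI)
  show "\<exists>!\<phi>. is_legendre_genus \<phi>"
    by (rule ex1I, rule legendre_genus_exists, rule legendre_genus_unique)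
next
  fix \<phi> l
  assume "is_legendre_genus \<phi>"
  then show "\<phi> (CP l) = (if 4 dvd l then eval_alpha_beta (legendre (l div 4)) else 0)"
    by (simp add: is_legendre_genus_iff)
next
  fix \<phi> and p :: nat
  assume \<phi>: "is_legendre_genus \<phi>" and p: "prime p \<and> p mod 4 = 1"
  then have "unital_subring (Zloc p)" by (simp add: unital_subring_Zloc)
  then show "\<phi> ` BP p \<subseteq> MG (of_rat ` Zloc p)"
    unfolding legendre_genus_unique[OF \<phi>] using p legendre_hom_BP by (auto intro: eval_mem_MG)
  show "eval_alpha_beta \<in> ring_iso (ring_of (polys_over (Zloc p))) (ring_of (MG (of_rat ` Zloc p)))"
    using p by (intro eval_ring_iso) auto
qed

end
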